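(* Let $G$ be a hyperbolic group. Then the search variation of the subset sum problem $\mathbf{SSP}(G)$ is solvable in polynomial time.
   Context: Fix a finite generating set $X$ of $G$. Elements of $G$ are given as words over $X\cup X^{-1}$, and the size of a tuple of words is the sum of their lengths. The search variation of $\mathbf{SSP}(G)$: given $g_1,\ldots,g_k,g\in G$, decide whether there exist $\varepsilon_1,\ldots,\varepsilon_k\in\{0,1\}$ with $g=g_1^{\varepsilon_1}\cdots g_k^{\varepsilon_k}$ in $G$ and, if so, find such $\varepsilon_1,\ldots,\varepsilon_k$. The group $G$ is fixed (not part of the input).
   Formalization: The size of an instance is taken as the sum of the word lengths plus k, since with empty words among the g_i the bare sum does not bound the k output bits; if all g_i are nonempty words, the bound is polynomial in the sum of lengths. *)

theory Defs
  imports "HOL-Algebra.Generated_Groups" "HOL-Computational_Algebra.Polynomial"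
begin

section \<open>Words over a generating set\<close>

datatype 'a letter = Pos 'a | Neg 'a

definition letters :: "'a set \<Rightarrow> 'a letter set" where
  "letters X = Pos ` X \<union> Neg ` X"

fun letter_val :: "('a, 'm) monoid_scheme \<Rightarrow> 'a letter \<Rightarrow> 'a" where
  "letter_val G (Pos x) = x"
| "letter_val G (Neg x) = inv\<^bsub>G\<^esub> x"

fun word_val :: "('a, 'm) monoid_scheme \<Rightarrow> 'a letter list \<Rightarrow> 'a" where
  "word_val G [] = \<one>\<^bsub>G\<^esub>"
| "word_val G (l # w) = letter_val G l \<otimes>\<^bsub>G\<^esub> word_val G w"

definition finite_generating_set :: "('a, 'm) monoid_scheme \<Rightarrow> 'a set \<Rightarrow> bool" where
  "finite_generating_set G X \<longleftrightarrow>
     finite X \<and> X \<subseteq> carrier G \<and> generate G X = carrier G"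


section \<open>Hyperbolic groups\<close>

text \<open>The least element below is only meaningful for elements of the subgroup generated by X.\<close>

definition word_length :: "('a, 'm) monoid_scheme \<Rightarrow> 'a set \<Rightarrow> 'a \<Rightarrow> nat" where
  "word_length G X g =
     (LEAST n. \<exists>w \<in> lists (letters X). length w = n \<and> word_val G w = g)"

definition word_dist :: "('a, 'm) monoid_scheme \<Rightarrow> 'a set \<Rightarrow> 'a \<Rightarrow> 'a \<Rightarrow> real" where
  "word_dist G X g h = real (word_length G X (inv\<^bsub>G\<^esub> g \<otimes>\<^bsub>G\<^esub> h))"

definition gromov_product :: "('a \<Rightarrow> 'a \<Rightarrow> real) \<Rightarrow> 'a \<Rightarrow> 'a \<Rightarrow> 'a \<Rightarrow> real" where
  "gromov_product d b x y = (d x b + d y b - d x y) / 2"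

text \<open>Gromov's definition: a metric space is \<open>\<delta>\<close>-hyperbolic if the following inequality
  holds for all points and all base points, and a finitely generated group is hyperbolic if,
  for some finite generating set and some \<open>\<delta>\<close>, it is \<open>\<delta>\<close>-hyperbolic in its word metric.\<close>

definition gromov_hyperbolic :: "'a set \<Rightarrow> ('a \<Rightarrow> 'a \<Rightarrow> real) \<Rightarrow> real \<Rightarrow> bool" where
  "gromov_hyperbolic M d \<delta> \<longleftrightarrow>
     (\<forall>b\<in>M. \<forall>x\<in>M. \<forall>y\<in>M. \<forall>z\<in>M.
        gromov_product d b x z \<ge> min (gromov_product d b x y) (gromov_product d b y z) - \<delta>)"

definition hyperbolic_group :: "('a, 'm) monoid_scheme \<Rightarrow> bool" where
  "hyperbolic_group G \<longleftrightarrow>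
     group G \<and>
     (\<exists>Y \<delta>. finite_generating_set G Y \<and> gromov_hyperbolic (carrier G) (word_dist G Y) \<delta>)"


section \<open>Deterministic multi-tape Turing machines\<close>

text \<open>The types of states and tape symbols are infinite; finiteness of a particular machine is
  imposed by \<open>wf_TM\<close>. Tape symbols are the blank, the input and output symbols, and auxiliary
  work symbols.\<close>

datatype 's tape_sym = Blank | Sym 's | Work nat

datatype move = Left | Stay | Right

record 's TM =
  ntapes :: nat
  states :: "nat set"
  tape_alphabet :: "'s tape_sym set"
  start_state :: nat
  halt_state :: nat
  trans :: "nat \<Rightarrow> 's tape_sym list \<Rightarrow> nat \<times> ('s tape_sym \<times> move) list"

definition wf_TM :: "'s set \<Rightarrow> 's TM \<Rightarrow> bool" where
  "wf_TM \<Sigma> M \<longleftrightarrow>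
     ntapes M \<ge> 1 \<and>
     finite (states M) \<and> start_state M \<in> states M \<and> halt_state M \<in> states M \<and>
     finite (tape_alphabet M) \<and> Blank \<in> tape_alphabet M \<and> Sym ` \<Sigma> \<subseteq> tape_alphabet M \<and>
     (\<forall>q \<in> states M - {halt_state M}. \<forall>as \<in> lists (tape_alphabet M).
        length as = ntapes M \<longrightarrow>
        fst (trans M q as) \<in> states M \<and>
        length (snd (trans M q as)) = ntapes M \<and>
        fst ` set (snd (trans M q as)) \<subseteq> tape_alphabet M)"

text \<open>A tape is two-way infinite and consists of its contents and the position of the head.\<close>

type_synonym 's tape = "(int \<Rightarrow> 's tape_sym) \<times> int"

type_synonym 's config = "nat \<times> 's tape list"

definition tape_read :: "'s tape \<Rightarrow> 's tape_sym" where
  "tape_read tp = fst tp (snd tp)"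

fun move_offset :: "move \<Rightarrow> int" where
  "move_offset Left = - 1"
| "move_offset Stay = 0"
| "move_offset Right = 1"

definition tape_act :: "'s tape_sym \<times> move \<Rightarrow> 's tape \<Rightarrow> 's tape" where
  "tape_act am tp = ((fst tp)(snd tp := fst am), snd tp + move_offset (snd am))"

definition TM_step :: "'s TM \<Rightarrow> 's config \<Rightarrow> 's config" where
  "TM_step M c =
     (if fst c = halt_state M then c
      else let (q, ams) = trans M (fst c) (map tape_read (snd c))
           in (q, map2 tape_act ams (snd c)))"

definition word_contents :: "'s list \<Rightarrow> int \<Rightarrow> 's tape_sym" where
  "word_contents x i = (if 0 \<le> i \<and> i < int (length x) then Sym (x ! nat i) else Blank)"

definition TM_init :: "'s TM \<Rightarrow> 's list \<Rightarrow> 's config" where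
  "TM_init M x =
     (start_state M, (word_contents x, 0) # replicate (ntapes M - 1) (\<lambda>_. Blank, 0))"

text \<open>The output is the contents of the first tape.\<close>

definition TM_outputs_after :: "'s TM \<Rightarrow> 's list \<Rightarrow> nat \<Rightarrow> 's list \<Rightarrow> bool" where
  "TM_outputs_after M x t y \<longleftrightarrow>
     (let c = (TM_step M ^^ t) (TM_init M x)
      in fst c = halt_state M \<and> fst (hd (snd c)) = word_contents y)"

text \<open>A search problem has a set \<open>I\<close> of instances and a relation \<open>R\<close> saying which answers are
  correct. Solving it in polynomial time means that one machine and one polynomial work for all
  instances: the machine halts on the encoding of the instance, within a number of steps
  polynomial in the length of this encoding, with the encoding of a correct answer as output.\<close>

definition poly_time_search ::
  "'s set \<Rightarrow> ('i \<Rightarrow> 's list) \<Rightarrow> ('o \<Rightarrow> 's list) \<Rightarrow> 'i set \<Rightarrow> ('i \<Rightarrow> 'o \<Rightarrow> bool) \<Rightarrow> bool" where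
  "poly_time_search \<Sigma> enc_in enc_out I R \<longleftrightarrow>
     (\<exists>M (p :: nat poly). wf_TM \<Sigma> M \<and>
        (\<forall>i\<in>I. \<exists>ans t. R i ans \<and> t \<le> poly p (length (enc_in i)) \<and>
           TM_outputs_after M (enc_in i) t (enc_out ans)))"


section \<open>The subset sum problem\<close>

text \<open>An instance is a pair of the list of words \<open>g\<^sub>1, \<dots>, g\<^sub>k\<close> and the word \<open>g\<close>.\<close>

type_synonym 'a ssp_instance = "'a letter list list \<times> 'a letter list"

definition ssp_instances :: "'a set \<Rightarrow> 'a ssp_instance set" where
  "ssp_instances X = lists (lists (letters X)) \<times> lists (letters X)"

fun subset_product :: "('a, 'm) monoid_scheme \<Rightarrow> 'a list \<Rightarrow> bool list \<Rightarrow> 'a" where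
  "subset_product G (g # gs) (e # es) =
     g [^]\<^bsub>G\<^esub> (of_bool e :: nat) \<otimes>\<^bsub>G\<^esub> subset_product G gs es"
| "subset_product G _ _ = \<one>\<^bsub>G\<^esub>"

definition ssp_solution ::
  "('a, 'm) monoid_scheme \<Rightarrow> 'a ssp_instance \<Rightarrow> bool list \<Rightarrow> bool" where
  "ssp_solution G i \<epsilon> \<longleftrightarrow>
     length \<epsilon> = length (fst i) \<and>
     word_val G (snd i) = subset_product G (map (word_val G) (fst i)) \<epsilon>"

text \<open>The answer \<open>None\<close> is the claim that there is no solution.\<close>

fun ssp_correct_answer ::
  "('a, 'm) monoid_scheme \<Rightarrow> 'a ssp_instance \<Rightarrow> bool list option \<Rightarrow> bool" where
  "ssp_correct_answer G i (Some \<epsilon>) \<longleftrightarrow> ssp_solution G i \<epsilon>"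
| "ssp_correct_answer G i None \<longleftrightarrow> \<not> (\<exists>\<epsilon>. ssp_solution G i \<epsilon>)"

datatype 'a ssp_sym = Letter "'a letter" | Sep | Bit bool

definition ssp_alphabet :: "'a set \<Rightarrow> 'a ssp_sym set" where
  "ssp_alphabet X = Letter ` letters X \<union> {Sep, Bit False, Bit True}"

text \<open>Each of the words \<open>g\<^sub>1, \<dots>, g\<^sub>k\<close> is followed by a separator. The length of the encoding is
  thus the sum of the lengths of all the words plus \<open>k\<close>; the summand \<open>k\<close> only matters if there
  are empty words among the \<open>g\<^sub>i\<close>, which the sum of the lengths would not account for.\<close>

definition encode_instance :: "'a ssp_instance \<Rightarrow> 'a ssp_sym list" where
  "encode_instance i =
     concat (map (\<lambda>w. map Letter w @ [Sep]) (fst i)) @ map Letter (snd i)"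

lemma length_encode_instance:
  "length (encode_instance (ws, w)) = sum_list (map length ws) + length w + length ws"
  by (induction ws) (auto simp: encode_instance_def)

text \<open>The first bit tells whether there is a solution.\<close>

fun encode_answer :: "bool list option \<Rightarrow> 'a ssp_sym list" where
  "encode_answer (Some \<epsilon>) = Bit True # map Bit \<epsilon>"
| "encode_answer None = [Bit False]"

definition ssp_search_poly_time :: "('a, 'm) monoid_scheme \<Rightarrow> 'a set \<Rightarrow> bool" where
  "ssp_search_poly_time G X \<longleftrightarrow>
     poly_time_search (ssp_alphabet X) encode_instance encode_answer
       (ssp_instances X) (ssp_correct_answer G)"

end

theory Submission
  imports Defs
begin

text \<open>A solution of an instance is a closed path in the Cayley graph that reads the selected words and
  then the inverse of the right-hand side. In a hyperbolic group a
  closed path of length \<open>n\<close> can be triangulated by diagonals of length \<open>O(log n)\<close>, and there are only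
  polynomially many words of such a length. Dynamic programming therefore decides, for every two
  positions of the input and every short word, whether some choice of the exponents between these
  positions yields the element given by the word, and it remembers one such choice. Two entries are
  combined with the help of Dehn's algorithm for the word problem.

  Polynomial time is established for functions on data that are encoded by binary trees. The class
  of these functions is closed under composition, pairing and iteration with polynomially bounded
  values, since trees in Polish notation can be handled on the stacks of a structured program, and
  such a program is a Turing machine.\<close>

section \<open>Structured programs for Turing machines\<close>

text \<open>Hyperbolicity is given for some generating set \<open>Y\<close>, whereas the input is
  written over \<open>X\<close>. Letters of \<open>X\<close> are therefore spelled over
  \<open>Y\<close>, and the bound \<open>D\<close> on the lengths of these spellings enters the
  length of the diagonals. The logarithm comes from the four-point inequality: bisecting a chain of
  \<open>2 ^ s\<close> steps costs \<delta> once per level, hence \<open>s\<close> times \<delta> in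
  all. Diagonals of length \<open>c1 * j + c2\<close>, with \<open>2 ^ j\<close> between the number
  of edges and about twice that number, leave a fixed power of \<open>2 ^ j\<close> many words.
  Exponential growth threatens at two places. There may be as many solutions as subsets, so the
  table keeps one witness for each key (source, target, short word). And iterating a polynomial-time
  function need not take polynomial time, so every loop comes with a bound on all its intermediate
  values. The machine does not compute in the group itself: shorter representatives of the finitely
  many words of length at most \<open>2 * h\<close> and the inverses of the generators are
  hard-wired as finite tables, whose mere existence is enough.\<close>

datatype 's com =
    Act nat "'s tape_sym list \<Rightarrow> 's tape_sym \<times> move"
  | Seq "'s com" "'s com" (infixr ";;" 60)
  | Cond "'s tape_sym list \<Rightarrow> bool" "'s com" "'s com"
  | While "'s tape_sym list \<Rightarrow> bool" "'s com"

text \<open>The step count agrees exactly with the compiled machine: a test takes one step, since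
  its code has a branching state of its own that leaves the tapes alone.\<close>

inductive exec :: "'s com \<Rightarrow> 's tape list \<Rightarrow> nat \<Rightarrow> 's tape list \<Rightarrow> bool" where
  exec_Act: "exec (Act j g) T 1 (T[j := tape_act (g (map tape_read T)) (T ! j)])"
| exec_Seq: "exec c T t T' \<Longrightarrow> exec d T' u T'' \<Longrightarrow> exec (c ;; d) T (t + u) T''"
| exec_CondT: "P (map tape_read T) \<Longrightarrow> exec c T t T' \<Longrightarrow> exec (Cond P c d) T (Suc t) T'"
| exec_CondF: "\<not> P (map tape_read T) \<Longrightarrow> exec d T t T' \<Longrightarrow> exec (Cond P c d) T (Suc t) T'"
| exec_WhileF: "\<not> P (map tape_read T) \<Longrightarrow> exec (While P c) T 1 T"
| exec_WhileT: "P (map tape_read T) \<Longrightarrow> exec c T t T' \<Longrightarrow> exec (While P c) T' u T'' \<Longrightarrow>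
    exec (While P c) T (Suc (t + u)) T''"

fun clen :: "'s com \<Rightarrow> nat" where
  "clen (Act j g) = 1"
| "clen (c ;; d) = clen c + clen d"
| "clen (Cond P c d) = Suc (clen c + clen d)"
| "clen (While P c) = Suc (clen c)"

abbreviation stay :: "'s tape_sym list \<Rightarrow> ('s tape_sym \<times> move) list" where
  "stay \<equiv> map (\<lambda>a. (a, Stay))"

text \<open>The code of a program occupies the states from \<open>s\<close> on, starts in \<open>s\<close> and leaves to \<open>e\<close>.\<close>

fun compile :: "'s com \<Rightarrow> nat \<Rightarrow> nat \<Rightarrow> nat \<Rightarrow> 's tape_sym list \<Rightarrow> nat \<times> ('s tape_sym \<times> move) list" where
  "compile (Act j g) s e q as = (e, (stay as)[j := g as])"
| "compile (c ;; d) s e q as =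
     (if q < s + clen c then compile c s (s + clen c) q as else compile d (s + clen c) e q as)"
| "compile (Cond P c d) s e q as =
     (if q = s then (if P as then Suc s else Suc s + clen c, stay as)
      else if q < Suc s + clen c then compile c (Suc s) e q as
      else compile d (Suc s + clen c) e q as)"
| "compile (While P c) s e q as =
     (if q = s then (if P as then Suc s else e, stay as) else compile c (Suc s) s q as)"

lemma clen_pos: "clen c > 0"
  by (induction c) auto

lemma map2_tape_act_stay: "map2 tape_act (stay (map tape_read T)) T = T"
  by (induction T) (auto simp: tape_act_def tape_read_def)

lemma map2_tape_act_update:
  "map2 tape_act ((stay (map tape_read T))[j := m]) T = T[j := tape_act m (T ! j)]"
proof (cases "j < length T")
  case True
  then show ?thesis
    by (intro nth_equalityI) (auto simp: nth_list_update tape_act_def tape_read_def)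
next
  case False
  then show ?thesis
    using map2_tape_act_stay[of T] by (simp add: list_update_beyond)
qed

lemma funpow_add_apply: "(f ^^ (t + u)) x = (f ^^ u) ((f ^^ t) x)"
  by (metis add.commute comp_apply funpow_add)

text \<open>Only the transitions inside the block of \<open>c\<close> are constrained and the exit
  \<open>e\<close> is arbitrary, so that the induction applies to the parts of a compound program;
  the exit of a loop body is the loop head itself. The states of the block must not be the halting
  state, because \<open>TM_step\<close> does nothing there.\<close>

lemma compile_correct:
  assumes "exec c T t T'"
    and "\<And>q. s \<le> q \<Longrightarrow> q < s + clen c \<Longrightarrow> trans M q = compile c s e q \<and> q \<noteq> halt_state M"
  shows "(TM_step M ^^ t) (s, T) = (e, T')"
  using assms
proof (induction arbitrary: s e rule: exec.induct)
  case (exec_Act j g T)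
  then show ?case
    by (simp add: TM_step_def map2_tape_act_update del: map_map)
next
  case (exec_Seq c T t T' d u T'')
  have "(TM_step M ^^ t) (s, T) = (s + clen c, T')"
    by (rule exec_Seq.IH) (use exec_Seq.prems in \<open>auto simp: fun_eq_iff\<close>)
  moreover have "(TM_step M ^^ u) (s + clen c, T') = (e, T'')"
    by (rule exec_Seq.IH) (use exec_Seq.prems in \<open>auto simp: fun_eq_iff\<close>)
  ultimately show ?case
    by (simp add: funpow_add_apply)
next
  case (exec_CondT P T c t T' d)
  have "TM_step M (s, T) = (Suc s, T)"
    using exec_CondT.prems[of s] exec_CondT.hyps by (simp add: TM_step_def map2_tape_act_stay del: map_map)
  moreover have "(TM_step M ^^ t) (Suc s, T) = (e, T')"
    by (rule exec_CondT.IH) (use exec_CondT.prems in \<open>auto simp: fun_eq_iff\<close>)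
  ultimately show ?case
    by (simp only: funpow_Suc_right comp_apply)
next
  case (exec_CondF P T d t T' c)
  have "TM_step M (s, T) = (Suc s + clen c, T)"
    using exec_CondF.prems[of s] exec_CondF.hyps by (simp add: TM_step_def map2_tape_act_stay del: map_map)
  moreover have "(TM_step M ^^ t) (Suc s + clen c, T) = (e, T')"
    by (rule exec_CondF.IH) (use exec_CondF.prems in \<open>auto simp: fun_eq_iff\<close>)
  ultimately show ?case
    by (simp only: funpow_Suc_right comp_apply)
next
  case (exec_WhileF P T c)
  then show ?case
    by (simp add: TM_step_def map2_tape_act_stay del: map_map)
next
  case (exec_WhileT P T c t T' u T'')
  have "TM_step M (s, T) = (Suc s, T)"
    using exec_WhileT.prems[of s] exec_WhileT.hyps by (simp add: TM_step_def map2_tape_act_stay del: map_map)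
  moreover have "(TM_step M ^^ t) (Suc s, T) = (s, T')"
    by (rule exec_WhileT.IH) (use exec_WhileT.prems in \<open>auto simp: fun_eq_iff\<close>)
  moreover have "(TM_step M ^^ u) (s, T') = (e, T'')"
    by (rule exec_WhileT.IH) (use exec_WhileT.prems in \<open>auto simp: fun_eq_iff\<close>)
  ultimately show ?case
    by (simp only: funpow_Suc_right comp_apply funpow_add_apply)
qed

fun wf_com :: "'s tape_sym set \<Rightarrow> nat \<Rightarrow> 's com \<Rightarrow> bool" where
  "wf_com \<Gamma> k (Act j g) \<longleftrightarrow> (\<forall>as \<in> lists \<Gamma>. length as = k \<longrightarrow> fst (g as) \<in> \<Gamma>)"
| "wf_com \<Gamma> k (c ;; d) \<longleftrightarrow> wf_com \<Gamma> k c \<and> wf_com \<Gamma> k d"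
| "wf_com \<Gamma> k (Cond P c d) \<longleftrightarrow> wf_com \<Gamma> k c \<and> wf_com \<Gamma> k d"
| "wf_com \<Gamma> k (While P c) \<longleftrightarrow> wf_com \<Gamma> k c"

lemma compile_wf:
  assumes "wf_com \<Gamma> k c" "as \<in> lists \<Gamma>" "length as = k" "s \<le> q" "q < s + clen c"
  shows "fst (compile c s e q as) \<in> insert e {s..<s + clen c}"
    and "length (snd (compile c s e q as)) = k"
    and "fst ` set (snd (compile c s e q as)) \<subseteq> \<Gamma>"
proof -
  have stay: "fst ` set (stay as) \<subseteq> \<Gamma>"
    using assms(2) by auto
  have "fst (compile c s e q as) \<in> insert e {s..<s + clen c} \<and>
        length (snd (compile c s e q as)) = k \<and> fst ` set (snd (compile c s e q as)) \<subseteq> \<Gamma>"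
    using assms
  proof (induction c arbitrary: s e)
    case (Act j g)
    have g: "fst (g as) \<in> \<Gamma>"
      using Act.prems(1,2,3) by simp
    have "fst m \<in> \<Gamma>" if "m \<in> set ((stay as)[j := g as])" for m
    proof -
      have "m \<in> insert (g as) (set (stay as))"
        using that set_update_subset_insert by fast
      then show ?thesis
        using g stay by auto
    qed
    then have "fst ` set ((stay as)[j := g as]) \<subseteq> \<Gamma>"
      by (intro image_subsetI)
    then show ?case
      using Act.prems(3) by simp
  next
    case (Seq c d)
    show ?case
    proof (cases "q < s + clen c")
      case True
      with Seq.IH(1)[of s "s + clen c"] Seq.prems clen_pos[of d] show ?thesis
        by auto
    next
      case False
      with Seq.IH(2)[of "s + clen c" e] Seq.prems show ?thesis
        by auto
    qed
  next
    case (Cond P c d)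
    consider "q = s" | "s < q" "q < Suc s + clen c" | "Suc s + clen c \<le> q"
      using Cond.prems by linarith
    then show ?case
    proof cases
      case 1
      then show ?thesis
        using Cond.prems stay clen_pos[of c] clen_pos[of d] by auto
    next
      case 2
      with Cond.IH(1)[of "Suc s" e] Cond.prems show ?thesis
        by auto
    next
      case 3
      with Cond.IH(2)[of "Suc s + clen c" e] Cond.prems show ?thesis
        by auto
    qed
  next
    case (While P c)
    show ?case
    proof (cases "q = s")
      case True
      then show ?thesis
        using While.prems stay clen_pos[of c] by auto
    next
      case False
      with While.IH[of "Suc s" s] While.prems show ?thesis
        by auto
    qed
  qed
  then show "fst (compile c s e q as) \<in> insert e {s..<s + clen c}"
    "length (snd (compile c s e q as)) = k"
    "fst ` set (snd (compile c s e q as)) \<subseteq> \<Gamma>"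
    by auto
qed

definition machine :: "nat \<Rightarrow> 's tape_sym set \<Rightarrow> 's com \<Rightarrow> 's TM" where
  "machine k \<Gamma> c = \<lparr>ntapes = k, states = {..clen c}, tape_alphabet = \<Gamma>, start_state = 0,
     halt_state = clen c, trans = compile c 0 (clen c)\<rparr>"

lemma wf_machine:
  assumes "wf_com \<Gamma> k c" "finite \<Gamma>" "Blank \<in> \<Gamma>" "Sym ` \<Sigma> \<subseteq> \<Gamma>" "k \<ge> 1"
  shows "wf_TM \<Sigma> (machine k \<Gamma> c)"
proof -
  have "fst (compile c 0 (clen c) q as) \<le> clen c"
    "length (snd (compile c 0 (clen c) q as)) = k"
    "fst ` set (snd (compile c 0 (clen c) q as)) \<subseteq> \<Gamma>"
    if "as \<in> lists \<Gamma>" "length as = k" "q < clen c" for q as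
    using compile_wf[OF assms(1), of as 0 q "clen c"] that by auto
  then show ?thesis
    using assms by (auto simp: wf_TM_def machine_def order.strict_iff_order)
qed

lemma machine_outputs:
  assumes "exec c ((word_contents x, 0) # replicate (k - 1) (\<lambda>_. Blank, 0)) t T"
    and "fst (hd T) = word_contents y"
  shows "TM_outputs_after (machine k \<Gamma> c) x t y"
  using compile_correct[OF assms(1), of 0 "machine k \<Gamma> c" "clen c"] assms(2)
  by (simp add: TM_outputs_after_def TM_init_def machine_def Let_def)

subsection \<open>Stacks\<close>

text \<open>Exact running times depend on the data in the loops; upper bounds compose just as well
  and can be rounded to simple expressions.\<close>

definition runs :: "'s com \<Rightarrow> 's tape list \<Rightarrow> nat \<Rightarrow> 's tape list \<Rightarrow> bool" where
  "runs c T t T' \<longleftrightarrow> (\<exists>t' \<le> t. exec c T t' T')"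

lemma runs_mono: "runs c T t T' \<Longrightarrow> t \<le> u \<Longrightarrow> runs c T u T'"
  unfolding runs_def using order_trans by blast

lemma exec_runs: "exec c T t T' \<Longrightarrow> runs c T t T'"
  unfolding runs_def by blast

lemma runs_Seq: "runs c T t T' \<Longrightarrow> runs d T' u T'' \<Longrightarrow> runs (c ;; d) T (t + u) T''"
  unfolding runs_def using exec_Seq add_mono by meson

lemma runs_CondT: "P (map tape_read T) \<Longrightarrow> runs c T t T' \<Longrightarrow> runs (Cond P c d) T (Suc t) T'"
  unfolding runs_def using exec_CondT Suc_le_mono by meson

lemma runs_CondF: "\<not> P (map tape_read T) \<Longrightarrow> runs d T t T' \<Longrightarrow> runs (Cond P c d) T (Suc t) T'"
  unfolding runs_def using exec_CondF Suc_le_mono by meson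

lemma runs_WhileF: "\<not> P (map tape_read T) \<Longrightarrow> runs (While P c) T 1 T"
  unfolding runs_def using exec_WhileF by blast

lemma runs_WhileT:
  "P (map tape_read T) \<Longrightarrow> runs c T t T' \<Longrightarrow> runs (While P c) T' u T'' \<Longrightarrow>
   runs (While P c) T (Suc (t + u)) T''"
  unfolding runs_def using exec_WhileT Suc_le_mono add_mono by meson

text \<open>The head is on the topmost symbol; a blank under the head means that the stack is empty.\<close>

definition stk :: "'s tape_sym list \<Rightarrow> 's tape" where
  "stk xs = (\<lambda>i. if 1 \<le> i \<and> i \<le> int (length xs) then rev xs ! nat (i - 1) else Blank,
             int (length xs))"

fun top :: "'s tape_sym list \<Rightarrow> 's tape_sym" where
  "top [] = Blank"
| "top (x # xs) = x"

lemma tape_read_stk [simp]: "tape_read (stk xs) = top xs"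
  by (cases xs) (auto simp: tape_read_def stk_def nth_append)

text \<open>An action writes before it moves, so a push takes two actions: rewrite the old top while
  moving right, then write the new symbol on the blank cell reached.\<close>

lemma stk_push: "tape_act (a, Stay) (tape_act (top xs, Right) (stk xs)) = stk (a # xs)"
proof -
  have "fst (tape_act (top xs, Right) (stk xs)) = fst (stk xs)"
    using tape_read_stk[of xs] by (auto simp: tape_act_def tape_read_def)
  then show ?thesis
    by (auto simp: tape_act_def stk_def fun_eq_iff nth_append)
qed

lemma stk_pop: "tape_act (Blank, Left) (stk (x # xs)) = stk xs"
  by (auto simp: tape_act_def stk_def fun_eq_iff nth_append)

text \<open>Tape 0 holds the input and the output, the other four tapes are used as stacks.\<close>

definition cfg :: "'s tape \<Rightarrow> (nat \<Rightarrow> 's tape_sym list) \<Rightarrow> 's tape list" where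
  "cfg tp ss = tp # map (\<lambda>j. stk (ss j)) [0..<4]"

lemma length_cfg [simp]: "length (cfg tp ss) = 5"
  by (simp add: cfg_def)

lemma cfg_reads:
  "map tape_read (cfg tp ss) ! 0 = tape_read tp"
  "j < 4 \<Longrightarrow> map tape_read (cfg tp ss) ! Suc j = top (ss j)"
  by (simp_all add: cfg_def)

lemma cfg_nth: "j < 4 \<Longrightarrow> cfg tp ss ! Suc j = stk (ss j)" "cfg tp ss ! 0 = tp"
  by (simp_all add: cfg_def)

lemma cfg_update_stk: "j < 4 \<Longrightarrow> (cfg tp ss)[Suc j := stk xs] = cfg tp (ss(j := xs))"
  by (rule nth_equalityI) (auto simp: cfg_def nth_list_update nth_Cons')

lemma cfg_update_tape: "(cfg tp ss)[0 := tp'] = cfg tp' ss"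
  by (simp add: cfg_def)

definition push_from :: "nat \<Rightarrow> ('s tape_sym list \<Rightarrow> 's tape_sym) \<Rightarrow> 's com" where
  "push_from j g = Act (Suc j) (\<lambda>as. (as ! Suc j, Right)) ;; Act (Suc j) (\<lambda>as. (g as, Stay))"

definition push :: "nat \<Rightarrow> 's tape_sym \<Rightarrow> 's com" where
  "push j a = push_from j (\<lambda>_. a)"

definition copy_top :: "nat \<Rightarrow> nat \<Rightarrow> 's com" where
  "copy_top i j = push_from j (\<lambda>as. as ! Suc i)"

definition pop :: "nat \<Rightarrow> 's com" where
  "pop j = Act (Suc j) (\<lambda>as. (Blank, Left))"

text \<open>When \<open>g\<close> is evaluated, the head of stack \<open>j\<close> has already moved
  on to a blank cell. The second assumption therefore asks that the value be independent of what is
  read on that tape.\<close>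

lemma runs_push_from:
  assumes "j < 4" and "\<And>b. g ((map tape_read (cfg tp ss))[Suc j := b]) = a"
  shows "runs (push_from j g) (cfg tp ss) 2 (cfg tp (ss(j := a # ss j)))"
proof -
  let ?T = "cfg tp ss"
  let ?t = "tape_act (top (ss j), Right) (stk (ss j))"
  have "exec (Act (Suc j) (\<lambda>as. (as ! Suc j, Right))) ?T 1 (?T[Suc j := ?t])"
    using exec_Act[of "Suc j" "\<lambda>as. (as ! Suc j, Right)" ?T] assms(1)
    by (simp add: cfg_reads cfg_nth del: nth_map)
  moreover have "exec (Act (Suc j) (\<lambda>as. (g as, Stay))) (?T[Suc j := ?t]) 1
     (?T[Suc j := ?t, Suc j := tape_act (a, Stay) ?t])"
    using exec_Act[of "Suc j" "\<lambda>as. (g as, Stay)" "?T[Suc j := ?t]"] assms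
    by (simp add: map_update del: list_update_overwrite)
  ultimately have "exec (push_from j g) ?T (1 + 1) (cfg tp (ss(j := a # ss j)))"
    using exec_Seq assms(1) unfolding push_from_def by (fastforce simp: stk_push cfg_update_stk)
  then show ?thesis
    using exec_runs by (metis one_add_one)
qed

lemma runs_push: "j < 4 \<Longrightarrow> runs (push j a) (cfg tp ss) 2 (cfg tp (ss(j := a # ss j)))"
  unfolding push_def by (rule runs_push_from) auto

lemma runs_copy_top:
  "i < 4 \<Longrightarrow> j < 4 \<Longrightarrow> i \<noteq> j \<Longrightarrow>
   runs (copy_top i j) (cfg tp ss) 2 (cfg tp (ss(j := top (ss i) # ss j)))"
  unfolding copy_top_def by (rule runs_push_from) (simp_all add: cfg_reads del: nth_map)

lemma runs_pop:
  assumes "j < 4" "ss j = a # r"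
  shows "runs (pop j) (cfg tp ss) 1 (cfg tp (ss(j := r)))"
proof -
  have "exec (pop j) (cfg tp ss) 1 ((cfg tp ss)[Suc j := tape_act (Blank, Left) (cfg tp ss ! Suc j)])"
    unfolding pop_def by (rule exec_Act)
  then show ?thesis
    using assms by (intro exec_runs) (simp add: cfg_nth stk_pop cfg_update_stk)
qed

lemma wf_push: "a \<in> \<Gamma> \<Longrightarrow> j < 4 \<Longrightarrow> wf_com \<Gamma> 5 (push j a)"
  by (auto simp: push_def push_from_def in_lists_conv_set)

lemma wf_copy_top: "i < 4 \<Longrightarrow> j < 4 \<Longrightarrow> wf_com \<Gamma> 5 (copy_top i j)"
  by (auto simp: copy_top_def push_from_def in_lists_conv_set)

lemma wf_pop: "Blank \<in> \<Gamma> \<Longrightarrow> wf_com \<Gamma> 5 (pop j)"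
  by (auto simp: pop_def)

section \<open>Tree-valued stacks\<close>

datatype tree = Leaf | Node tree tree

fun code :: "tree \<Rightarrow> 's tape_sym list" where
  "code Leaf = [Work 0]"
| "code (Node a b) = Work 1 # code a @ code b"

fun tsize :: "tree \<Rightarrow> nat" where
  "tsize Leaf = 1"
| "tsize (Node a b) = Suc (tsize a + tsize b)"

lemma length_code [simp]: "length (code t) = tsize t"
  by (induction t) auto

lemma Blank_notin_code [simp]: "Blank \<notin> set (code t)"
  by (induction t) auto

lemma tsize_pos [simp]: "tsize t > 0"
  by (cases t) auto

text \<open>Polish notation is prefix-free. The arbitrary remainders are needed for the induction:
  in the code of a node, the second subtree belongs to the remainder of the first.\<close>

lemma code_append_inject: "code s @ xs = code t @ ys \<Longrightarrow> s = t \<and> xs = ys"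
proof (induction s arbitrary: t xs ys)
  case Leaf
  then show ?case by (cases t) auto
next
  case (Node a b)
  obtain a' b' where t: "t = Node a' b'"
    using Node.prems by (cases t) auto
  then have "code a @ (code b @ xs) = code a' @ (code b' @ ys)"
    using Node.prems by simp
  from Node.IH(1)[OF this] show ?case
    using Node.IH(2)[of xs b' ys] t by simp
qed

lemma code_inject [simp]: "code s = code t \<longleftrightarrow> s = t"
  using code_append_inject[of s "[]" t "[]"] by auto

definition stacks :: "'a list \<Rightarrow> 'a list \<Rightarrow> 'a list \<Rightarrow> 'a list \<Rightarrow> nat \<Rightarrow> 'a list" where
  "stacks a b c d j = (if j = 0 then a else if j = 1 then b else if j = 2 then c
     else if j = 3 then d else [])"

lemma stacks_apply [simp]:
  "stacks a b c d 0 = a" "stacks a b c d (Suc 0) = b" "stacks a b c d 2 = c" "stacks a b c d 3 = d"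
  by (simp_all add: stacks_def)

lemma stacks_update [simp]:
  "(stacks a b c d)(0 := x) = stacks x b c d"
  "(stacks a b c d)(Suc 0 := x) = stacks a x c d"
  "(stacks a b c d)(2 := x) = stacks a b x d"
  "(stacks a b c d)(3 := x) = stacks a b c x"
  by (auto simp: stacks_def fun_eq_iff)

lemma cfg_read_at [simp]:
  "map tape_read (cfg tp ss) ! 0 = tape_read tp"
  "map tape_read (cfg tp ss) ! Suc 0 = top (ss 0)"
  "map tape_read (cfg tp ss) ! 2 = top (ss 1)"
  "map tape_read (cfg tp ss) ! 3 = top (ss 2)"
  "map tape_read (cfg tp ss) ! 4 = top (ss 3)"
  by (simp_all add: cfg_def numeral_eq_Suc)

definition skip :: "'s com" where
  "skip = Act 0 (\<lambda>as. (as ! 0, Stay))"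

lemma runs_Act0:
  "runs (Act 0 g) (cfg tp ss) 1 (cfg (tape_act (g (map tape_read (cfg tp ss))) tp) ss)"
  using exec_runs[OF exec_Act[of 0 g "cfg tp ss"]] by (simp add: cfg_update_tape cfg_nth)

lemma runs_skip: "runs skip (cfg tp ss) 1 (cfg tp ss)"
  using runs_Act0[of "\<lambda>as. (as ! 0, Stay)" tp ss]
  by (simp add: skip_def tape_act_def tape_read_def del: nth_map)

abbreviation grab_symbol :: "nat \<Rightarrow> nat \<Rightarrow> 's com" where
  "grab_symbol i j \<equiv> copy_top i j ;;
     Cond (\<lambda>as. as ! Suc i = Work 1) (pop i ;; push 3 (Work 0)) (pop i ;; pop 3)"

text \<open>Stack 3 counts in unary the subtrees that are still to be read. The code arrives reversed.\<close>

definition grab_loop :: "nat \<Rightarrow> nat \<Rightarrow> 's com" where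
  "grab_loop i j = While (\<lambda>as. as ! 4 = Work 0)
     (grab_symbol i j)"

definition grab :: "nat \<Rightarrow> nat \<Rightarrow> 's com" where
  "grab i j = push 3 (Work 0) ;; grab_loop i j"

text \<open>Stated with the rest of the computation as a premise, because the two subtrees of a node
  are consumed by iterations of one and the same loop: where the first subtree ends, the loop goes
  on with the second. The factor 8 bounds the cost of one symbol.\<close>

lemma runs_grab_loop:
  assumes "runs (grab_loop i j)
      (cfg tp (ss(i := R, j := rev (code t) @ ss j, 3 := K))) u T"
    and "ss i = code t @ R" "ss 3 = Work 0 # K" "i < 3" "j < 3" "i \<noteq> j"
  shows "runs (grab_loop i j) (cfg tp ss) (u + 8 * tsize t) T"
  using assms
proof (induction t arbitrary: ss R K u)
  case Leaf
  let ?ss = "ss(j := Work 0 # ss j)"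
  have "runs (copy_top i j) (cfg tp ss) 2 (cfg tp ?ss)"
    using runs_copy_top[of i j tp ss] Leaf by simp
  moreover have "runs (pop i ;; pop 3) (cfg tp ?ss) (1 + 1) (cfg tp (?ss(i := R, 3 := K)))"
  proof (rule runs_Seq)
    show "runs (pop i) (cfg tp ?ss) 1 (cfg tp (?ss(i := R)))"
      using Leaf by (intro runs_pop) auto
    show "runs (pop 3) (cfg tp (?ss(i := R))) 1 (cfg tp (?ss(i := R, 3 := K)))"
      using Leaf by (intro runs_pop) auto
  qed
  ultimately have "runs (grab_symbol i j)
     (cfg tp ss) (2 + Suc (1 + 1)) (cfg tp (?ss(i := R, 3 := K)))"
    using Leaf.prems by (elim runs_Seq runs_CondF[rotated]) (simp add: cfg_reads del: nth_map)
  moreover have "?ss(i := R, 3 := K) = ss(i := R, j := rev (code Leaf) @ ss j, 3 := K)"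
    using Leaf by (auto simp: fun_eq_iff)
  ultimately have "runs (grab_loop i j) (cfg tp ss) (Suc (2 + Suc (1 + 1) + u)) T"
    using Leaf.prems unfolding grab_loop_def
    by (intro runs_WhileT) (simp_all del: nth_map fun_upd_apply)
  then show ?case
    by (rule runs_mono) simp
next
  case (Node a b)
  let ?ss = "ss(j := Work 1 # ss j)"
  \<comment> \<open>Reading a node replaces one outstanding subtree by two.\<close>
  let ?ss' = "?ss(i := code a @ code b @ R, 3 := Work 0 # Work 0 # K)"
  have "runs (copy_top i j) (cfg tp ss) 2 (cfg tp ?ss)"
    using runs_copy_top[of i j tp ss] Node by simp
  moreover have "runs (pop i ;; push 3 (Work 0)) (cfg tp ?ss) (1 + 2) (cfg tp ?ss')"
  proof (rule runs_Seq)
    show "runs (pop i) (cfg tp ?ss) 1 (cfg tp (?ss(i := code a @ code b @ R)))"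
      using Node by (intro runs_pop) auto
    show "runs (push 3 (Work 0)) (cfg tp (?ss(i := code a @ code b @ R))) 2 (cfg tp ?ss')"
      using runs_push[of 3 "Work 0" tp "?ss(i := code a @ code b @ R)"] Node by simp
  qed
  ultimately have body: "runs (grab_symbol i j)
     (cfg tp ss) (2 + Suc (1 + 2)) (cfg tp ?ss')"
    using Node.prems by (elim runs_Seq runs_CondT[rotated]) (simp add: cfg_reads del: nth_map)
  let ?ss'' = "ss(i := code b @ R, j := rev (code a) @ Work 1 # ss j, 3 := Work 0 # K)"
  have "?ss''(i := R, j := rev (code b) @ ?ss'' j, 3 := K) =
      ss(i := R, j := rev (code (Node a b)) @ ss j, 3 := K)"
    using Node.prems by (auto simp: fun_eq_iff)
  then have "runs (grab_loop i j) (cfg tp ?ss'') (u + 8 * tsize b) T"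
    using Node.prems by (intro Node.IH(2)[of _ R K]) (simp_all del: fun_upd_apply, simp_all)
  moreover have "?ss'(i := code b @ R, j := rev (code a) @ ?ss' j, 3 := Work 0 # K) = ?ss''"
    using Node.prems by (auto simp: fun_eq_iff)
  ultimately have "runs (grab_loop i j) (cfg tp ?ss') (u + 8 * tsize b + 8 * tsize a) T"
    using Node.prems
    by (intro Node.IH(1)[of _ "code b @ R" "Work 0 # K"]) (simp_all del: fun_upd_apply, simp_all)
  with body have "runs (grab_loop i j) (cfg tp ss) (Suc (2 + Suc (1 + 2) + (u + 8 * tsize b + 8 * tsize a))) T"
    unfolding grab_loop_def using Node.prems by (intro runs_WhileT) (auto simp del: nth_map)
  then show ?case
    by (rule runs_mono) simp
qed

lemma runs_grab:
  assumes "ss i = code t @ R" "ss 3 = []" "i < 3" "j < 3" "i \<noteq> j"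
  shows "runs (grab i j) (cfg tp ss) (11 * tsize t) (cfg tp (ss(i := R, j := rev (code t) @ ss j)))"
proof -
  let ?ss = "ss(3 := [Work 0])"
  have push: "runs (push 3 (Work 0)) (cfg tp ss) 2 (cfg tp ?ss)"
    using runs_push[of 3 "Work 0" tp ss] assms by simp
  let ?T = "cfg tp (ss(i := R, j := rev (code t) @ ss j))"
  have eq: "?ss(i := R, j := rev (code t) @ ?ss j, 3 := []) = ss(i := R, j := rev (code t) @ ss j)"
    using assms by (auto simp: fun_eq_iff)
  have "runs (grab_loop i j) ?T 1 ?T"
    unfolding grab_loop_def using assms by (intro runs_WhileF) (auto simp del: nth_map)
  then have "runs (grab_loop i j) (cfg tp ?ss) (1 + 8 * tsize t) ?T"
    by (intro runs_grab_loop[of _ _ _ _ R _ "[]"]) (use assms eq in auto)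
  with push have "runs (grab i j) (cfg tp ss) (2 + (1 + 8 * tsize t)) ?T"
    unfolding grab_def by (rule runs_Seq)
  then show ?thesis
    by (rule runs_mono) (use tsize_pos[of t] in linarith)
qed

definition pour :: "nat \<Rightarrow> nat \<Rightarrow> 's com" where
  "pour i j = While (\<lambda>as. as ! Suc i \<noteq> Blank) (copy_top i j ;; pop i)"

definition pour_both :: "nat \<Rightarrow> nat \<Rightarrow> nat \<Rightarrow> 's com" where
  "pour_both i j k = While (\<lambda>as. as ! Suc i \<noteq> Blank) (copy_top i j ;; copy_top i k ;; pop i)"

definition clear :: "nat \<Rightarrow> 's com" where
  "clear i = While (\<lambda>as. as ! Suc i \<noteq> Blank) (pop i)"

lemma runs_pour:
  assumes "Blank \<notin> set xs" "ss i = xs" "i < 4" "j < 4" "i \<noteq> j"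
  shows "runs (pour i j) (cfg tp ss) (4 * length xs + 1) (cfg tp (ss(i := [], j := rev xs @ ss j)))"
  using assms
proof (induction xs arbitrary: ss)
  case Nil
  then have "ss(i := [], j := rev [] @ ss j) = ss" by (auto simp: fun_eq_iff)
  moreover have "\<not> map tape_read (cfg tp ss) ! Suc i \<noteq> Blank"
    using Nil by (simp add: cfg_reads del: nth_map)
  ultimately show ?case
    using runs_WhileF[of "\<lambda>as. as ! Suc i \<noteq> Blank" "cfg tp ss"] unfolding pour_def by (simp del: fun_upd_apply)
next
  case (Cons a xs)
  let ?ss = "ss(j := a # ss j)"
  let ?ss' = "?ss(i := xs)"
  have "runs (copy_top i j) (cfg tp ss) 2 (cfg tp ?ss)"
    using runs_copy_top[of i j tp ss] Cons.prems by simp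
  moreover have "runs (pop i) (cfg tp ?ss) 1 (cfg tp ?ss')"
    using Cons.prems by (intro runs_pop) auto
  ultimately have body: "runs (copy_top i j ;; pop i) (cfg tp ss) (2 + 1) (cfg tp ?ss')"
    by (rule runs_Seq)
  have "runs (pour i j) (cfg tp ?ss') (4 * length xs + 1) (cfg tp (?ss'(i := [], j := rev xs @ ?ss' j)))"
    by (rule Cons.IH) (use Cons.prems in auto)
  moreover have "?ss'(i := [], j := rev xs @ ?ss' j) = ss(i := [], j := rev (a # xs) @ ss j)"
    using Cons.prems by (auto simp: fun_eq_iff)
  ultimately have "runs (pour i j) (cfg tp ss) (Suc (2 + 1 + (4 * length xs + 1)))
      (cfg tp (ss(i := [], j := rev (a # xs) @ ss j)))"
    using body Cons.prems unfolding pour_def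
    by (intro runs_WhileT) (auto simp: cfg_reads simp del: nth_map)
  then show ?case by (rule runs_mono) simp
qed

lemma runs_pour_both:
  assumes "Blank \<notin> set xs" "ss i = xs" "i < 4" "j < 4" "k < 4" "i \<noteq> j" "i \<noteq> k" "j \<noteq> k"
  shows "runs (pour_both i j k) (cfg tp ss) (6 * length xs + 1)
     (cfg tp (ss(i := [], j := rev xs @ ss j, k := rev xs @ ss k)))"
  using assms
proof (induction xs arbitrary: ss)
  case Nil
  then have "ss(i := [], j := rev [] @ ss j, k := rev [] @ ss k) = ss" by (auto simp: fun_eq_iff)
  moreover have "\<not> map tape_read (cfg tp ss) ! Suc i \<noteq> Blank"
    using Nil by (simp add: cfg_reads del: nth_map)
  ultimately show ?case
    using runs_WhileF[of "\<lambda>as. as ! Suc i \<noteq> Blank" "cfg tp ss"] unfolding pour_both_def by (simp del: fun_upd_apply)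
next
  case (Cons a xs)
  let ?ss = "ss(j := a # ss j)"
  let ?ss1 = "?ss(k := a # ss k)"
  let ?ss' = "?ss1(i := xs)"
  have "runs (copy_top i j) (cfg tp ss) 2 (cfg tp ?ss)"
    using runs_copy_top[of i j tp ss] Cons.prems by simp
  moreover have "runs (copy_top i k) (cfg tp ?ss) 2 (cfg tp ?ss1)"
    using runs_copy_top[of i k tp ?ss] Cons.prems by simp
  moreover have "runs (pop i) (cfg tp ?ss1) 1 (cfg tp ?ss')"
    using Cons.prems by (intro runs_pop) auto
  ultimately have body: "runs (copy_top i j ;; copy_top i k ;; pop i) (cfg tp ss) (2 + (2 + 1)) (cfg tp ?ss')"
    by (intro runs_Seq)
  have "runs (pour_both i j k) (cfg tp ?ss') (6 * length xs + 1)
      (cfg tp (?ss'(i := [], j := rev xs @ ?ss' j, k := rev xs @ ?ss' k)))"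
    by (rule Cons.IH) (use Cons.prems in auto)
  moreover have "?ss'(i := [], j := rev xs @ ?ss' j, k := rev xs @ ?ss' k) =
      ss(i := [], j := rev (a # xs) @ ss j, k := rev (a # xs) @ ss k)"
    using Cons.prems by (auto simp: fun_eq_iff)
  ultimately have "runs (pour_both i j k) (cfg tp ss) (Suc (2 + (2 + 1) + (6 * length xs + 1)))
      (cfg tp (ss(i := [], j := rev (a # xs) @ ss j, k := rev (a # xs) @ ss k)))"
    using body Cons.prems unfolding pour_both_def
    by (intro runs_WhileT) (auto simp: cfg_reads simp del: nth_map)
  then show ?case by (rule runs_mono) simp
qed

lemma runs_clear:
  assumes "Blank \<notin> set xs" "ss i = xs" "i < 4"
  shows "runs (clear i) (cfg tp ss) (2 * length xs + 1) (cfg tp (ss(i := [])))"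
  using assms
proof (induction xs arbitrary: ss)
  case Nil
  then have "ss(i := []) = ss" by (auto simp: fun_eq_iff)
  moreover have "\<not> map tape_read (cfg tp ss) ! Suc i \<noteq> Blank"
    using Nil by (simp add: cfg_reads del: nth_map)
  ultimately show ?case
    using runs_WhileF[of "\<lambda>as. as ! Suc i \<noteq> Blank" "cfg tp ss"] unfolding clear_def by (simp del: fun_upd_apply)
next
  case (Cons a xs)
  have "runs (pop i) (cfg tp ss) 1 (cfg tp (ss(i := xs)))"
    using Cons.prems by (intro runs_pop) auto
  moreover have "runs (clear i) (cfg tp (ss(i := xs))) (2 * length xs + 1) (cfg tp (ss(i := [])))"
    using Cons.IH[of "ss(i := xs)"] Cons.prems by (simp del: fun_upd_apply, simp)
  ultimately have "runs (clear i) (cfg tp ss) (Suc (1 + (2 * length xs + 1))) (cfg tp (ss(i := [])))"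
    using Cons.prems unfolding clear_def
    by (intro runs_WhileT) (auto simp: cfg_reads simp del: nth_map)
  then show ?case by (rule runs_mono) simp
qed

section \<open>Copying, exchanging, discarding and comparing the trees on top of the main
  stack\<close>

definition conf :: "'s tape \<Rightarrow> 's tape_sym list \<Rightarrow> 's tape list" where
  "conf tp S = cfg tp (stacks S [] [] [])"

text \<open>Every transfer between stacks reverses the code. The copy that \<open>pour_both\<close>
  leaves on stack 2 has the right orientation, so it must return to stack 0 in two moves, by way of
  stack 1.\<close>

definition dup :: "'s com" where
  "dup = grab 0 1 ;; pour_both 1 0 2 ;; pour 2 1 ;; pour 1 0"

lemma runs_dup: "runs dup (conf tp (code x @ R)) (50 * tsize x) (conf tp (code x @ code x @ R))"
proof -
  have "runs dup (conf tp (code x @ R))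
     (11 * tsize x + ((6 * tsize x + 1) + ((4 * tsize x + 1) + (4 * tsize x + 1))))
     (conf tp (code x @ code x @ R))"
    unfolding dup_def
  proof (intro runs_Seq)
    show "runs (grab 0 1) (conf tp (code x @ R)) (11 * tsize x) (cfg tp (stacks R (rev (code x)) [] []))"
      using runs_grab[of "stacks (code x @ R) [] [] []" 0 x R 1 tp] by (simp add: conf_def)
    show "runs (pour_both 1 0 2) (cfg tp (stacks R (rev (code x)) [] [])) (6 * tsize x + 1)
       (cfg tp (stacks (code x @ R) [] (code x) []))"
      using runs_pour_both[of "rev (code x)" "stacks R (rev (code x)) [] []" 1 0 2 tp] by simp
    show "runs (pour 2 1) (cfg tp (stacks (code x @ R) [] (code x) [])) (4 * tsize x + 1)
       (cfg tp (stacks (code x @ R) (rev (code x)) [] []))"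
      using runs_pour[of "code x" "stacks (code x @ R) [] (code x) []" 2 1 tp] by simp
    show "runs (pour 1 0) (cfg tp (stacks (code x @ R) (rev (code x)) [] [])) (4 * tsize x + 1)
       (conf tp (code x @ code x @ R))"
      using runs_pour[of "rev (code x)" "stacks (code x @ R) (rev (code x)) [] []" 1 0 tp]
      by (simp add: conf_def)
  qed
  then show ?thesis
    by (rule runs_mono) (use tsize_pos[of x] in linarith)
qed

definition swap :: "'s com" where
  "swap = grab 0 1 ;; grab 0 2 ;; pour 1 0 ;; pour 2 0"

lemma runs_swap:
  "runs swap (conf tp (code x @ code y @ R)) (30 * (tsize x + tsize y)) (conf tp (code y @ code x @ R))"
proof -
  have "runs swap (conf tp (code x @ code y @ R))
     (11 * tsize x + (11 * tsize y + ((4 * tsize x + 1) + (4 * tsize y + 1))))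
     (conf tp (code y @ code x @ R))"
    unfolding swap_def
  proof (intro runs_Seq)
    show "runs (grab 0 1) (conf tp (code x @ code y @ R)) (11 * tsize x)
       (cfg tp (stacks (code y @ R) (rev (code x)) [] []))"
      using runs_grab[of "stacks (code x @ code y @ R) [] [] []" 0 x "code y @ R" 1 tp]
      by (simp add: conf_def)
    show "runs (grab 0 2) (cfg tp (stacks (code y @ R) (rev (code x)) [] [])) (11 * tsize y)
       (cfg tp (stacks R (rev (code x)) (rev (code y)) []))"
      using runs_grab[of "stacks (code y @ R) (rev (code x)) [] []" 0 y R 2 tp] by simp
    show "runs (pour 1 0) (cfg tp (stacks R (rev (code x)) (rev (code y)) [])) (4 * tsize x + 1)
       (cfg tp (stacks (code x @ R) [] (rev (code y)) []))"
      using runs_pour[of "rev (code x)" "stacks R (rev (code x)) (rev (code y)) []" 1 0 tp] by simp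
    show "runs (pour 2 0) (cfg tp (stacks (code x @ R) [] (rev (code y)) [])) (4 * tsize y + 1)
       (conf tp (code y @ code x @ R))"
      using runs_pour[of "rev (code y)" "stacks (code x @ R) [] (rev (code y)) []" 2 0 tp]
      by (simp add: conf_def)
  qed
  then show ?thesis
    by (rule runs_mono) (use tsize_pos[of x] tsize_pos[of y] in \<open>simp add: algebra_simps del: tsize_pos\<close>)
qed

definition discard :: "'s com" where
  "discard = grab 0 1 ;; clear 1"

lemma runs_discard: "runs discard (conf tp (code x @ R)) (20 * tsize x) (conf tp R)"
proof -
  have "runs discard (conf tp (code x @ R)) (11 * tsize x + (2 * tsize x + 1)) (conf tp R)"
    unfolding discard_def
  proof (intro runs_Seq)
    show "runs (grab 0 1) (conf tp (code x @ R)) (11 * tsize x) (cfg tp (stacks R (rev (code x)) [] []))"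
      using runs_grab[of "stacks (code x @ R) [] [] []" 0 x R 1 tp] by (simp add: conf_def)
    show "runs (clear 1) (cfg tp (stacks R (rev (code x)) [] [])) (2 * tsize x + 1) (conf tp R)"
      using runs_clear[of "rev (code x)" "stacks R (rev (code x)) [] []" 1 tp] by (simp add: conf_def)
  qed
  then show ?thesis
    by (rule runs_mono) (use tsize_pos[of x] in linarith)
qed

lemma runs_push0: "runs (push 0 a) (cfg tp (stacks S A B C)) 2 (cfg tp (stacks (a # S) A B C))"
  using runs_push[of 0 a tp "stacks S A B C"] by simp

lemma runs_pop0: "runs (pop 0) (cfg tp (stacks (a # S) A B C)) 1 (cfg tp (stacks S A B C))"
  using runs_pop[of 0 "stacks (a # S) A B C" a S tp] by simp

lemma runs_push_conf: "runs (push 0 a) (conf tp S) 2 (conf tp (a # S))"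
  unfolding conf_def by (rule runs_push0)

lemma runs_pop_conf: "runs (pop 0) (conf tp (a # S)) 1 (conf tp S)"
  unfolding conf_def by (rule runs_pop0)

fun push_tree :: "tree \<Rightarrow> 's com" where
  "push_tree Leaf = push 0 (Work 0)"
| "push_tree (Node a b) = push_tree b ;; push_tree a ;; push 0 (Work 1)"

lemma runs_push_tree: "runs (push_tree x) (conf tp R) (2 * tsize x) (conf tp (code x @ R))"
proof (induction x arbitrary: R)
  case Leaf
  then show ?case using runs_push_conf by simp
next
  case (Node a b)
  have "runs (push_tree b ;; push_tree a ;; push 0 (Work 1)) (conf tp R)
     (2 * tsize b + (2 * tsize a + 2)) (conf tp (Work 1 # (code a @ (code b @ R))))"
    by (rule runs_Seq[OF Node.IH(2) runs_Seq[OF Node.IH(1) runs_push_conf]])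
  then show ?case by (simp add: add_ac)
qed

abbreviation strip_common_prefix :: "'s com" where
  "strip_common_prefix \<equiv> While (\<lambda>as. as ! 2 = as ! 3 \<and> as ! 2 \<noteq> Blank) (pop 1 ;; pop 2)"

abbreviation report_empty :: "'s com" where
  "report_empty \<equiv> Cond (\<lambda>as. as ! 2 = Blank \<and> as ! 3 = Blank) (push_tree (Node Leaf Leaf))
       (clear 1 ;; clear 2 ;; push_tree Leaf)"

definition compare_trees :: "'s com" where
  "compare_trees = grab 0 1 ;; grab 0 2 ;;
     strip_common_prefix ;;
     report_empty"

text \<open>The remainders stay unspecified: it only matters whether both are empty. The inclusions
  and length bounds provide what clearing the two stacks afterwards requires. That the codes lie
  reversed on the stacks does not affect equality.\<close>

lemma runs_strip_common_prefix:
  assumes "Blank \<notin> set xs" "Blank \<notin> set ys"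
  shows "\<exists>xs' ys'. runs strip_common_prefix
      (cfg tp (stacks S xs ys [])) (3 * length xs + 1) (cfg tp (stacks S xs' ys' [])) \<and>
     (xs' = [] \<and> ys' = [] \<longleftrightarrow> xs = ys) \<and> set xs' \<subseteq> set xs \<and> set ys' \<subseteq> set ys \<and>
     length xs' \<le> length xs \<and> length ys' \<le> length ys"
  using assms
proof (induction xs arbitrary: ys)
  case Nil
  then have "runs strip_common_prefix
      (cfg tp (stacks S [] ys [])) 1 (cfg tp (stacks S [] ys []))"
    by (intro runs_WhileF) (simp del: nth_map)
  then show ?case by (intro exI[of _ "[]"] exI[of _ ys]) auto
next
  case (Cons a xs)
  show ?case
  proof (cases "\<exists>zs. ys = a # zs")
    case True
    then obtain zs where ys: "ys = a # zs" by blast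
    then obtain xs' ys' where IH: "runs strip_common_prefix
      (cfg tp (stacks S xs zs [])) (3 * length xs + 1) (cfg tp (stacks S xs' ys' []))"
      "xs' = [] \<and> ys' = [] \<longleftrightarrow> xs = zs" "set xs' \<subseteq> set xs" "set ys' \<subseteq> set zs"
      "length xs' \<le> length xs" "length ys' \<le> length zs"
      using Cons.IH[of zs] Cons.prems by auto
    have "runs (pop 1 ;; pop 2) (cfg tp (stacks S (a # xs) (a # zs) [])) (1 + 1)
      (cfg tp (stacks S xs zs []))"
    proof (rule runs_Seq)
      show "runs (pop 1) (cfg tp (stacks S (a # xs) (a # zs) [])) 1 (cfg tp (stacks S xs (a # zs) []))"
        using runs_pop[of 1 "stacks S (a # xs) (a # zs) []" a xs tp] by simp
      show "runs (pop 2) (cfg tp (stacks S xs (a # zs) [])) 1 (cfg tp (stacks S xs zs []))"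
        using runs_pop[of 2 "stacks S xs (a # zs) []" a zs tp] by simp
    qed
    then have "runs strip_common_prefix
      (cfg tp (stacks S (a # xs) ys [])) (Suc (1 + 1 + (3 * length xs + 1))) (cfg tp (stacks S xs' ys' []))"
      using IH(1) Cons.prems ys by (intro runs_WhileT) (auto simp del: nth_map)
    then have "runs strip_common_prefix
      (cfg tp (stacks S (a # xs) ys [])) (3 * length (a # xs) + 1) (cfg tp (stacks S xs' ys' []))"
      by (rule runs_mono) simp
    then show ?thesis
      using IH ys by (intro exI[of _ xs'] exI[of _ ys']) auto
  next
    case False
    then have "runs strip_common_prefix
      (cfg tp (stacks S (a # xs) ys [])) 1 (cfg tp (stacks S (a # xs) ys []))"
      using Cons.prems by (intro runs_WhileF) (cases ys; auto simp del: nth_map)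
    then have "runs strip_common_prefix
      (cfg tp (stacks S (a # xs) ys [])) (3 * length (a # xs) + 1) (cfg tp (stacks S (a # xs) ys []))"
      by (rule runs_mono) simp
    then show ?thesis
      using False by (intro exI[of _ "a # xs"] exI[of _ ys]) auto
  qed
qed

lemma runs_compare_trees:
  "runs compare_trees (conf tp (code x @ code y @ R)) (40 * (tsize x + tsize y))
     (conf tp (code (if x = y then Node Leaf Leaf else Leaf) @ R))"
proof -
  let ?W = "strip_common_prefix"
  have "Blank \<notin> set (rev (code x :: 'a tape_sym list))" "Blank \<notin> set (rev (code y :: 'a tape_sym list))"
    by simp_all
  from runs_strip_common_prefix[OF this, of tp R] obtain xs ys where W: "runs ?W (cfg tp (stacks R (rev (code x)) (rev (code y)) []))
      (3 * length (rev (code x :: 'a tape_sym list)) + 1) (cfg tp (stacks R xs ys []))"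
    and eq: "xs = [] \<and> ys = [] \<longleftrightarrow> rev (code x :: 'a tape_sym list) = rev (code y)"
    and sub: "set xs \<subseteq> set (rev (code x))" "set ys \<subseteq> set (rev (code y))"
      "length xs \<le> length (rev (code x :: 'a tape_sym list))"
      "length ys \<le> length (rev (code y :: 'a tape_sym list))"
    by (elim exE conjE) (rule that)
  have nb: "Blank \<notin> set xs" "Blank \<notin> set ys"
    using sub(1,2) Blank_notin_code[of x] Blank_notin_code[of y] unfolding set_rev by blast+
  have last: "runs (report_empty) (cfg tp (stacks R xs ys []))
       (Suc ((2 * tsize x + 1) + ((2 * tsize y + 1) + 6)))
     (conf tp (code (if x = y then Node Leaf Leaf else Leaf) @ R))"
  proof (cases "x = y")
    case True
    then have "runs (push_tree (Node Leaf Leaf)) (cfg tp (stacks R xs ys [])) 6 (conf tp (code (Node Leaf Leaf) @ R))"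
      using eq runs_push_tree[of "Node Leaf Leaf" tp R] by (simp add: conf_def)
    then have "runs (report_empty) (cfg tp (stacks R xs ys [])) (Suc 6) (conf tp (code (Node Leaf Leaf) @ R))"
      using eq True by (intro runs_CondT) (auto simp del: nth_map)
    then show ?thesis
      using True by (auto elim!: runs_mono)
  next
    case False
    then have ne: "\<not> (xs = [] \<and> ys = [])" using eq by simp
    have "runs (clear 1 ;; clear 2 ;; push_tree Leaf) (cfg tp (stacks R xs ys []))
      ((2 * length xs + 1) + ((2 * length ys + 1) + 2)) (conf tp (code Leaf @ R))"
    proof (intro runs_Seq)
      show "runs (clear 1) (cfg tp (stacks R xs ys [])) (2 * length xs + 1) (cfg tp (stacks R [] ys []))"
        using runs_clear[of xs "stacks R xs ys []" 1 tp] nb by simp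
      show "runs (clear 2) (cfg tp (stacks R [] ys [])) (2 * length ys + 1) (conf tp R)"
        using runs_clear[of ys "stacks R [] ys []" 2 tp] nb by (simp add: conf_def)
      show "runs (push_tree Leaf) (conf tp R) 2 (conf tp (code Leaf @ R))"
        using runs_push_tree[of Leaf tp R] by simp
    qed
    then have "runs (report_empty) (cfg tp (stacks R xs ys []))
       (Suc ((2 * length xs + 1) + ((2 * length ys + 1) + 2))) (conf tp (code Leaf @ R))"
      using ne nb by (intro runs_CondF) (cases xs; cases ys; auto simp del: nth_map)
    then show ?thesis
      using False sub(3,4) by (auto elim!: runs_mono)
  qed
  have "runs compare_trees (conf tp (code x @ code y @ R))
    (11 * tsize x + (11 * tsize y + ((3 * length (rev (code x :: 'a tape_sym list)) + 1) +
       Suc ((2 * tsize x + 1) + ((2 * tsize y + 1) + 6)))))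
     (conf tp (code (if x = y then Node Leaf Leaf else Leaf) @ R))"
    unfolding compare_trees_def
  proof (intro runs_Seq)
    show "runs (grab 0 1) (conf tp (code x @ code y @ R)) (11 * tsize x)
       (cfg tp (stacks (code y @ R) (rev (code x)) [] []))"
      using runs_grab[of "stacks (code x @ code y @ R) [] [] []" 0 x "code y @ R" 1 tp]
      by (simp add: conf_def)
    show "runs (grab 0 2) (cfg tp (stacks (code y @ R) (rev (code x)) [] [])) (11 * tsize y)
       (cfg tp (stacks R (rev (code x)) (rev (code y)) []))"
      using runs_grab[of "stacks (code y @ R) (rev (code x)) [] []" 0 y R 2 tp] by simp
    show "runs ?W (cfg tp (stacks R (rev (code x)) (rev (code y)) []))
      (3 * length (rev (code x :: 'a tape_sym list)) + 1) (cfg tp (stacks R xs ys []))"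
      by (rule W)
  qed (rule last)
  moreover have "tsize x \<ge> 1" "tsize y \<ge> 1"
    using tsize_pos[of x] tsize_pos[of y] by linarith+
  ultimately show ?thesis
    by (elim runs_mono) simp
qed

lemma wf_stack_coms:
  assumes "{Blank, Work 0, Work 1} \<subseteq> \<Gamma>"
  shows "wf_com \<Gamma> 5 skip" "wf_com \<Gamma> 5 dup" "wf_com \<Gamma> 5 swap" "wf_com \<Gamma> 5 discard"
    "wf_com \<Gamma> 5 (push_tree t)" "wf_com \<Gamma> 5 compare_trees"
proof -
  show push_tree: "wf_com \<Gamma> 5 (push_tree t)" for t
    using assms by (induction t) (auto simp: wf_push)
  show "wf_com \<Gamma> 5 skip"
    by (auto simp: skip_def in_lists_conv_set)
  show "wf_com \<Gamma> 5 dup" "wf_com \<Gamma> 5 swap" "wf_com \<Gamma> 5 discard" "wf_com \<Gamma> 5 compare_trees"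
    using assms push_tree
    by (simp_all add: dup_def swap_def discard_def compare_trees_def grab_def grab_loop_def pour_def
        pour_both_def clear_def wf_push wf_pop wf_copy_top)
qed

section \<open>Polynomial-time functions\<close>

text \<open>Injectivity is what allows equality of values to be tested by comparing trees.\<close>

class enc =
  fixes enc :: "'a \<Rightarrow> tree"
  assumes enc_inject: "enc x = enc y \<longleftrightarrow> x = y"

definition sz :: "'a::enc \<Rightarrow> nat" where
  "sz x = tsize (enc x)"

instantiation unit :: enc
begin
definition enc_unit :: "unit \<Rightarrow> tree" where
  "enc_unit x = Leaf"
instance by standard (simp add: enc_unit_def)
end

instantiation bool :: enc
begin
definition enc_bool :: "bool \<Rightarrow> tree" where
  "enc_bool b = (if b then Node Leaf Leaf else Leaf)"
instance by standard (simp add: enc_bool_def)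
end

text \<open>Unary, so that \<open>Suc\<close> merely pairs a number with a leaf. This is affordable,
  since the numbers that occur are positions in the input and letters from a finite range.\<close>

instantiation nat :: enc
begin
primrec enc_nat :: "nat \<Rightarrow> tree" where
  "enc_nat 0 = Leaf"
| "enc_nat (Suc n) = Node Leaf (enc_nat n)"
instance
proof
  show "enc x = enc y \<longleftrightarrow> x = y" for x y :: nat
    by (induction x arbitrary: y; case_tac y) auto
qed
end

instantiation prod :: (enc, enc) enc
begin
definition enc_prod :: "'a \<times> 'b \<Rightarrow> tree" where
  "enc_prod p = Node (enc (fst p)) (enc (snd p))"
instance by standard (auto simp: enc_prod_def enc_inject)
end

instantiation list :: (enc) enc
begin
primrec enc_list :: "'a list \<Rightarrow> tree" where
  "enc_list [] = Leaf"
| "enc_list (x # xs) = Node (enc x) (enc_list xs)"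
instance
proof
  show "enc x = enc y \<longleftrightarrow> x = y" for x y :: "'a list"
    by (induction x arbitrary: y; case_tac y) (auto simp: enc_inject)
qed
end

section \<open>Sizes of encoded data\<close>

lemma sz_pos [simp]: "sz x > 0"
  by (simp add: sz_def)

lemma sz_ge_1 [simp]: "Suc 0 \<le> sz x"
  by (simp add: Suc_le_eq)

lemma sz_simps [simp]:
  "sz (u :: unit) = 1"
  "sz (a, b) = Suc (sz a + sz b)"
  "sz [] = 1"
  "sz (x # xs) = Suc (sz x + sz xs)"
  "sz n = Suc (2 * n)"
  by (simp_all add: sz_def enc_unit_def enc_prod_def) (induction n, auto)

lemma sz_bool: "sz (b :: bool) \<le> 3"
  by (simp add: sz_def enc_bool_def)

lemma sz_list: "sz xs = Suc (\<Sum>x\<leftarrow>xs. Suc (sz x))"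
  by (induction xs) auto

lemma length_le_sz: "length xs \<le> sz xs"
  by (induction xs) auto

lemma sz_nth_le: "x \<in> set xs \<Longrightarrow> sz x \<le> sz xs"
  by (induction xs) auto

lemma sz_append [simp]: "sz (xs @ ys) = sz xs + sz ys - 1"
  by (simp add: sz_list)

lemma sz_rev [simp]: "sz (rev xs) = sz xs"
  by (simp add: sz_list flip: rev_map)

lemma sz_take_le: "sz (take i xs) \<le> sz xs"
  by (metis append_take_drop_id sz_append sz_ge_1 Nat.add_diff_assoc le_add1 One_nat_def)

lemma sz_list_le: "(\<And>x. x \<in> set xs \<Longrightarrow> sz x \<le> b) \<Longrightarrow> length xs \<le> n \<Longrightarrow> sz xs \<le> Suc (n * Suc b)"
proof -
  assume b: "\<And>x. x \<in> set xs \<Longrightarrow> sz x \<le> b" and n: "length xs \<le> n"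
  have "sz xs \<le> Suc (length xs * Suc b)"
    using b
  proof (induction xs)
    case (Cons x xs)
    then have "sz x \<le> b" "sz xs \<le> Suc (length xs * Suc b)"
      by simp_all
    then show ?case
      by simp
  qed simp
  also have "\<dots> \<le> Suc (n * Suc b)"
    using n mult_le_mono1 by blast
  finally show ?thesis .
qed

subsection \<open>Polynomial bounds\<close>

text \<open>The coefficients are natural numbers, so every such polynomial is monotone. This is what
  allows an upper bound to be substituted for a size.\<close>

lemma poly_mono_nat: "x \<le> y \<Longrightarrow> poly p x \<le> poly p (y :: nat)"
  by (induction p) (auto intro!: add_mono mult_mono)

definition poly_bounded :: "('a::enc \<Rightarrow> nat) \<Rightarrow> bool" where
  "poly_bounded h \<longleftrightarrow> (\<exists>p. \<forall>x. h x \<le> poly p (sz x))"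

lemma poly_boundedI: "(\<And>x. h x \<le> poly p (sz x)) \<Longrightarrow> poly_bounded h"
  unfolding poly_bounded_def by blast

lemma poly_bounded_mono: "poly_bounded k \<Longrightarrow> (\<And>x. h x \<le> k x) \<Longrightarrow> poly_bounded h"
  unfolding poly_bounded_def by (meson order_trans)

lemma poly_bounded_const: "poly_bounded (\<lambda>x. c)"
  by (rule poly_boundedI[of _ "[:c:]"]) simp

lemma poly_bounded_sz: "poly_bounded sz"
  by (rule poly_boundedI[of _ "[:0, 1:]"]) simp

lemma poly_bounded_add:
  assumes "poly_bounded h" "poly_bounded k"
  shows "poly_bounded (\<lambda>x. h x + k x)"
proof -
  obtain p q where "\<And>x. h x \<le> poly p (sz x)" "\<And>x. k x \<le> poly q (sz x)"
    using assms unfolding poly_bounded_def by blast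
  then show ?thesis
    by (intro poly_boundedI[of _ "p + q"]) (simp add: add_mono)
qed

lemma poly_bounded_mult:
  assumes "poly_bounded h" "poly_bounded k"
  shows "poly_bounded (\<lambda>x. h x * k x)"
proof -
  obtain p q where "\<And>x. h x \<le> poly p (sz x)" "\<And>x. k x \<le> poly q (sz x)"
    using assms unfolding poly_bounded_def by blast
  then show ?thesis
    by (intro poly_boundedI[of _ "p * q"]) (simp add: mult_mono)
qed

lemma poly_bounded_poly:
  assumes "poly_bounded h"
  shows "poly_bounded (\<lambda>x. poly p (h x))"
proof -
  obtain q where "\<And>x. h x \<le> poly q (sz x)"
    using assms unfolding poly_bounded_def by blast
  then show ?thesis
    by (intro poly_boundedI[of _ "pcompose p q"]) (simp add: poly_pcompose poly_mono_nat)
qed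

lemma poly_bounded_comp:
  assumes "poly_bounded h" "poly_bounded (\<lambda>x. sz (g x))"
  shows "poly_bounded (\<lambda>x. h (g x))"
proof -
  obtain p where "\<And>x. h x \<le> poly p (sz x)"
    using assms(1) unfolding poly_bounded_def by blast
  then show ?thesis
    by (intro poly_bounded_mono[OF poly_bounded_poly[OF assms(2)]])
qed

lemma poly_bounded_Suc: "poly_bounded h \<Longrightarrow> poly_bounded (\<lambda>x. Suc (h x))"
  using poly_bounded_add[OF _ poly_bounded_const[of 1]] by simp

lemma poly_bounded_power: "poly_bounded h \<Longrightarrow> poly_bounded (\<lambda>x. h x ^ k)"
  by (induction k) (auto intro: poly_bounded_mult poly_bounded_const)

lemma poly_bounded_length:
  "poly_bounded (\<lambda>x. sz (l x)) \<Longrightarrow> poly_bounded (\<lambda>x. length (l x))"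
  by (erule poly_bounded_mono) (rule length_le_sz)

lemmas poly_bounded_intros =
  poly_bounded_add poly_bounded_mult poly_bounded_Suc poly_bounded_power poly_bounded_const
  poly_bounded_length

subsection \<open>Basic closure properties\<close>

locale tape_alphabet =
  fixes \<Sigma> :: "'s set"
begin

definition \<Gamma> :: "'s tape_sym set" where
  "\<Gamma> = {Blank, Work 0, Work 1} \<union> Sym ` \<Sigma>"

text \<open>The remainder \<open>R\<close> is arbitrary, so other values can be parked below while a
  program runs. The auxiliary stacks are empty before and after, by the definition of
  \<open>conf\<close>.\<close>

definition computes :: "'s com \<Rightarrow> ('a::enc \<Rightarrow> nat) \<Rightarrow> ('a \<Rightarrow> 'b::enc) \<Rightarrow> bool" where
  "computes c T f \<longleftrightarrow>
     (\<forall>x tp R. runs c (conf tp (code (enc x) @ R)) (T x) (conf tp (code (enc (f x)) @ R)))"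

lemma computesD:
  "computes c T f \<Longrightarrow> runs c (conf tp (code (enc x) @ R)) (T x) (conf tp (code (enc (f x)) @ R))"
  unfolding computes_def by blast

text \<open>The bound on the size of the result makes the time of a program that runs afterwards
  polynomial in the original input.\<close>

definition ptime :: "('a::enc \<Rightarrow> 'b::enc) \<Rightarrow> bool" where
  "ptime f \<longleftrightarrow> (\<exists>c T. wf_com \<Gamma> 5 c \<and> poly_bounded (\<lambda>x. sz (f x)) \<and> poly_bounded T \<and> computes c T f)"

lemma ptimeI:
  assumes "wf_com \<Gamma> 5 c" "poly_bounded (\<lambda>x. sz (f x))" "poly_bounded T"
    and "\<And>x tp R. runs c (conf tp (code (enc x) @ R)) (T x) (conf tp (code (enc (f x)) @ R))"
  shows "ptime f"
  unfolding ptime_def computes_def using assms by blast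

lemma ptime_size: "ptime f \<Longrightarrow> poly_bounded (\<lambda>x. sz (f x))"
  unfolding ptime_def by blast

lemma wf_basic [simp]:
  "wf_com \<Gamma> 5 skip" "wf_com \<Gamma> 5 dup" "wf_com \<Gamma> 5 swap" "wf_com \<Gamma> 5 discard"
  "wf_com \<Gamma> 5 (push_tree t)" "wf_com \<Gamma> 5 compare_trees"
  "wf_com \<Gamma> 5 (pop 0)" "wf_com \<Gamma> 5 (push 0 (Work 0))" "wf_com \<Gamma> 5 (push 0 (Work 1))"
  by (auto simp: \<Gamma>_def intro!: wf_stack_coms wf_pop wf_push)

lemma wf_push_Suc_0 [simp]: "wf_com \<Gamma> 5 (push 0 (Work (Suc 0)))"
  using wf_basic(9) by simp

text \<open>A change of type that keeps the tree costs nothing. It turns pairs into nonempty lists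
  and into successors, so that \<open>Cons\<close> and \<open>Suc\<close> reduce to pairing.\<close>

lemma ptime_recode:
  assumes "\<And>x. enc (f x) = enc x"
  shows "ptime f"
  by (rule ptimeI[of skip _ "\<lambda>_. 1"])
    (auto simp: assms sz_def conf_def runs_skip[simplified] intro: poly_bounded_const
       poly_bounded_sz[unfolded sz_def])

lemma ptime_id: "ptime (\<lambda>x. x)"
  by (rule ptime_recode) simp

lemma ptime_const: "ptime (\<lambda>x. k)"
proof (rule ptimeI)
  show "runs (discard ;; push_tree (enc k)) (conf tp (code (enc x) @ R)) (20 * sz x + 2 * sz k)
     (conf tp (code (enc k) @ R))" for x tp R
    unfolding sz_def by (rule runs_Seq[OF runs_discard runs_push_tree])
qed (auto intro!: poly_bounded_intros poly_bounded_sz)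

lemma ptime_comp:
  assumes "ptime f" "ptime g"
  shows "ptime (\<lambda>x. f (g x))"
proof -
  obtain c T where f: "wf_com \<Gamma> 5 c" "poly_bounded (\<lambda>x. sz (f x))" "poly_bounded T"
    "computes c T f"
    using assms(1) unfolding ptime_def by blast
  obtain d U where g: "wf_com \<Gamma> 5 d" "poly_bounded (\<lambda>x. sz (g x))" "poly_bounded U"
    "computes d U g"
    using assms(2) unfolding ptime_def by blast
  show ?thesis
  proof (rule ptimeI)
    show "runs (d ;; c) (conf tp (code (enc x) @ R)) (U x + T (g x)) (conf tp (code (enc (f (g x))) @ R))"
      for x tp R
      by (rule runs_Seq[OF computesD[OF g(4)] computesD[OF f(4)]])
  qed (use f g poly_bounded_comp in \<open>auto intro!: poly_bounded_intros\<close>)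
qed

text \<open>The second component is computed first: the result computed last lies on top, and the
  code of a pair begins with its first component.\<close>

lemma ptime_Pair:
  assumes "ptime f" "ptime g"
  shows "ptime (\<lambda>x. (f x, g x))"
proof -
  obtain c T where f: "wf_com \<Gamma> 5 c" "poly_bounded (\<lambda>x. sz (f x))" "poly_bounded T"
    "computes c T f"
    using assms(1) unfolding ptime_def by blast
  obtain d U where g: "wf_com \<Gamma> 5 d" "poly_bounded (\<lambda>x. sz (g x))" "poly_bounded U"
    "computes d U g"
    using assms(2) unfolding ptime_def by blast
  show ?thesis
  proof (rule ptimeI)
    fix x tp R
    have "runs (dup ;; d ;; swap ;; c ;; push 0 (Work 1)) (conf tp (code (enc x) @ R))
       (50 * sz x + (U x + (30 * (sz (g x) + sz x) + (T x + 2))))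
       (conf tp (Work 1 # code (enc (f x)) @ code (enc (g x)) @ R))"
      unfolding sz_def
      by (rule runs_Seq[OF runs_dup runs_Seq[OF computesD[OF g(4)] runs_Seq[OF runs_swap runs_Seq[OF computesD[OF f(4)] runs_push_conf]]]])
    then show "runs (dup ;; d ;; swap ;; c ;; push 0 (Work 1)) (conf tp (code (enc x) @ R))
       (50 * sz x + (U x + (30 * (sz (g x) + sz x) + (T x + 2)))) (conf tp (code (enc (f x, g x)) @ R))"
      by (simp add: enc_prod_def)
  qed (use f g in \<open>auto intro!: poly_bounded_intros poly_bounded_sz\<close>)
qed

lemma ptime_fst0: "ptime fst"
proof (rule ptimeI)
  fix p :: "'a \<times> 'b" and tp R
  have "runs (pop 0 ;; swap ;; discard) (conf tp (Work 1 # code (enc (fst p)) @ code (enc (snd p)) @ R))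
     (1 + (30 * (tsize (enc (fst p)) + tsize (enc (snd p))) + 20 * tsize (enc (snd p))))
     (conf tp (code (enc (fst p)) @ R))"
    by (rule runs_Seq[OF runs_pop_conf runs_Seq[OF runs_swap runs_discard]])
  then have "runs (pop 0 ;; swap ;; discard) (conf tp (code (enc p) @ R))
     (1 + (30 * (tsize (enc (fst p)) + tsize (enc (snd p))) + 20 * tsize (enc (snd p))))
     (conf tp (code (enc (fst p)) @ R))"
    by (simp add: enc_prod_def)
  then show "runs (pop 0 ;; swap ;; discard) (conf tp (code (enc p) @ R)) (50 * sz p)
     (conf tp (code (enc (fst p)) @ R))"
    by (rule runs_mono) (simp add: sz_def enc_prod_def)
next
  show "poly_bounded (\<lambda>p :: 'a \<times> 'b. sz (fst p))"
    by (rule poly_bounded_mono[OF poly_bounded_sz]) (auto simp: sz_def enc_prod_def)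
qed (auto intro!: poly_bounded_intros poly_bounded_sz)

lemma ptime_snd0: "ptime snd"
proof (rule ptimeI)
  fix p :: "'a \<times> 'b" and tp R
  have "runs (pop 0 ;; discard) (conf tp (Work 1 # code (enc (fst p)) @ code (enc (snd p)) @ R))
     (1 + 20 * tsize (enc (fst p))) (conf tp (code (enc (snd p)) @ R))"
    by (rule runs_Seq[OF runs_pop_conf runs_discard])
  then have "runs (pop 0 ;; discard) (conf tp (code (enc p) @ R))
     (1 + 20 * tsize (enc (fst p))) (conf tp (code (enc (snd p)) @ R))"
    by (simp add: enc_prod_def)
  then show "runs (pop 0 ;; discard) (conf tp (code (enc p) @ R)) (50 * sz p)
     (conf tp (code (enc (snd p)) @ R))"
    by (rule runs_mono) (simp add: sz_def enc_prod_def)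
next
  show "poly_bounded (\<lambda>p :: 'a \<times> 'b. sz (snd p))"
    by (rule poly_bounded_mono[OF poly_bounded_sz]) (auto simp: sz_def enc_prod_def)
qed (auto intro!: poly_bounded_intros poly_bounded_sz)

lemma ptime_fst: "ptime f \<Longrightarrow> ptime (\<lambda>x. fst (f x))"
  by (rule ptime_comp[OF ptime_fst0])

lemma ptime_snd: "ptime f \<Longrightarrow> ptime (\<lambda>x. snd (f x))"
  by (rule ptime_comp[OF ptime_snd0])

lemma ptime_Cons:
  fixes f :: "'a::enc \<Rightarrow> 'b::enc"
  assumes "ptime f" "ptime g"
  shows "ptime (\<lambda>x. f x # g x)"
proof -
  have "ptime (\<lambda>p :: 'b \<times> 'b list. fst p # snd p)"
    by (rule ptime_recode) (simp add: enc_prod_def)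
  from ptime_comp[OF this ptime_Pair[OF assms]] show ?thesis
    by simp
qed

lemma ptime_Suc:
  assumes "ptime f"
  shows "ptime (\<lambda>x. Suc (f x))"
proof -
  have "ptime (\<lambda>p :: unit \<times> nat. Suc (snd p))"
    by (rule ptime_recode) (simp add: enc_prod_def enc_unit_def)
  from ptime_comp[OF this ptime_Pair[OF ptime_const assms]] show ?thesis
    by simp
qed

lemma ptime_eq:
  assumes "ptime f" "ptime g"
  shows "ptime (\<lambda>x. f x = g x)"
proof -
  obtain c T where f: "wf_com \<Gamma> 5 c" "poly_bounded (\<lambda>x. sz (f x))" "poly_bounded T"
    "computes c T f"
    using assms(1) unfolding ptime_def by blast
  obtain d U where g: "wf_com \<Gamma> 5 d" "poly_bounded (\<lambda>x. sz (g x))" "poly_bounded U"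
    "computes d U g"
    using assms(2) unfolding ptime_def by blast
  show ?thesis
  proof (rule ptimeI)
    fix x tp R
    have "runs (dup ;; d ;; swap ;; c ;; compare_trees) (conf tp (code (enc x) @ R))
       (50 * sz x + (U x + (30 * (sz (g x) + sz x) + (T x + 40 * (sz (f x) + sz (g x))))))
       (conf tp (code (if enc (f x) = enc (g x) then Node Leaf Leaf else Leaf) @ R))"
      unfolding sz_def
      by (rule runs_Seq[OF runs_dup runs_Seq[OF computesD[OF g(4)] runs_Seq[OF runs_swap runs_Seq[OF computesD[OF f(4)] runs_compare_trees]]]])
    then show "runs (dup ;; d ;; swap ;; c ;; compare_trees) (conf tp (code (enc x) @ R))
       (50 * sz x + (U x + (30 * (sz (g x) + sz x) + (T x + 40 * (sz (f x) + sz (g x))))))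
       (conf tp (code (enc (f x = g x)) @ R))"
      by (simp add: enc_bool_def enc_inject cong: if_cong)
  qed (use f g in \<open>auto intro!: poly_bounded_intros poly_bounded_sz
         poly_bounded_mono[OF poly_bounded_const sz_bool]\<close>)
qed

section \<open>Branching and loops\<close>

text \<open>The topmost symbol tells a node from a leaf, hence \<open>True\<close> from
  \<open>False\<close> and a nonempty list from the empty one.\<close>

definition test :: "'s com \<Rightarrow> 's com \<Rightarrow> 's com" where
  "test = Cond (\<lambda>as. as ! 1 = Work 1)"

lemma runs_test_True: "runs c (conf tp (Work 1 # S)) t T \<Longrightarrow> runs (test c d) (conf tp (Work 1 # S)) (Suc t) T"
  unfolding test_def conf_def by (intro runs_CondT) (auto simp del: nth_map)

lemma runs_test_False: "runs d (conf tp (Work 0 # S)) t T \<Longrightarrow> runs (test c d) (conf tp (Work 0 # S)) (Suc t) T"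
  unfolding test_def conf_def by (intro runs_CondF) (auto simp del: nth_map)

lemma wf_test [simp]: "wf_com \<Gamma> k (test c d) \<longleftrightarrow> wf_com \<Gamma> k c \<and> wf_com \<Gamma> k d"
  by (simp add: test_def)

lemma ptime_If:
  assumes "ptime b" "ptime f" "ptime g"
  shows "ptime (\<lambda>x. if b x then f x else g x)"
proof -
  obtain e V where b: "wf_com \<Gamma> 5 e" "poly_bounded (\<lambda>x. sz (b x))" "poly_bounded V"
    "computes e V b"
    using assms(1) unfolding ptime_def by blast
  obtain c T where f: "wf_com \<Gamma> 5 c" "poly_bounded (\<lambda>x. sz (f x))" "poly_bounded T"
    "computes c T f"
    using assms(2) unfolding ptime_def by blast
  obtain d U where g: "wf_com \<Gamma> 5 d" "poly_bounded (\<lambda>x. sz (g x))" "poly_bounded U"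
    "computes d U g"
    using assms(3) unfolding ptime_def by blast
  \<comment> \<open>\<open>True\<close> is coded by three symbols and \<open>False\<close> by one,
    which explains the numbers of pops.\<close>
  let ?c = "dup ;; e ;; test (pop 0 ;; pop 0 ;; pop 0 ;; c) (pop 0 ;; d)"
  show ?thesis
  proof (rule ptimeI)
    fix x tp R
    have "runs (test (pop 0 ;; pop 0 ;; pop 0 ;; c) (pop 0 ;; d)) (conf tp (code (enc (b x)) @ code (enc x) @ R))
       (Suc (3 + T x + U x)) (conf tp (code (enc (if b x then f x else g x)) @ R))"
    proof (cases "b x")
      case True
      have "runs (test (pop 0 ;; pop 0 ;; pop 0 ;; c) (pop 0 ;; d)) (conf tp (Work 1 # Work 0 # Work 0 # code (enc x) @ R))
       (Suc (1 + (1 + (1 + T x)))) (conf tp (code (enc (f x)) @ R))"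
        by (rule runs_test_True[OF runs_Seq[OF runs_pop_conf runs_Seq[OF runs_pop_conf
             runs_Seq[OF runs_pop_conf computesD[OF f(4)]]]]])
      with True show ?thesis
        by (auto simp: enc_bool_def elim!: runs_mono)
    next
      case False
      have "runs (test (pop 0 ;; pop 0 ;; pop 0 ;; c) (pop 0 ;; d)) (conf tp (Work 0 # code (enc x) @ R))
       (Suc (1 + U x)) (conf tp (code (enc (g x)) @ R))"
        by (rule runs_test_False[OF runs_Seq[OF runs_pop_conf computesD[OF g(4)]]])
      with False show ?thesis
        by (auto simp: enc_bool_def elim!: runs_mono)
    qed
    from runs_Seq[OF runs_dup runs_Seq[OF computesD[OF b(4)] this]]
    show "runs ?c (conf tp (code (enc x) @ R)) (50 * sz x + (V x + (Suc (3 + T x + U x))))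
        (conf tp (code (enc (if b x then f x else g x)) @ R))"
      unfolding sz_def .
  next
    show "poly_bounded (\<lambda>x. sz (if b x then f x else g x))"
      by (rule poly_bounded_mono[OF poly_bounded_add[OF f(2) g(2)]]) auto
  qed (use b f g in \<open>auto intro!: poly_bounded_intros poly_bounded_sz\<close>)
qed

lemma ptime_case_list:
  assumes "ptime l" "ptime f" "ptime (\<lambda>p. g (fst (fst p)) (snd (fst p)) (snd p))"
  shows "ptime (\<lambda>x. case l x of [] \<Rightarrow> f x | y # ys \<Rightarrow> g y ys x)"
proof -
  let ?g = "\<lambda>p. g (fst (fst p)) (snd (fst p)) (snd p)"
  obtain e V where l: "wf_com \<Gamma> 5 e" "poly_bounded (\<lambda>x. sz (l x))" "poly_bounded V"
    "computes e V l"
    using assms(1) unfolding ptime_def by blast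
  obtain c T where f: "wf_com \<Gamma> 5 c" "poly_bounded (\<lambda>x. sz (f x))" "poly_bounded T"
    "computes c T f"
    using assms(2) unfolding ptime_def by blast
  obtain d U where g: "wf_com \<Gamma> 5 d" "poly_bounded (\<lambda>p. sz (?g p))" "poly_bounded U"
    "computes d U ?g"
    using assms(3) unfolding ptime_def by blast
  \<comment> \<open>The list \<open>y # ys\<close> has the same tree as the pair
    \<open>(y, ys)\<close>. With one more \<open>Work 1\<close> in front, its code followed by that
    of \<open>x\<close> is the code of \<open>((y, ys), x)\<close>, the argument that
    \<open>d\<close> expects.\<close>
  let ?c = "dup ;; e ;; test (push 0 (Work 1) ;; d) (pop 0 ;; c)"
  let ?h = "\<lambda>x. case l x of [] \<Rightarrow> f x | y # ys \<Rightarrow> g y ys x"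
  let ?p = "\<lambda>x. case l x of [] \<Rightarrow> undefined | y # ys \<Rightarrow> ((y, ys), x)"
  obtain u where u: "\<And>p. U p \<le> poly u (sz p)"
    using g(3) unfolding poly_bounded_def by blast
  obtain v where v: "\<And>p. sz (?g p) \<le> poly v (sz p)"
    using g(2) unfolding poly_bounded_def by blast
  let ?s = "\<lambda>x. Suc (sz (l x) + sz x)"
  show ?thesis
  proof (rule ptimeI)
    fix x tp R
    have "runs (test (push 0 (Work 1) ;; d) (pop 0 ;; c)) (conf tp (code (enc (l x)) @ code (enc x) @ R))
       (Suc (2 + T x + poly u (?s x))) (conf tp (code (enc (?h x)) @ R))"
    proof (cases "l x")
      case Nil
      have "runs (test (push 0 (Work 1) ;; d) (pop 0 ;; c)) (conf tp (Work 0 # code (enc x) @ R))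
       (Suc (1 + T x)) (conf tp (code (enc (f x)) @ R))"
        by (rule runs_test_False[OF runs_Seq[OF runs_pop_conf computesD[OF f(4)]]])
      with Nil show ?thesis
        by (auto elim!: runs_mono)
    next
      case (Cons y ys)
      have "runs d (conf tp (code (enc ((y, ys), x)) @ R)) (U ((y, ys), x)) (conf tp (code (enc (g y ys x)) @ R))"
        using computesD[OF g(4), of tp "((y, ys), x)" R] by simp
      then have "runs d (conf tp (Work 1 # Work 1 # code (enc y) @ code (enc ys) @ code (enc x) @ R))
         (U ((y, ys), x)) (conf tp (code (enc (g y ys x)) @ R))"
        by (simp add: enc_prod_def)
      from runs_test_True[OF runs_Seq[OF runs_push_conf this]]
      have "runs (test (push 0 (Work 1) ;; d) (pop 0 ;; c)) (conf tp (code (enc (l x)) @ code (enc x) @ R))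
        (Suc (2 + U ((y, ys), x))) (conf tp (code (enc (g y ys x)) @ R))"
        using Cons by simp
      moreover have "U ((y, ys), x) \<le> poly u (?s x)"
        using u[of "((y, ys), x)"] Cons by simp
      ultimately show ?thesis
        using Cons by (auto elim!: runs_mono)
    qed
    from runs_Seq[OF runs_dup runs_Seq[OF computesD[OF l(4)] this]]
    show "runs ?c (conf tp (code (enc x) @ R)) (50 * sz x + (V x + (Suc (2 + T x + poly u (?s x)))))
        (conf tp (code (enc (?h x)) @ R))"
      unfolding sz_def .
  next
    have "poly_bounded (\<lambda>x. sz (f x) + poly v (?s x))"
      using f(2) l(2) by (auto intro!: poly_bounded_intros poly_bounded_sz poly_bounded_poly)
    moreover have "sz (?h x) \<le> sz (f x) + poly v (?s x)" for x
    proof (cases "l x")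
      case (Cons y ys)
      then show ?thesis
        using v[of "((y, ys), x)"] by simp
    qed simp
    ultimately show "poly_bounded (\<lambda>x. sz (?h x))"
      by (rule poly_bounded_mono)
  qed (use l f g in \<open>auto intro!: poly_bounded_intros poly_bounded_sz poly_bounded_poly\<close>)
qed

text \<open>\<open>N x\<close> is the exact number of rounds. A common bound \<open>B x\<close> on
  all iterates is required because a polynomial bound for a single round does not survive iteration:
  a function that doubles its argument already gives exponential growth.\<close>

lemma ptime_while:
  fixes f :: "'b::enc \<Rightarrow> 'b" and h :: "'a::enc \<Rightarrow> 'b"
  assumes "ptime b" "ptime f" "ptime h" "poly_bounded N" "poly_bounded B"
    and cont: "\<And>x i. i < N x \<Longrightarrow> b ((f ^^ i) (h x))"
    and stop: "\<And>x. \<not> b ((f ^^ N x) (h x))"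
    and size: "\<And>x i. i \<le> N x \<Longrightarrow> sz ((f ^^ i) (h x)) \<le> B x"
  shows "ptime (\<lambda>x. (f ^^ N x) (h x))"
proof -
  obtain e V where b: "wf_com \<Gamma> 5 e" "poly_bounded (\<lambda>x. sz (b x))" "poly_bounded V"
    "computes e V b"
    using assms(1) unfolding ptime_def by blast
  obtain c T where f: "wf_com \<Gamma> 5 c" "poly_bounded (\<lambda>x. sz (f x))" "poly_bounded T"
    "computes c T f"
    using assms(2) unfolding ptime_def by blast
  obtain d U where h: "wf_com \<Gamma> 5 d" "poly_bounded (\<lambda>x. sz (h x))" "poly_bounded U" "computes d U h"
    using assms(3) unfolding ptime_def by blast
  obtain v where v: "\<And>x. V x \<le> poly v (sz x)"
    using b(3) unfolding poly_bounded_def by blast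
  obtain u where u: "\<And>x. T x \<le> poly u (sz x)"
    using f(3) unfolding poly_bounded_def by blast
  \<comment> \<open>Before each test the value of \<open>b\<close> lies above the current iterate.
    The body first removes the three symbols of \<open>True\<close>; after the last round the single
    symbol of \<open>False\<close> remains and is popped outside the loop.\<close>
  let ?W = "While (\<lambda>as. as ! 1 = Work 1) (pop 0 ;; pop 0 ;; pop 0 ;; c ;; dup ;; e)"
  let ?t = "\<lambda>x. 50 * B x + poly v (B x)"
  let ?step = "\<lambda>x. Suc (3 + poly u (B x) + ?t x)"
  have check: "runs (dup ;; e) (conf tp (code (enc ((f ^^ i) (h x))) @ R)) (?t x)
     (conf tp (code (enc (b ((f ^^ i) (h x)))) @ code (enc ((f ^^ i) (h x))) @ R))" if "i \<le> N x" for i x tp R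
  proof -
    have "V ((f ^^ i) (h x)) \<le> poly v (B x)"
      using v[of "(f ^^ i) (h x)"] poly_mono_nat[OF size[OF that], of v] by simp
    then show ?thesis
      using runs_mono[OF runs_Seq[OF runs_dup computesD[OF b(4)]]] size[OF that]
      unfolding sz_def by (metis add_mono mult_le_mono2)
  qed
  have loop: "runs ?W (conf tp (code (enc (b ((f ^^ i) (h x)))) @ code (enc ((f ^^ i) (h x))) @ R))
     (k * ?step x + 1) (conf tp (Work 0 # code (enc ((f ^^ N x) (h x))) @ R))" if "i + k = N x" for i k x tp R
    using that
  proof (induction k arbitrary: i)
    case 0
    then have "i = N x" by simp
    then show ?case
      using stop[of x] runs_WhileF[of "\<lambda>as. as ! 1 = Work 1" "conf tp (Work 0 # code (enc ((f ^^ N x) (h x))) @ R)"]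
      by (simp add: enc_bool_def conf_def del: nth_map)
  next
    case (Suc k)
    let ?y = "(f ^^ i) (h x)"
    have y: "(f ^^ Suc i) (h x) = f ?y" by simp
    have "T ?y \<le> poly u (B x)"
      using u[of ?y] poly_mono_nat[OF size[of i x], of u] Suc.prems by simp
    then have "1 + (1 + (1 + (T ?y + ?t x))) \<le> 3 + poly u (B x) + ?t x"
      by simp
    moreover have "runs (pop 0 ;; pop 0 ;; pop 0 ;; c ;; dup ;; e) (conf tp (Work 1 # Work 0 # Work 0 # code (enc ?y) @ R))
      (1 + (1 + (1 + (T ?y + ?t x))))
      (conf tp (code (enc (b ((f ^^ Suc i) (h x)))) @ code (enc ((f ^^ Suc i) (h x))) @ R))"
      using check[of "Suc i" x] Suc.prems unfolding y
      by (intro runs_Seq[OF runs_pop_conf runs_Seq[OF runs_pop_conf runs_Seq[OF runs_pop_conf runs_Seq[OF computesD[OF f(4)]]]]]) simp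
    ultimately have body: "runs (pop 0 ;; pop 0 ;; pop 0 ;; c ;; dup ;; e)
      (conf tp (Work 1 # Work 0 # Work 0 # code (enc ?y) @ R)) (3 + poly u (B x) + ?t x)
      (conf tp (code (enc (b ((f ^^ Suc i) (h x)))) @ code (enc ((f ^^ Suc i) (h x))) @ R))"
      using runs_mono by blast
    have "b ?y"
      using cont[of i x] Suc.prems by simp
    then have S: "code (enc (b ?y)) @ code (enc ?y) @ R = Work 1 # Work 0 # Work 0 # code (enc ?y) @ R"
      by (simp add: enc_bool_def)
    have "map tape_read (conf tp (Work 1 # Work 0 # Work 0 # code (enc ?y) @ R)) ! 1 = Work 1"
      by (simp add: conf_def del: nth_map)
    then have "runs ?W (conf tp (code (enc (b ?y)) @ code (enc ?y) @ R))
      (Suc (3 + poly u (B x) + ?t x + (k * ?step x + 1)))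
      (conf tp (Work 0 # code (enc ((f ^^ N x) (h x))) @ R))"
      unfolding S by (rule runs_WhileT[OF _ body Suc.IH]) (use Suc.prems in simp)
    then show ?case
      by (simp add: algebra_simps)
  qed
  show ?thesis
  proof (rule ptimeI)
    fix x tp R
    have "runs (dup ;; e) (conf tp (code (enc (h x)) @ R)) (?t x)
     (conf tp (code (enc (b (h x))) @ code (enc (h x)) @ R))"
      using check[of 0 x tp R] by simp
    from runs_Seq[OF computesD[OF h(4)] runs_Seq[OF this
        runs_Seq[OF loop[of 0 "N x" x, simplified] runs_pop_conf]]]
    show "runs (d ;; (dup ;; e) ;; ?W ;; pop 0) (conf tp (code (enc x) @ R))
      (U x + (?t x + ((N x * ?step x + 1) + 1))) (conf tp (code (enc ((f ^^ N x) (h x))) @ R))"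
      by simp
  next
    show "poly_bounded (\<lambda>x. sz ((f ^^ N x) (h x)))"
      by (rule poly_bounded_mono[OF assms(5) size]) simp
  qed (use b f h assms(4,5) in \<open>auto intro!: poly_bounded_intros poly_bounded_sz poly_bounded_poly\<close>)
qed

subsection \<open>Lists\<close>

text \<open>The workhorse for all later running times: the size bound has to hold after every prefix
  of the list, which is why the invariants below are stated for folds over arbitrary lists.\<close>

lemma ptime_foldl:
  assumes "ptime (\<lambda>p. step (fst p) (fst (snd p)) (snd (snd p)))" "ptime init" "ptime l"
    and "poly_bounded B"
    and size: "\<And>x i. sz (foldl (\<lambda>s y. step s y x) (init x) (take i (l x))) \<le> B x"
  shows "ptime (\<lambda>x. foldl (\<lambda>s y. step s y x) (init x) (l x))"
proof -
  \<comment> \<open>The state consists of the unread part of the list, the accumulator and the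
    unchanged input \<open>x\<close>, which \<open>step\<close> may consult.\<close>
  define F where "F = (\<lambda>p. case fst p of [] \<Rightarrow> p
     | y # ys \<Rightarrow> (ys, step (fst (snd p)) y (snd (snd p)), snd (snd p)))"
  let ?h = "\<lambda>x. (l x, init x, x)"
  have F_simp: "F (y # ys, s, x) = (ys, step s y x, x)" for y ys s x
    by (simp add: F_def)
  have iter: "(F ^^ i) (ys, s, x) = (drop i ys, foldl (\<lambda>s y. step s y x) s (take i ys), x)"
    if "i \<le> length ys" for i ys s x
    using that
  proof (induction i arbitrary: ys s)
    case (Suc i)
    then obtain y zs where "ys = y # zs" by (cases ys) auto
    with Suc show ?case
      by (simp only: funpow_Suc_right comp_apply F_simp) simp
  qed simp
  have F: "ptime F"
    unfolding F_def
  proof (rule ptime_case_list)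
    have "ptime (\<lambda>p. (\<lambda>q. step (fst q) (fst (snd q)) (snd (snd q)))
        (fst (snd (snd p)), fst (fst p), snd (snd (snd p))))"
      by (rule ptime_comp[OF assms(1)]) (intro ptime_Pair ptime_fst ptime_snd ptime_id)
    then show "ptime (\<lambda>p. (snd (fst p), step (fst (snd (snd p))) (fst (fst p)) (snd (snd (snd p))), snd (snd (snd p))))"
      by (intro ptime_Pair ptime_fst ptime_snd ptime_id) simp
  qed (intro ptime_fst ptime_id)+
  have "ptime (\<lambda>x. (F ^^ length (l x)) (?h x))"
  proof (rule ptime_while)
    show "ptime (\<lambda>p. if fst p = [] then False else True)"
      by (intro ptime_If ptime_eq ptime_fst ptime_id ptime_const)
    show "poly_bounded (\<lambda>x. length (l x))"
      by (intro poly_bounded_length ptime_size assms)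
    show "poly_bounded (\<lambda>x. Suc (sz (l x) + Suc (B x + sz x)))"
      by (intro poly_bounded_intros poly_bounded_sz ptime_size assms)
    show "sz ((F ^^ i) (?h x)) \<le> Suc (sz (l x) + Suc (B x + sz x))" if "i \<le> length (l x)" for x i
    proof -
      have "sz (drop i (l x)) \<le> sz (l x)"
        using sz_append[of "take i (l x)" "drop i (l x)"] sz_ge_1[of "take i (l x)"]
        unfolding append_take_drop_id by linarith
      then show ?thesis
        using size[of x i] that by (simp add: iter)
    qed
  qed (use F assms in \<open>auto simp: iter intro!: ptime_Pair ptime_id\<close>)
  from ptime_fst[OF ptime_snd[OF this]] show ?thesis
    by (simp add: iter)
qed

lemma foldl_Cons: "foldl (\<lambda>s y. g y # s) s xs = rev (map g xs) @ s"
  by (induction xs arbitrary: s) auto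

lemma ptime_rev:
  assumes "ptime l"
  shows "ptime (\<lambda>x. rev (l x))"
proof -
  have "ptime (\<lambda>x. foldl (\<lambda>s y. y # s) [] (l x))"
  proof (rule ptime_foldl)
    show "ptime (\<lambda>p. fst (snd p) # fst p)"
      by (intro ptime_Cons ptime_fst ptime_snd ptime_id)
    show "poly_bounded (\<lambda>x. sz (l x))"
      by (rule ptime_size[OF assms])
  qed (simp_all add: foldl_Cons[where g = "\<lambda>y. y"] sz_take_le ptime_const assms)
  then show ?thesis
    by (simp add: foldl_Cons[where g = "\<lambda>y. y"])
qed

lemma ptime_append:
  assumes "ptime f" "ptime g"
  shows "ptime (\<lambda>x. f x @ g x)"
proof -
  have "ptime (\<lambda>x. foldl (\<lambda>s y. y # s) (g x) (rev (f x)))"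
  proof (rule ptime_foldl)
    show "ptime (\<lambda>p. fst (snd p) # fst p)"
      by (intro ptime_Cons ptime_fst ptime_snd ptime_id)
    show "poly_bounded (\<lambda>x. sz (f x) + sz (g x))"
      by (intro poly_bounded_intros ptime_size assms)
    show "sz (foldl (\<lambda>s y. y # s) (g x) (take i (rev (f x)))) \<le> sz (f x) + sz (g x)" for x i
      using sz_take_le[of i "rev (f x)"] by (simp add: foldl_Cons[where g = "\<lambda>y. y"] le_diff_conv)
  qed (intro ptime_rev assms)+
  then show ?thesis
    by (simp add: foldl_Cons[where g = "\<lambda>y. y"])
qed

lemma ptime_map:
  assumes "ptime (\<lambda>p. g (fst p) (snd p))" "ptime l"
  shows "ptime (\<lambda>x. map (\<lambda>y. g y x) (l x))"
proof -
  obtain q where q: "\<And>p. sz (g (fst p) (snd p)) \<le> poly q (sz p)"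
    using ptime_size[OF assms(1)] unfolding poly_bounded_def by blast
  let ?b = "\<lambda>x. poly q (Suc (sz (l x) + sz x))"
  have "ptime (\<lambda>x. foldl (\<lambda>s y. g y x # s) [] (l x))"
  proof (rule ptime_foldl)
    have "ptime (\<lambda>p. (\<lambda>q. g (fst q) (snd q)) (fst (snd p), snd (snd p)))"
      by (rule ptime_comp[OF assms(1)]) (intro ptime_Pair ptime_fst ptime_snd ptime_id)
    then show "ptime (\<lambda>p. g (fst (snd p)) (snd (snd p)) # fst p)"
      by (intro ptime_Cons ptime_fst ptime_id) simp
    show "poly_bounded (\<lambda>x. Suc (length (l x) * Suc (?b x)))"
      by (intro poly_bounded_intros poly_bounded_poly poly_bounded_sz ptime_size assms)
    show "sz (foldl (\<lambda>s y. g y x # s) [] (take i (l x))) \<le> Suc (length (l x) * Suc (?b x))" for x i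
    proof -
      have "sz (g y x) \<le> ?b x" if "y \<in> set (l x)" for y
      proof -
        have "sz (g y x) \<le> poly q (sz (y, x))"
          using q[of "(y, x)"] by simp
        also have "\<dots> \<le> ?b x"
          using sz_nth_le[OF that] by (intro poly_mono_nat) simp
        finally show ?thesis .
      qed
      then have "sz (map (\<lambda>y. g y x) (take i (l x))) \<le> Suc (length (l x) * Suc (?b x))"
        by (intro sz_list_le) (auto dest: in_set_takeD)
      then show ?thesis
        by (simp add: foldl_Cons)
    qed
  qed (intro ptime_const assms)+
  from ptime_rev[OF this] show ?thesis
    by (simp add: foldl_Cons)
qed

lemma sz_concat_le: "sz (concat xss) \<le> sz xss"
  by (induction xss) auto

lemma foldl_append: "foldl (\<lambda>s y. s @ y) s xss = s @ concat xss"
  by (induction xss arbitrary: s) auto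

lemma ptime_concat:
  assumes "ptime l"
  shows "ptime (\<lambda>x. concat (l x))"
proof -
  have "ptime (\<lambda>x. foldl (\<lambda>s y. s @ y) [] (l x))"
  proof (rule ptime_foldl)
    show "ptime (\<lambda>p. fst p @ fst (snd p))"
      by (intro ptime_append ptime_fst ptime_snd ptime_id)
    show "poly_bounded (\<lambda>x. sz (l x))"
      by (rule ptime_size[OF assms])
    show "sz (foldl (\<lambda>s y. s @ y) [] (take i (l x))) \<le> sz (l x)" for x i
      using sz_concat_le[of "take i (l x)"] sz_take_le[of i "l x"] by (simp add: foldl_append)
  qed (intro ptime_const assms)+
  then show ?thesis
    by (simp add: foldl_append)
qed

lemma ptime_not:
  assumes "ptime b"
  shows "ptime (\<lambda>x. \<not> b x)"
proof -
  have "(\<lambda>x. \<not> b x) = (\<lambda>x. if b x then False else True)" by auto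
  then show ?thesis
    using ptime_If[OF assms ptime_const[of False] ptime_const[of True]] by simp
qed

lemma ptime_conj:
  assumes "ptime b" "ptime c"
  shows "ptime (\<lambda>x. b x \<and> c x)"
proof -
  have "(\<lambda>x. b x \<and> c x) = (\<lambda>x. if b x then c x else False)" by auto
  then show ?thesis
    using ptime_If[OF assms ptime_const[of False]] by simp
qed

lemma ptime_disj:
  assumes "ptime b" "ptime c"
  shows "ptime (\<lambda>x. b x \<or> c x)"
proof -
  have "(\<lambda>x. b x \<or> c x) = (\<lambda>x. if b x then True else c x)" by auto
  then show ?thesis
    using ptime_If[OF assms(1) ptime_const[of True] assms(2)] by simp
qed

lemma ptime_tl: "ptime l \<Longrightarrow> ptime (\<lambda>x. tl (l x))"
  unfolding tl_def
  by (erule ptime_case_list[where g = "\<lambda>y ys x. ys"]) (intro ptime_const ptime_fst ptime_snd ptime_id)+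

lemma take_Suc_case: "take (Suc n) xs = (case xs of [] \<Rightarrow> [] | y # ys \<Rightarrow> y # take n ys)"
  by (cases xs) auto

text \<open>The number \<open>n\<close> belongs to the program and not to its input; the induction
  produces one program for each \<open>n\<close>.\<close>

lemma ptime_take0: "ptime (take n)"
proof (induction n)
  case 0
  have "take 0 = (\<lambda>xs :: 'a list. [])" by auto
  then show ?case using ptime_const by simp
next
  case (Suc n)
  have "ptime (\<lambda>xs :: 'a list. case xs of [] \<Rightarrow> [] | y # ys \<Rightarrow> y # take n ys)"
    by (rule ptime_case_list[where g = "\<lambda>y ys x. y # take n ys"])
      (intro ptime_Cons ptime_const ptime_fst ptime_snd ptime_id ptime_comp[OF Suc.IH])+
  then show ?case by (simp add: take_Suc_case[abs_def])
qed

lemma ptime_take: "ptime l \<Longrightarrow> ptime (\<lambda>x. take n (l x))"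
  by (rule ptime_comp[OF ptime_take0])

lemma ptime_drop: "ptime l \<Longrightarrow> ptime (\<lambda>x. drop n (l x))"
  by (induction n arbitrary: l) (auto simp: drop_Suc intro!: ptime_tl)

lemma ptime_funpow:
  fixes f :: "'b::enc \<Rightarrow> 'b" and l :: "'a::enc \<Rightarrow> 'b"
  shows "ptime f \<Longrightarrow> ptime l \<Longrightarrow> ptime (\<lambda>x. (f ^^ n) (l x))"
  by (induction n) (auto intro: ptime_comp)

text \<open>Any function on a finite set can be hard-wired as a cascade of comparisons, whether or
  not it is given effectively. In this way the data of the group enter the machine.\<close>

lemma ptime_finite_table:
  assumes "finite D" "ptime f"
  shows "ptime (\<lambda>x. if x \<in> D then h x else f x)"
  using assms(1)
proof induction
  case empty
  then show ?case using assms(2) by simp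
next
  case (insert a D)
  have "ptime (\<lambda>x. if x = a then h a else if x \<in> D then h x else f x)"
    by (intro ptime_If ptime_eq ptime_id ptime_const insert.IH)
  moreover have "(\<lambda>x. if x = a then h a else if x \<in> D then h x else f x) =
      (\<lambda>x. if x \<in> insert a D then h x else f x)"
    by auto
  ultimately show ?case by simp
qed

lemmas ptime_intros =
  ptime_id ptime_const ptime_Pair ptime_fst ptime_snd ptime_Cons ptime_Suc ptime_eq ptime_If
  ptime_rev ptime_append ptime_map ptime_concat ptime_not ptime_conj ptime_disj ptime_tl ptime_take ptime_drop

subsection \<open>Input and output\<close>

text \<open>Trees contain no input symbols, so a symbol is represented by its number under
  \<open>idx\<close>; the cascade runs through the finite alphabet.\<close>

fun push_symbol :: "('s \<Rightarrow> nat) \<Rightarrow> 's list \<Rightarrow> 's com" where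
  "push_symbol idx [] = skip"
| "push_symbol idx (s # ss) = Cond (\<lambda>as. as ! 0 = Sym s) (push_tree (enc (idx s)) ;; push 0 (Work 1))
     (push_symbol idx ss)"

lemma wf_push_symbol: "wf_com \<Gamma> 5 (push_symbol idx ss)"
  by (induction ss) auto

lemma runs_push_symbol:
  assumes "tape_read tp = Sym s" "s \<in> set ss" "\<And>s. s \<in> set ss \<Longrightarrow> 2 * sz (idx s) \<le> b"
  shows "runs (push_symbol idx ss) (conf tp S) (b + length ss + 2) (conf tp (Work 1 # code (enc (idx s)) @ S))"
  using assms(2,3)
proof (induction ss)
  case (Cons s' ss)
  have read: "map tape_read (conf tp S) ! 0 = Sym s"
    by (simp add: conf_def assms(1) del: nth_map)
  show ?case
  proof (cases "s' = s")
    case True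
    have "runs (push_symbol idx (s' # ss)) (conf tp S) (Suc (2 * sz (idx s) + 2)) (conf tp (Work 1 # code (enc (idx s)) @ S))"
      using read unfolding push_symbol.simps sz_def True
      by (rule runs_CondT[OF _ runs_Seq[OF runs_push_tree runs_push_conf]])
    then show ?thesis
      using Cons.prems(2)[of s] True by (auto elim!: runs_mono)
  next
    case False
    then have "runs (push_symbol idx ss) (conf tp S) (b + length ss + 2) (conf tp (Work 1 # code (enc (idx s)) @ S))"
      using Cons by auto
    then have "runs (push_symbol idx (s' # ss)) (conf tp S) (Suc (b + length ss + 2)) (conf tp (Work 1 # code (enc (idx s)) @ S))"
      using read False unfolding push_symbol.simps by (intro runs_CondF) auto
    then show ?thesis by simp
  qed
qed simp

abbreviation go_right :: "'s com" where
  "go_right \<equiv> While (\<lambda>as. as ! 0 \<noteq> Blank) (Act 0 (\<lambda>as. (as ! 0, Right)))"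

abbreviation collect :: "('s \<Rightarrow> nat) \<Rightarrow> 's list \<Rightarrow> 's com" where
  "collect idx ss \<equiv> While (\<lambda>as. as ! 0 \<noteq> Blank) (push_symbol idx ss ;; Act 0 (\<lambda>as. (Blank, Left)))"

text \<open>The code of a list is built on a stack from its end, so the head first runs to the right
  end of the input. On the way back the input is erased, which leaves a blank tape for the output;
  the final move corrects the head from position -1 to 0.\<close>

definition read_input :: "('s \<Rightarrow> nat) \<Rightarrow> 's list \<Rightarrow> 's com" where
  "read_input idx ss =
     go_right ;;
     Act 0 (\<lambda>as. (as ! 0, Left)) ;;
     push 0 (Work 0) ;;
     (collect idx ss) ;;
     Act 0 (\<lambda>as. (Blank, Right))"

lemma conf_read0 [simp]: "map tape_read (conf tp S) ! 0 = tape_read tp"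
  by (simp add: conf_def del: nth_map)

lemma runs_Act0_conf:
  "runs (Act 0 g) (conf tp S) 1 (conf (tape_act (g (map tape_read (conf tp S))) tp) S)"
  unfolding conf_def by (rule runs_Act0)

lemma tape_read_word:
  "tape_read (word_contents x, int k) = (if k < length x then Sym (x ! k) else Blank)"
  by (simp add: tape_read_def word_contents_def)

lemma runs_go_right:
  assumes "k \<le> length x"
  shows "runs (go_right) (conf (word_contents x, int k) S)
     (2 * (length x - k) + 1) (conf (word_contents x, int (length x)) S)"
  using assms
proof (induction "length x - k" arbitrary: k)
  case 0
  then have "runs (go_right) (conf (word_contents x, int k) S)
     1 (conf (word_contents x, int k) S)"
    by (intro runs_WhileF) (simp add: tape_read_word del: nth_map)
  with 0 show ?case by simp
next
  case (Suc n)
  have act: "tape_act (tape_read (word_contents x, int k), Right) (word_contents x, int k) = (word_contents x, int (Suc k))"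
    by (simp add: tape_act_def tape_read_def)
  have "runs (Act 0 (\<lambda>as. (as ! 0, Right))) (conf (word_contents x, int k) S) 1 (conf (word_contents x, int (Suc k)) S)"
    using runs_Act0_conf[of "\<lambda>as. (as ! 0, Right)" "(word_contents x, int k)" S]
    by (simp add: act del: nth_map of_nat_Suc)
  then have "runs (go_right) (conf (word_contents x, int k) S)
     (Suc (1 + (2 * (length x - Suc k) + 1))) (conf (word_contents x, int (length x)) S)"
    using Suc by (intro runs_WhileT[OF _ _ Suc.hyps(1)]) (auto simp: tape_read_word simp del: nth_map)
  then show ?case
    by (rule runs_mono) (use Suc in linarith)
qed

lemma runs_collect:
  assumes "set x \<subseteq> set ss" "\<And>s. s \<in> set ss \<Longrightarrow> 2 * sz (idx s) \<le> b" "k \<le> length x"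
  shows "runs (collect idx ss)
     (conf (word_contents (take k x), int k - 1) (code (enc (map idx (drop k x)))))
     (k * (b + length ss + 4) + 1)
     (conf (\<lambda>_. Blank, - 1) (code (enc (map idx x))))"
  using assms(3)
proof (induction k)
  case 0
  have e: "word_contents [] = (\<lambda>_. Blank)"
    by (auto simp: word_contents_def)
  have "runs (collect idx ss)
     (conf (\<lambda>_. Blank, - 1) (code (enc (map idx x)))) 1 (conf (\<lambda>_. Blank, - 1) (code (enc (map idx x))))"
    by (rule runs_WhileF) (simp add: tape_read_def del: nth_map)
  then show ?case
    by (simp add: e)
next
  case (Suc k)
  let ?tp = "(word_contents (take (Suc k) x), int k)"
  let ?S = "code (enc (map idx (drop (Suc k) x))) :: 's tape_sym list"
  have read: "tape_read ?tp = Sym (x ! k)"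
    using Suc.prems by (simp add: tape_read_word)
  have "x ! k \<in> set ss"
    using Suc.prems assms(1) by auto
  from runs_push_symbol[OF read this assms(2)]
  have "runs (push_symbol idx ss) (conf ?tp ?S) (b + length ss + 2)
     (conf ?tp (Work 1 # code (enc (idx (x ! k))) @ ?S))"
    by simp
  moreover have "Work 1 # code (enc (idx (x ! k))) @ ?S = code (enc (map idx (drop k x)))"
    using Suc.prems by (simp add: Cons_nth_drop_Suc[symmetric])
  ultimately have push: "runs (push_symbol idx ss) (conf ?tp ?S) (b + length ss + 2)
     (conf ?tp (code (enc (map idx (drop k x)))))"
    by simp
  have "tape_act (Blank, Left) ?tp = (word_contents (take k x), int k - 1)"
    using Suc.prems by (auto simp: tape_act_def word_contents_def fun_eq_iff)
  then have "runs (Act 0 (\<lambda>as. (Blank, Left))) (conf ?tp (code (enc (map idx (drop k x))))) 1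
     (conf (word_contents (take k x), int k - 1) (code (enc (map idx (drop k x)))))"
    using runs_Act0_conf[of "\<lambda>as. (Blank, Left)" ?tp "code (enc (map idx (drop k x)))"] by simp
  from runs_WhileT[OF _ runs_Seq[OF push this] Suc.IH]
  have "runs (collect idx ss)
     (conf ?tp ?S) (Suc (b + length ss + 2 + 1 + (k * (b + length ss + 4) + 1)))
     (conf (\<lambda>_. Blank, - 1) (code (enc (map idx x))))"
    using Suc.prems read by (simp del: nth_map)
  then show ?case
    by (auto simp: algebra_simps elim!: runs_mono)
qed

lemma runs_read_input:
  assumes "set x \<subseteq> set ss" "\<And>s. s \<in> set ss \<Longrightarrow> 2 * sz (idx s) \<le> b"
  shows "runs (read_input idx ss) (conf (word_contents x, 0) [])
     (length x * (b + length ss + 6) + 7)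
     (conf (\<lambda>_. Blank, 0) (code (enc (map idx x))))"
proof -
  have left: "tape_act (tape_read (word_contents x, int (length x)), Left) (word_contents x, int (length x))
      = (word_contents x, int (length x) - 1)"
    by (simp add: tape_act_def tape_read_def)
  have right: "tape_act (Blank, Right) (\<lambda>_. Blank, - 1) = (\<lambda>_. Blank, 0)"
    by (simp add: tape_act_def fun_eq_iff)
  have "runs (read_input idx ss) (conf (word_contents x, 0) [])
     ((2 * (length x - 0) + 1) + (1 + (2 + ((length x * (b + length ss + 4) + 1) + 1))))
     (conf (\<lambda>_. Blank, 0) (code (enc (map idx x))))"
    unfolding read_input_def
  proof (intro runs_Seq)
    show "runs (go_right) (conf (word_contents x, 0) [])
       (2 * (length x - 0) + 1) (conf (word_contents x, int (length x)) [])"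
      using runs_go_right[of 0 x "[]"] by simp
    show "runs (Act 0 (\<lambda>as. (as ! 0, Left))) (conf (word_contents x, int (length x)) []) 1
       (conf (word_contents x, int (length x) - 1) [])"
      using runs_Act0_conf[of "\<lambda>as. (as ! 0, Left)" "(word_contents x, int (length x))" "[]"]
      by (simp add: left del: nth_map)
    show "runs (push 0 (Work 0)) (conf (word_contents x, int (length x) - 1) []) 2
       (conf (word_contents x, int (length x) - 1) [Work 0])"
      by (rule runs_push_conf)
    show "runs (collect idx ss)
       (conf (word_contents x, int (length x) - 1) [Work 0]) (length x * (b + length ss + 4) + 1)
       (conf (\<lambda>_. Blank, - 1) (code (enc (map idx x))))"
      using runs_collect[OF assms, where k = "length x"] by simp
    show "runs (Act 0 (\<lambda>as. (Blank, Right))) (conf (\<lambda>_. Blank, - 1) (code (enc (map idx x)))) 1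
       (conf (\<lambda>_. Blank, 0) (code (enc (map idx x))))"
      using runs_Act0_conf[of "\<lambda>as. (Blank, Right)" "(\<lambda>_. Blank, - 1)"] by (simp add: right)
  qed
  then show ?thesis
    by (rule runs_mono) (simp add: algebra_simps)
qed

abbreviation write_bit :: "(bool \<Rightarrow> 's) \<Rightarrow> 's com" where
  "write_bit out \<equiv> test (pop 0 ;; pop 0 ;; pop 0 ;; Act 0 (\<lambda>as. (Sym (out True), Right)))
       (pop 0 ;; Act 0 (\<lambda>as. (Sym (out False), Right)))"

definition write_output :: "(bool \<Rightarrow> 's) \<Rightarrow> 's com" where
  "write_output out = While (\<lambda>as. as ! 1 = Work 1) (pop 0 ;;
     write_bit out)"

lemma runs_write_output:
  "runs (write_output out) (conf (word_contents ys, int (length ys)) (code (enc bs))) (7 * length bs + 1)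
     (conf (word_contents (ys @ map out bs), int (length (ys @ map out bs))) [Work 0])"
proof (induction bs arbitrary: ys)
  case Nil
  have "map tape_read (conf (word_contents ys, int (length ys)) [Work 0]) ! 1 \<noteq> Work 1"
    by (simp add: conf_def del: nth_map)
  then show ?case
    using runs_WhileF[of "\<lambda>as. as ! 1 = Work 1"] by (simp add: write_output_def)
next
  case (Cons b bs)
  let ?tp = "(word_contents ys, int (length ys))"
  let ?tp' = "(word_contents (ys @ [out b]), int (length (ys @ [out b])))"
  let ?S = "code (enc bs)"
  have act: "tape_act (Sym (out b), Right) ?tp = ?tp'"
    by (auto simp: tape_act_def word_contents_def fun_eq_iff nth_append)
  have wr: "runs (Act 0 (\<lambda>as. (Sym (out b), Right))) (conf ?tp ?S) 1 (conf ?tp' ?S)"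
    using runs_Act0_conf[of "\<lambda>as. (Sym (out b), Right)" ?tp ?S] unfolding act .
  have "runs (write_bit out) (conf ?tp (code (enc b) @ ?S)) 5 (conf ?tp' ?S)"
  proof (cases b)
    case True
    have "runs (write_bit out) (conf ?tp (Work 1 # Work 0 # Work 0 # ?S))
       (Suc (1 + (1 + (1 + 1)))) (conf ?tp' ?S)"
      using wr True
      by (intro runs_test_True runs_Seq[OF runs_pop_conf runs_Seq[OF runs_pop_conf runs_Seq[OF runs_pop_conf]]]) simp
    with True show ?thesis
      by (auto simp: enc_bool_def elim!: runs_mono)
  next
    case False
    have "runs (write_bit out) (conf ?tp (Work 0 # ?S))
       (Suc (1 + 1)) (conf ?tp' ?S)"
      using wr False by (intro runs_test_False runs_Seq[OF runs_pop_conf]) simp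
    with False show ?thesis
      by (auto simp: enc_bool_def elim!: runs_mono)
  qed
  from runs_WhileT[OF _ runs_Seq[OF runs_pop_conf this] Cons.IH[of "ys @ [out b]", unfolded write_output_def], of "Work 1"]
  have "runs (write_output out) (conf ?tp (Work 1 # code (enc b) @ ?S)) (Suc (1 + 5 + (7 * length bs + 1)))
     (conf (word_contents ((ys @ [out b]) @ map out bs), int (length ((ys @ [out b]) @ map out bs))) [Work 0])"
    by (simp add: write_output_def conf_def del: nth_map)
  then show ?case
    by (auto simp: algebra_simps elim!: runs_mono)
qed

theorem ptime_machine:
  fixes f :: "nat list \<Rightarrow> bool list" and idx :: "'s \<Rightarrow> nat"
  assumes "ptime f" "finite \<Sigma>" "range out \<subseteq> \<Sigma>"
  shows "\<exists>M p. wf_TM \<Sigma> M \<and> (\<forall>x \<in> lists \<Sigma>. \<exists>t \<le> poly p (length x).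
     TM_outputs_after M x t (map out (f (map idx x))))"
proof -
  obtain c T where f: "wf_com \<Gamma> 5 c" "poly_bounded (\<lambda>x. sz (f x))" "poly_bounded T" "computes c T f"
    using assms(1) unfolding ptime_def by blast
  obtain u where u: "\<And>x. T x \<le> poly u (sz x)"
    using f(3) unfolding poly_bounded_def by blast
  obtain v where v: "\<And>x. sz (f x) \<le> poly v (sz x)"
    using f(2) unfolding poly_bounded_def by blast
  obtain ss where ss: "set ss = \<Sigma>"
    using finite_list[OF assms(2)] by blast
  \<comment> \<open>A common bound on the cost of pushing the number of one symbol. It makes the
    size of the encoded input linear in its length.\<close>
  define b where "b = (\<Sum>s\<leftarrow>ss. 2 * sz (idx s))"
  have b: "2 * sz (idx s) \<le> b" if "s \<in> set ss" for s
    unfolding b_def using that by (intro member_le_sum_list) auto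
  let ?c = "read_input idx ss ;; c ;; write_output out"
  have "wf_com \<Gamma> 5 ?c"
    using f(1) assms(3)
    by (auto simp: read_input_def write_output_def wf_push_symbol in_lists_conv_set)
      (auto simp: \<Gamma>_def)
  then have wf: "wf_TM \<Sigma> (machine 5 \<Gamma> ?c)"
    using assms(2) by (intro wf_machine) (auto simp: \<Gamma>_def)
  have sz_in: "sz (map idx x) \<le> Suc (length x * Suc b)" if "set x \<subseteq> \<Sigma>" for x
    using b that ss by (intro sz_list_le) fastforce+
  let ?s = "[:1, Suc b:]"
  let ?p = "[:7, b + length ss + 6:] + (pcompose u ?s + (smult 7 (pcompose v ?s) + 1))"
  have "\<exists>t \<le> poly ?p (length x). TM_outputs_after (machine 5 \<Gamma> ?c) x t (map out (f (map idx x)))"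
    if "x \<in> lists \<Sigma>" for x
  proof -
    have x: "set x \<subseteq> \<Sigma>"
      using that by auto
    let ?y = "f (map idx x)"
    let ?n = "poly ?s (length x)"
    have n: "sz (map idx x) \<le> ?n"
      using sz_in[OF x] by (simp add: algebra_simps)
    have mid: "runs c (conf (\<lambda>_. Blank, 0) (code (enc (map idx x)))) (T (map idx x))
        (conf (\<lambda>_. Blank, 0) (code (enc ?y)))"
      using computesD[OF f(4), of "(\<lambda>_. Blank, 0)" "map idx x" "[]"] by simp
    have "word_contents ([] :: 's list) = (\<lambda>_. Blank)"
      by (auto simp: word_contents_def)
    then have out: "runs (write_output out) (conf (\<lambda>_. Blank, 0) (code (enc ?y))) (7 * length ?y + 1)
        (conf (word_contents (map out ?y), int (length ?y)) [Work 0])"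
      using runs_write_output[of out "[]" ?y] by simp
    have "set x \<subseteq> set ss"
      using x ss by simp
    note runs_Seq[OF runs_read_input[OF this b] runs_Seq[OF mid out]]
    then obtain t where t: "t \<le> (length x * (b + length ss + 6) + 7) + (T (map idx x) + (7 * length ?y + 1))"
      and ex: "exec ?c (conf (word_contents x, 0) []) t (conf (word_contents (map out ?y), int (length ?y)) [Work 0])"
      unfolding runs_def by blast
    have "T (map idx x) \<le> poly u ?n"
      using u[of "map idx x"] poly_mono_nat[OF n, of u] by linarith
    moreover have "length ?y \<le> poly v ?n"
      using length_le_sz[of ?y] v[of "map idx x"] poly_mono_nat[OF n, of v] by linarith
    ultimately have "t \<le> poly ?p (length x)"
      using t by (simp add: poly_pcompose algebra_simps)
    moreover have "conf (word_contents x, 0) [] = (word_contents x, 0) # replicate (5 - 1) (\<lambda>_. Blank, 0)"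
      by (auto simp: conf_def cfg_def stacks_def stk_def upt_rec numeral_eq_Suc fun_eq_iff)
    note machine_outputs[OF ex[unfolded this], of "map out ?y" \<Gamma>]
    then have "TM_outputs_after (machine 5 \<Gamma> ?c) x t (map out ?y)"
      by (simp add: conf_def cfg_def)
    ultimately show ?thesis by blast
  qed
  with wf show ?thesis by blast
qed

end

section \<open>Word metrics\<close>

fun inv_letter :: "'a letter \<Rightarrow> 'a letter" where
  "inv_letter (Pos x) = Neg x"
| "inv_letter (Neg x) = Pos x"

lemma inv_letter_in_letters [simp]: "inv_letter l \<in> letters X \<longleftrightarrow> l \<in> letters X"
  by (cases l) (auto simp: letters_def)

context group
begin

lemma letter_val_closed: "X \<subseteq> carrier G \<Longrightarrow> l \<in> letters X \<Longrightarrow> letter_val G l \<in> carrier G"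
  by (auto simp: letters_def)

lemma word_val_closed: "X \<subseteq> carrier G \<Longrightarrow> w \<in> lists (letters X) \<Longrightarrow> word_val G w \<in> carrier G"
  by (induction w) (auto simp: letter_val_closed)

lemma word_val_append:
  "X \<subseteq> carrier G \<Longrightarrow> u \<in> lists (letters X) \<Longrightarrow> v \<in> lists (letters X) \<Longrightarrow>
   word_val G (u @ v) = word_val G u \<otimes> word_val G v"
  by (induction u) (auto simp: letter_val_closed word_val_closed m_assoc)

lemma letter_val_inv_letter:
  "X \<subseteq> carrier G \<Longrightarrow> l \<in> letters X \<Longrightarrow> letter_val G (inv_letter l) = inv letter_val G l"
  by (auto simp: letters_def)

lemma word_val_inverse:
  assumes "X \<subseteq> carrier G" "w \<in> lists (letters X)"
  shows "word_val G (rev (map inv_letter w)) = inv word_val G w"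
  using assms(2)
proof (induction w)
  case (Cons l w)
  then have "word_val G (rev (map inv_letter w) @ [inv_letter l]) =
      word_val G (rev (map inv_letter w)) \<otimes> word_val G [inv_letter l]"
    using assms(1) by (intro word_val_append) (auto simp: in_lists_conv_set)
  then show ?case
    using Cons assms by (simp add: letter_val_inv_letter inv_mult_group letter_val_closed word_val_closed)
qed simp

lemma generate_word:
  assumes "X \<subseteq> carrier G" "g \<in> generate G X"
  shows "\<exists>w \<in> lists (letters X). word_val G w = g"
  using assms(2)
proof induction
  case one
  show ?case by (intro bexI[of _ "[]"]) auto
next
  case (incl x)
  then show ?case
    using assms(1) by (intro bexI[of _ "[Pos x]"]) (auto simp: letters_def)
next
  case (inv x)
  then show ?case
    using assms(1) by (intro bexI[of _ "[Neg x]"]) (auto simp: letters_def)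
next
  case (eng g h)
  then show ?case
    using word_val_append[OF assms(1)] by (metis append_in_lists_conv)
qed

lemma inv_mult_cancel_left: "a \<in> carrier G \<Longrightarrow> b \<in> carrier G \<Longrightarrow> inv a \<otimes> (a \<otimes> b) = b"
  by (metis inv_closed l_inv l_one m_assoc)

fun list_prod :: "'a list \<Rightarrow> 'a" where
  "list_prod [] = \<one>"
| "list_prod (g # gs) = g \<otimes> list_prod gs"

lemma list_prod_closed [simp]: "set gs \<subseteq> carrier G \<Longrightarrow> list_prod gs \<in> carrier G"
  by (induction gs) auto

lemma list_prod_append:
  "set gs \<subseteq> carrier G \<Longrightarrow> set hs \<subseteq> carrier G \<Longrightarrow> list_prod (gs @ hs) = list_prod gs \<otimes> list_prod hs"
  by (induction gs) (auto simp: m_assoc)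

end

locale word_metric = group +
  fixes Y
  assumes fg: "finite_generating_set G Y"
begin

definition wlen :: "'a \<Rightarrow> nat" where
  "wlen g = word_length G Y g"

abbreviation d :: "'a \<Rightarrow> 'a \<Rightarrow> real" where
  "d \<equiv> word_dist G Y"

lemma Y_carrier: "Y \<subseteq> carrier G"
  using fg by (simp add: finite_generating_set_def)

lemma wlen_word:
  assumes "g \<in> carrier G"
  shows "\<exists>w \<in> lists (letters Y). length w = wlen g \<and> word_val G w = g"
proof -
  have "\<exists>n. \<exists>w \<in> lists (letters Y). length w = n \<and> word_val G w = g"
    using generate_word[of Y g] assms fg by (auto simp: finite_generating_set_def)
  then show ?thesis
    unfolding wlen_def word_length_def by (rule LeastI_ex)
qed

lemma wlen_le: "w \<in> lists (letters Y) \<Longrightarrow> wlen (word_val G w) \<le> length w"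
  unfolding wlen_def word_length_def by (rule Least_le) blast

lemma wlen_one [simp]: "wlen \<one> = 0"
  using wlen_le[of "[]"] by simp

lemma wlen_mult:
  assumes "g \<in> carrier G" "h \<in> carrier G"
  shows "wlen (g \<otimes> h) \<le> wlen g + wlen h"
proof -
  obtain u v where "u \<in> lists (letters Y)" "length u = wlen g" "word_val G u = g"
    "v \<in> lists (letters Y)" "length v = wlen h" "word_val G v = h"
    using assms wlen_word by meson
  then show ?thesis
    using wlen_le[of "u @ v"] word_val_append[OF Y_carrier, of u v] by simp
qed

lemma wlen_inv_le:
  assumes "g \<in> carrier G"
  shows "wlen (inv g) \<le> wlen g"
proof -
  obtain u where "u \<in> lists (letters Y)" "length u = wlen g" "word_val G u = g"
    using assms wlen_word by meson
  then show ?thesis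
    using wlen_le[of "rev (map inv_letter u)"] word_val_inverse[OF Y_carrier, of u]
    by (auto simp: in_lists_conv_set)
qed

lemma wlen_inv: "g \<in> carrier G \<Longrightarrow> wlen (inv g) = wlen g"
  using wlen_inv_le[of g] wlen_inv_le[of "inv g"] by simp

lemma d_eq: "d g h = real (wlen (inv g \<otimes> h))"
  by (simp add: word_dist_def wlen_def)

lemma d_one: "g \<in> carrier G \<Longrightarrow> d \<one> g = real (wlen g)"
  by (simp add: d_eq)

lemma d_commute:
  assumes "g \<in> carrier G" "h \<in> carrier G"
  shows "d g h = d h g"
  using assms wlen_inv[of "inv g \<otimes> h"] by (simp add: d_eq inv_mult_group)

lemma d_triangle:
  assumes "x \<in> carrier G" "y \<in> carrier G" "z \<in> carrier G"
  shows "d x z \<le> d x y + d y z"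
proof -
  have "(inv x \<otimes> y) \<otimes> (inv y \<otimes> z) = inv x \<otimes> (y \<otimes> (inv y \<otimes> z))"
    using assms by (simp add: m_assoc)
  also have "y \<otimes> (inv y \<otimes> z) = z"
    using assms inv_mult_cancel_left[of "inv y" z] by simp
  finally have "(inv x \<otimes> y) \<otimes> (inv y \<otimes> z) = inv x \<otimes> z" .
  then show ?thesis
    using wlen_mult[of "inv x \<otimes> y" "inv y \<otimes> z"] assms by (simp add: d_eq flip: of_nat_add)
qed

text \<open>A prefix of a shortest word: neither part can be shorter than its share, since otherwise
  the whole word would not be shortest.\<close>

lemma geodesic_point:
  assumes "g \<in> carrier G" "k \<le> wlen g"
  obtains q where "q \<in> carrier G" "d \<one> q = k" "d q g = real (wlen g) - k"
proof -
  obtain w where w: "w \<in> lists (letters Y)" "length w = wlen g" "word_val G w = g"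
    using assms wlen_word by meson
  let ?u = "take k w" and ?v = "drop k w"
  have uv: "?u \<in> lists (letters Y)" "?v \<in> lists (letters Y)"
    using w(1) by (auto simp: in_lists_conv_set dest: in_set_takeD in_set_dropD)
  let ?q = "word_val G ?u"
  have closed: "?q \<in> carrier G" "word_val G ?v \<in> carrier G"
    using uv word_val_closed[OF Y_carrier] by auto
  have g: "g = ?q \<otimes> word_val G ?v"
    using word_val_append[OF Y_carrier uv] unfolding append_take_drop_id w(3) .
  have v: "inv ?q \<otimes> g = word_val G ?v"
    unfolding g by (rule inv_mult_cancel_left[OF closed])
  have "wlen ?q \<le> k" "wlen (word_val G ?v) \<le> wlen g - k"
    using wlen_le[OF uv(1)] wlen_le[OF uv(2)] w assms by auto
  moreover have "wlen g \<le> wlen ?q + wlen (word_val G ?v)"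
    using wlen_mult[OF closed] g by simp
  ultimately have "wlen ?q = k" "wlen (word_val G ?v) = wlen g - k"
    using assms(2) by linarith+
  then show ?thesis
    using that[of ?q] closed assms(2) v by (simp add: d_one) (simp add: d_eq)
qed

section \<open>Paths in the Cayley graph\<close>

text \<open>The \<open>i\<close>-th vertex of the path that starts at the identity and follows the
  factors.\<close>

definition partial_prod :: "'a list \<Rightarrow> nat \<Rightarrow> 'a" where
  "partial_prod gs i = list_prod (take i gs)"

lemma partial_prod_closed [simp]: "set gs \<subseteq> carrier G \<Longrightarrow> partial_prod gs i \<in> carrier G"
  unfolding partial_prod_def by (rule list_prod_closed) (meson order_trans set_take_subset)

lemma partial_prod_0 [simp]: "partial_prod gs 0 = \<one>"
  by (simp add: partial_prod_def)

lemma partial_prod_add: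
  assumes "set gs \<subseteq> carrier G"
  shows "inv partial_prod gs i \<otimes> partial_prod gs (i + k) = list_prod (take k (drop i gs))"
proof -
  have sub: "set (take i gs) \<subseteq> carrier G" "set (take k (drop i gs)) \<subseteq> carrier G"
    using assms by (meson order_trans set_take_subset set_drop_subset)+
  have "partial_prod gs (i + k) = partial_prod gs i \<otimes> list_prod (take k (drop i gs))"
    using list_prod_append[OF sub] by (simp add: partial_prod_def take_add)
  then show ?thesis
    using assms sub by (simp add: inv_mult_cancel_left)
qed

lemma list_prod_drop:
  assumes "set gs \<subseteq> carrier G"
  shows "list_prod (drop i gs) = inv partial_prod gs i \<otimes> list_prod gs"
proof -
  have sub: "set (take i gs) \<subseteq> carrier G" "set (drop i gs) \<subseteq> carrier G"
    using assms by (meson order_trans set_take_subset set_drop_subset)+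
  have "list_prod gs = partial_prod gs i \<otimes> list_prod (drop i gs)"
    using list_prod_append[OF sub] by (simp add: partial_prod_def)
  then show ?thesis
    using assms sub by (simp add: inv_mult_cancel_left)
qed

lemma d_partial_prod:
  "set gs \<subseteq> carrier G \<Longrightarrow> d (partial_prod gs i) (partial_prod gs (i + k)) = wlen (list_prod (take k (drop i gs)))"
  by (simp add: d_eq partial_prod_add)

lemma wlen_list_prod_le:
  "set gs \<subseteq> carrier G \<Longrightarrow> (\<And>g. g \<in> set gs \<Longrightarrow> wlen g \<le> 1) \<Longrightarrow> wlen (list_prod gs) \<le> length gs"
proof (induction gs)
  case (Cons g gs)
  then have "wlen (g \<otimes> list_prod gs) \<le> wlen g + wlen (list_prod gs)" "wlen g \<le> 1"
    "wlen (list_prod gs) \<le> length gs"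
    by (auto intro!: wlen_mult)
  then show ?case by simp
qed simp

end

section \<open>Hyperbolic word metrics\<close>

locale hyperbolic_metric = word_metric +
  fixes \<delta> :: real
  assumes hyp: "gromov_hyperbolic (carrier G) (word_dist G Y) \<delta>"
begin

abbreviation gp :: "'a \<Rightarrow> 'a \<Rightarrow> 'a \<Rightarrow> real" where
  "gp \<equiv> gromov_product (word_dist G Y)"

lemma four_point:
  "b \<in> carrier G \<Longrightarrow> x \<in> carrier G \<Longrightarrow> y \<in> carrier G \<Longrightarrow> z \<in> carrier G \<Longrightarrow>
   min (gp b x y) (gp b y z) - \<delta> \<le> gp b x z"
  using hyp unfolding gromov_hyperbolic_def by blast

lemma delta_nonneg: "0 \<le> \<delta>"
  using four_point[of \<one> \<one> \<one> \<one>] by simp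

text \<open>Halving the chain applies the four-point inequality once per level, so the loss is
  \<delta> times the logarithm of the number of steps. This is the source of the logarithmic
  diagonals.\<close>

lemma gromov_product_chain:
  assumes "b \<in> carrier G" "\<And>i. p i \<in> carrier G"
    and "\<And>i. i < m \<Longrightarrow> r \<le> gp b (p i) (p (Suc i))" "1 \<le> m" "m \<le> 2 ^ s"
  shows "r - s * \<delta> \<le> gp b (p 0) (p m)"
  using assms(2-)
proof (induction s arbitrary: p m)
  case 0
  then have "m = 1" by simp
  with 0(2)[of 0] show ?case by simp
next
  case (Suc s)
  show ?case
  proof (cases "m = 1")
    case True
    moreover have "0 \<le> real (Suc s) * \<delta>"
      using delta_nonneg by simp
    ultimately show ?thesis
      using Suc.prems(2)[of 0] by simp
  next
    case False
    define h where "h = m div 2"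
    have h: "1 \<le> h" "h \<le> 2 ^ s" "1 \<le> m - h" "m - h \<le> 2 ^ s" "h \<le> m"
      using False Suc.prems(3,4) unfolding h_def by auto
    have "r - s * \<delta> \<le> gp b (p 0) (p h)"
      using h Suc.prems by (intro Suc.IH) auto
    moreover have "r - s * \<delta> \<le> gp b (p (h + 0)) (p (h + (m - h)))"
      using h Suc.prems by (intro Suc.IH[of "\<lambda>i. p (h + i)"]) auto
    moreover have "min (gp b (p 0) (p h)) (gp b (p h) (p m)) - \<delta> \<le> gp b (p 0) (p m)"
      by (intro four_point assms(1) Suc.prems(1))
    ultimately show ?thesis
      using h(5) by (simp add: algebra_simps)
  qed
qed

text \<open>A closed polygon with \<open>2 ^ s\<close> sides can be triangulated by diagonals whose length is linear
  in \<open>s\<close>: a point of the path close to the midpoint of a geodesic side splits the polygon.\<close>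

lemma split_product:
  assumes gs: "set gs \<subseteq> carrier G" "\<And>g. g \<in> set gs \<Longrightarrow> wlen g \<le> D"
    and len: "2 \<le> length gs" "length gs \<le> 2 ^ s"
    and K: "wlen (list_prod gs) \<le> K" "2 * s * \<delta> + 3 * D + 3 \<le> real K"
  obtains us vs where "gs = us @ vs" "us \<noteq> []" "vs \<noteq> []"
    "wlen (list_prod us) \<le> K" "wlen (list_prod vs) \<le> K"
proof -
  let ?p = "partial_prod gs"
  let ?m = "length gs" and ?N = "wlen (list_prod gs)"
  have p [simp]: "?p i \<in> carrier G" for i
    using gs(1) by simp
  have pm: "?p ?m = list_prod gs"
    by (simp add: partial_prod_def)
  have step: "d (?p i) (?p (Suc i)) \<le> D" if "i < ?m" for i
    using d_partial_prod[OF gs(1), of i 1] gs(2)[of "gs ! i"] gs(1) nth_mem[OF that] that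
    by (simp add: Cons_nth_drop_Suc[OF that, symmetric] subset_iff)
  have "0 \<le> 2 * s * \<delta>"
    using delta_nonneg by simp
  show ?thesis
  \<comment> \<open>If the closing side leaves room for one more factor, cutting off the first
    factor is enough. The geometry is needed only for a closing side of almost maximal
    length.\<close>
  proof (cases "?N + D \<le> K")
    case True
    obtain g hs where ghs: "gs = g # hs" "hs \<noteq> []"
      using len(1) by (metis Suc_le_length_iff length_greater_0_conv numeral_2_eq_2 zero_less_Suc less_le_trans Suc_le_eq)
    have closed: "g \<in> carrier G" "list_prod hs \<in> carrier G"
      using gs(1) ghs by auto
    have "list_prod hs = inv g \<otimes> list_prod gs"
      using closed ghs by (simp add: inv_mult_cancel_left)
    then have "wlen (list_prod hs) \<le> wlen g + ?N"
      using wlen_mult[of "inv g" "list_prod gs"] wlen_inv[of g] closed gs(1) by simp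
    then have "wlen (list_prod hs) \<le> K" "wlen (list_prod [g]) \<le> K"
      using gs(2)[of g] True ghs closed by auto
    then show ?thesis
      using that[of "[g]" hs] ghs by simp
  next
    case False
    define k where "k = ?N div 2"
    obtain q where q: "q \<in> carrier G" "d \<one> q = k" "d q (list_prod gs) = real ?N - k"
      using geodesic_point[of "list_prod gs" k] gs(1) unfolding k_def by auto
    \<comment> \<open>The point \<open>q\<close> lies on a geodesic between the two ends of the
      path. If all consecutive Gromov products at \<open>q\<close> were at least
      \<open>s * \<delta> + 1\<close>, the chain estimate would give a product of at least 1
      here.\<close>
    have "gp q (?p 0) (?p ?m) = 0"
      using q gs(1) d_one[of "list_prod gs"] d_commute[of q "list_prod gs"]
      by (simp add: gromov_product_def pm)
    have "\<exists>i < ?m. gp q (?p i) (?p (Suc i)) < s * \<delta> + 1"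
    proof (rule ccontr)
      assume "\<not> ?thesis"
      then have "\<And>i. i < ?m \<Longrightarrow> s * \<delta> + 1 \<le> gp q (?p i) (?p (Suc i))"
        by (meson not_less)
      then have "(s * \<delta> + 1) - s * \<delta> \<le> gp q (?p 0) (?p ?m)"
        using len q by (intro gromov_product_chain) (auto simp: not_less dest: leD)
      then show False
        using \<open>gp q (?p 0) (?p ?m) = 0\<close> by simp
    qed
    then obtain i where i: "i < ?m" "gp q (?p i) (?p (Suc i)) < s * \<delta> + 1"
      by blast
    have "d (?p i) q \<le> d (?p i) (?p (Suc i)) + d (?p (Suc i)) q"
      using q by (intro d_triangle) auto
    \<comment> \<open>The Gromov product of two points that are at most \<open>D\<close> apart
      differs from the distance to either of them by at most \<open>D\<close>.\<close>
    then have near: "d (?p i) q < s * \<delta> + 1 + D"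
      using i step[OF i(1)] by (simp add: gromov_product_def)
    have "d \<one> (?p i) \<le> d \<one> q + d q (?p i)"
      using q by (intro d_triangle) auto
    then have 1: "real (wlen (?p i)) \<le> k + d (?p i) q"
      using q d_commute[of q "?p i"] by (simp add: d_one)
    have "d (?p i) (list_prod gs) \<le> d (?p i) q + d q (list_prod gs)"
      using q gs by (intro d_triangle) auto
    then have 2: "real (wlen (list_prod (drop i gs))) \<le> d (?p i) q + (real ?N - k)"
      using q by (simp add: d_eq list_prod_drop[OF gs(1)])
    have "2 * k \<le> ?N" "?N \<le> 2 * k + 1"
      unfolding k_def by linarith+
    then have "2 * real k \<le> ?N" "real ?N \<le> 2 * real k + 1"
      by linarith+
    then have k: "real k \<le> ?N / 2" "(real ?N - 1) / 2 \<le> k"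
      by simp_all
    have N: "real ?N \<le> K" "real K < real ?N + D"
      using K(1) False by auto
    \<comment> \<open>A split at the start would be no split. It would give
      \<open>k < s * \<delta> + 1 + D\<close>, whereas \<open>k\<close> is at least (N - 1) / 2,
      which exceeds (K - D - 1) / 2. This comparison is where the constant \<open>3 * D + 3\<close>
      comes from.\<close>
    have "i \<noteq> 0"
    proof
      assume "i = 0"
      then have "real k < s * \<delta> + 1 + D"
        using near q by simp
      then show False
        using k N K(2) by argo
    qed
    moreover have "real (wlen (?p i)) \<le> K" "real (wlen (list_prod (drop i gs))) \<le> K"
      using 1 2 near k N K(2) by argo+
    ultimately show ?thesis
      using i by (intro that[of "take i gs" "drop i gs"]) (auto simp: partial_prod_def)
  qed
qed

text \<open>At the point of the closed path that is farthest from the origin, a long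
  geodesic subword would contradict the four-point condition.\<close>

lemma short_nongeodesic_subword:
  assumes gs: "set gs \<subseteq> carrier G" "\<And>g. g \<in> set gs \<Longrightarrow> wlen g \<le> 1"
    and "gs \<noteq> []" "list_prod gs = \<one>" and h: "2 * \<delta> < real h" "1 \<le> h"
  obtains i k where "i + k \<le> length gs" "k \<le> 2 * h" "wlen (list_prod (take k (drop i gs))) < k"
proof (rule ccontr)
  assume "\<not> thesis"
  let ?p = "partial_prod gs" and ?n = "length gs"
  have p [simp]: "?p i \<in> carrier G" for i
    using gs(1) by simp
  \<comment> \<open>Under the contrary assumption the path is a local geodesic: all its stretches of
    length at most \<open>2 * h\<close> are geodesic.\<close>
  have geo: "d (?p i) (?p j) = real j - real i" if "i \<le> j" "j \<le> ?n" "j \<le> i + 2 * h" for i j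
  proof -
    obtain k where k: "j = i + k"
      using le_Suc_ex[OF \<open>i \<le> j\<close>] by blast
    let ?w = "take k (drop i gs)"
    have sub: "set ?w \<subseteq> set gs"
      by (meson order_trans set_take_subset set_drop_subset)
    then have "wlen (list_prod ?w) \<le> length ?w"
      using gs by (intro wlen_list_prod_le) auto
    moreover have "\<not> wlen (list_prod ?w) < k"
      using \<open>\<not> thesis\<close> \<open>i \<le> j\<close> that k \<open>\<And>i k. \<lbrakk>i + k \<le> length gs; k \<le> 2 * h; wlen (list_prod (take k (drop i gs))) < k\<rbrakk> \<Longrightarrow> thesis\<close> by auto
    ultimately have "wlen (list_prod ?w) = k"
      using that k by simp
    then show ?thesis
      using d_partial_prod[OF gs(1), of i k] k by simp
  qed
  have p0: "?p 0 = \<one>" and pn: "?p ?n = \<one>"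
    using assms(4) by (simp_all add: partial_prod_def)
  define f where "f i = d \<one> (?p i)" for i
  have f_lower: "f i = i" if "i \<le> ?n" "i \<le> 2 * h" for i
    using geo[of 0 i] that by (simp add: f_def p0)
  have f_upper: "f i = real ?n - i" if "i \<le> ?n" "?n \<le> i + 2 * h" for i
    using geo[of i ?n] that d_commute[of \<one> "?p i"] by (simp add: f_def pn)
  have "finite (f ` {..?n})" "f ` {..?n} \<noteq> {}"
    by auto
  then have "Max (f ` {..?n}) \<in> f ` {..?n}"
    by (rule Max_in)
  then obtain i where "Max (f ` {..?n}) = f i" "i \<in> {..?n}"
    by (rule imageE)
  then have i: "i \<le> ?n" "\<And>j. j \<le> ?n \<Longrightarrow> f j \<le> f i"
    using Max_ge[of "f ` {..?n}"] by auto
  have n: "1 \<le> ?n"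
    using assms(3) by (simp add: Suc_le_eq)
  have "f 1 = 1"
    using f_lower[of 1] n h by simp
  then have pos: "1 \<le> f i"
    using i(2)[OF n] by simp
  have "f 0 = 0" "f ?n = 0"
    using f_lower[of 0] f_upper[of ?n] by auto
  then have "i \<noteq> 0" "i \<noteq> ?n"
    using pos by (metis not_one_le_zero)+
  \<comment> \<open>Within distance \<open>2 * h\<close> along the path from either end, the
    distance \<open>f\<close> from the origin has slope one, so the maximum cannot lie within
    \<open>h\<close> of an end.\<close>
  consider "i \<le> h" | "?n - i \<le> h" | "h < i" "h < ?n - i"
    by linarith
  then show False
  proof cases
    case 1
    then show False
      using f_lower[of i] f_lower[of "Suc i"] i(2)[of "Suc i"] i(1) \<open>i \<noteq> ?n\<close> h by simp
  next
    case 2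
    then have "?n \<le> i + 2 * h" "?n \<le> (i - 1) + 2 * h" "i - 1 \<le> ?n"
      using i(1) h by linarith+
    then show False
      using f_upper[of i] f_upper[of "i - 1"] i(2)[of "i - 1"] i(1) \<open>i \<noteq> 0\<close> by (simp add: of_nat_diff)
  next
    case 3
    \<comment> \<open>The geodesic from \<open>?a\<close> to \<open>?b\<close> has the farthest
      point \<open>i\<close> as its midpoint. The four-point inequality for these three points
      yields \<open>h\<close> plus a nonnegative difference of values of \<open>f\<close> on the
      left of \<le> and twice \<delta> on the right, against the choice of \<open>h\<close>.\<close>
    let ?a = "i - h" and ?b = "i + h"
    have "d (?p ?a) (?p i) = h" "d (?p i) (?p ?b) = h" "d (?p ?a) (?p ?b) = 2 * real h"
      using geo[of ?a i] geo[of i ?b] geo[of ?a ?b] 3 i(1) by (simp_all add: of_nat_diff)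
    moreover have "min (gp \<one> (?p ?a) (?p i)) (gp \<one> (?p i) (?p ?b)) - \<delta> \<le> gp \<one> (?p ?a) (?p ?b)"
      by (intro four_point) auto
    moreover have "d (?p j) \<one> = f j" for j
      unfolding f_def by (intro d_commute) auto
    moreover have "f ?a \<le> f i" "f ?b \<le> f i"
      using i 3 by auto
    ultimately show False
      using h by (auto simp: gromov_product_def min_def field_simps split: if_splits)
  qed
qed

end

section \<open>The algorithm\<close>

text \<open>A vertex \<open>(t, l)\<close> stands for the \<open>t\<close>-th position in the input; the flag \<open>l\<close> tells whether
  the word around this position has been selected. An edge consists of its source, its target, a
  word for the group element and the bits of the solution that it determines.\<close>

type_synonym vertex = "nat \<times> bool"
type_synonym edge = "vertex \<times> vertex \<times> nat list \<times> bool list"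
type_synonym item = "bool \<times> nat list"

abbreviation src :: "edge \<Rightarrow> vertex" where "src \<equiv> fst"
abbreviation tgt :: "edge \<Rightarrow> vertex" where "tgt e \<equiv> fst (snd e)"
abbreviation word :: "edge \<Rightarrow> nat list" where "word e \<equiv> fst (snd (snd e))"
abbreviation bits :: "edge \<Rightarrow> bool list" where "bits e \<equiv> snd (snd (snd e))"

text \<open>The exponents are chosen at the separators. A letter keeps the flag and contributes its
  word only if selected; a separator closes a word, records the flag as its bit and leaves the flag
  of the next word free.\<close>

definition step_edges :: "nat \<Rightarrow> item \<Rightarrow> edge list" where
  "step_edges t it = concat (map (\<lambda>l. concat (map (\<lambda>l'.
     if fst it \<or> l = l'
     then [((t, l), (Suc t, l'), if \<not> fst it \<and> l then snd it else [], if fst it then [l] else [])]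
     else []) [True, False])) [True, False])"

abbreviation edges_step :: "nat \<times> edge list \<Rightarrow> item \<Rightarrow> nat \<times> edge list" where
  "edges_step \<equiv> (\<lambda>s it. (Suc (fst s), snd s @ step_edges (fst s) it))"

definition edges :: "item list \<Rightarrow> nat \<times> edge list" where
  "edges its = foldl edges_step (0, []) its"

abbreviation split_step :: "item list \<times> item list \<Rightarrow> item \<Rightarrow> item list \<times> item list" where
  "split_step \<equiv> (\<lambda>s it. if fst it then (fst s @ snd s @ [it], []) else (fst s, snd s @ [it]))"

text \<open>The second component collects the letters since the last separator; what it holds at the
  end is the right-hand side of the instance.\<close>

definition split_items :: "item list \<Rightarrow> item list \<times> item list" where
  "split_items its = foldl split_step ([], []) its"

text \<open>A comparison of lengths as a fold, with \<open>P\<close> as a unary counter, so that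
  polynomial time follows from \<open>ptime_foldl\<close>.\<close>

definition covers :: "unit list \<Rightarrow> edge list \<Rightarrow> bool" where
  "covers P E \<longleftrightarrow> foldl (\<lambda>s u. tl s) E P = []"

definition vertices :: "edge list \<Rightarrow> vertex list" where
  "vertices E = map fst E @ map (\<lambda>e. fst (snd e)) E"

definition keys :: "edge list \<Rightarrow> nat list list \<Rightarrow> (vertex \<times> vertex \<times> nat list) list" where
  "keys E W = concat (map (\<lambda>i. concat (map (\<lambda>j. map (\<lambda>w. (i, j, w)) W) (vertices E))) (vertices E))"

definition compositions :: "edge list \<Rightarrow> edge list" where
  "compositions T = concat (map (\<lambda>p. concat (map (\<lambda>q.
     if tgt p = src q then [(src p, tgt q, word p @ word q, bits p @ bits q)] else []) T)) T)"

lemma covers_iff: "covers P E \<longleftrightarrow> length E \<le> length P"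
proof -
  have "foldl (\<lambda>s u. tl s) E P = drop (length P) E"
    by (induction P arbitrary: E) (auto simp: drop_Suc)
  then show ?thesis
    by (simp add: covers_def)
qed

lemma edges_snoc:
  "edges (its @ [it]) = (Suc (fst (edges its)), snd (edges its) @ step_edges (fst (edges its)) it)"
  by (simp add: edges_def)

lemma step_edges_bits: "e \<in> set (step_edges t it) \<Longrightarrow> fst (src e) + length (bits e) \<le> fst (tgt e)"
  by (auto simp: step_edges_def split: if_splits)

text \<open>An edge carries at most as many bits as the positions it spans. The inequality survives
  the composition of edges and so bounds the partial solutions that the table remembers.\<close>

lemma edges_bits: "e \<in> set (snd (edges its)) \<Longrightarrow> fst (src e) + length (bits e) \<le> fst (tgt e)"
proof (induction its rule: rev_induct)
  case Nil
  then show ?case by (simp add: edges_def)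
next
  case (snoc it its)
  then show ?case
    using step_edges_bits[of e "fst (edges its)" it] by (auto simp: edges_snoc)
qed

lemma compositions_mem:
  "e \<in> set (compositions T) \<longleftrightarrow> (\<exists>p \<in> set T. \<exists>q \<in> set T. tgt p = src q \<and>
     e = (src p, tgt q, word p @ word q, bits p @ bits q))"
  by (auto simp: compositions_def)

text \<open>Contains what the running time depends on; the group enters in
  \<open>ssp_solver_correct\<close>. The letters of the words are numbers below \<open>B\<close>,
  \<open>tab\<close> shortens words of length at most \<open>L\<close>, \<open>iv\<close> inverts a
  letter and \<open>item\<close> decodes an input symbol.\<close>

locale ssp_solver = tape_alphabet \<Sigma> for \<Sigma> :: "'s set" +
  fixes tab :: "nat list \<Rightarrow> nat list" and iv :: "nat \<Rightarrow> nat" and item :: "nat \<Rightarrow> item"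
    and L B c1 c2 :: nat
  assumes ptime_tab: "ptime tab" and ptime_iv: "ptime iv" and ptime_item: "ptime item"
    and length_tab: "length (tab u) \<le> length u" and set_tab: "set (tab u) \<subseteq> set u \<union> {..<B}"
begin

abbreviation pass_step :: "nat list \<Rightarrow> nat \<Rightarrow> nat list" where
  "pass_step \<equiv> (\<lambda>r a. tab (take L (a # r)) @ drop L (a # r))"

text \<open>The word is rebuilt from its right end, with one look-up after each added letter. If no
  look-up shortens anything, every window of length \<open>L\<close> has been examined.\<close>

definition pass :: "nat list \<Rightarrow> nat list" where
  "pass w = foldl pass_step [] (rev w)"

text \<open>Dehn's algorithm: every pass shortens the word unless all its short subwords are geodesic.\<close>

definition trivial :: "nat list \<Rightarrow> bool" where
  "trivial w \<longleftrightarrow> foldl (\<lambda>s u. pass s) w w = []"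

definition inverse_word :: "nat list \<Rightarrow> nat list" where
  "inverse_word w = rev (map iv w)"

definition extend :: "nat list list \<Rightarrow> nat list list" where
  "extend W = [] # concat (map (\<lambda>a. map (\<lambda>w. a # w) W) [0..<B])"

text \<open>The list of units doubles until it is as long as \<open>E\<close>; hence the length of the words is
  logarithmic in the length of \<open>E\<close>, and their number is polynomial.\<close>

definition grow :: "edge list \<Rightarrow> unit list \<times> nat list list" where
  "grow E = foldl (\<lambda>s e. if covers (fst s) E then s else (fst s @ fst s, (extend ^^ c1) (snd s)))
     ([()], [[]]) E"

definition short_words :: "edge list \<Rightarrow> nat list list" where
  "short_words E = (extend ^^ c2) (snd (grow E))"

text \<open>One witness per key, by \<open>take 1\<close>, keeps the table no longer than the list
  of keys. Candidates are compared as group elements, since the word of a composition is in general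
  longer than the diagonals. A round starts again from the edges and the compositions of old
  entries.\<close>

definition refine :: "edge list \<Rightarrow> (vertex \<times> vertex \<times> nat list) list \<Rightarrow> edge list \<Rightarrow> edge list" where
  "refine E K T = concat (map (\<lambda>k. take 1 (concat (map (\<lambda>c.
     if fst k = src c \<and> fst (snd k) = tgt c \<and> trivial (word c @ inverse_word (snd (snd k)))
     then [(fst k, fst (snd k), snd (snd k), bits c)] else []) (E @ compositions T)))) K)"

text \<open>The list \<open>E\<close> also serves as the counter. One round per edge suffices: after
  \<open>r\<close> rounds paths of at most \<open>r\<close> edges are treated, because a split makes
  both parts strictly shorter.\<close>

definition table :: "edge list \<Rightarrow> edge list" where
  "table E = foldl (\<lambda>T e. refine E (keys E (short_words E)) T) [] E"

text \<open>The additional separator in front makes every solution start with the bit \<open>True\<close>, as the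
  encoding of an answer does.\<close>

definition prepare :: "nat list \<Rightarrow> item list" where
  "prepare x = (True, []) # fst (split_items (map item x)) @
     rev (map (\<lambda>it. (False, inverse_word (snd it))) (snd (split_items (map item x))))"

text \<open>No separator follows the inverse of the right-hand side, so the flag \<open>True\<close>
  at the last vertex forces it to be selected. The empty word asks for a product equal to the
  identity, and \<open>[False]\<close> is the encoding of the answer \<open>None\<close>.\<close>

definition solve :: "nat list \<Rightarrow> bool list" where
  "solve x = (case concat (map (\<lambda>e. if src e = (0, True) \<and> tgt e = (fst (edges (prepare x)), True) \<and> word e = []
        then [bits e] else []) (table (snd (edges (prepare x))))) of [] \<Rightarrow> [False] | b # bs \<Rightarrow> b)"

subsection \<open>Running time\<close>

lemma pass_invariant:
  "length (foldl pass_step [] v) \<le> length v \<and>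
   set (foldl pass_step [] v) \<subseteq> set v \<union> {..<B}"
proof (induction v rule: rev_induct)
  case (snoc a v)
  let ?r = "foldl pass_step [] v"
  have "length (tab (take L (a # ?r)) @ drop L (a # ?r)) \<le> length (take L (a # ?r) @ drop L (a # ?r))"
    using length_tab[of "take L (a # ?r)"] unfolding length_append by (rule add_right_mono)
  also have "\<dots> = Suc (length ?r)"
    unfolding append_take_drop_id by simp
  finally have "length (tab (take L (a # ?r)) @ drop L (a # ?r)) \<le> Suc (length v)"
    using snoc.IH by simp
  moreover have "set (tab (take L (a # ?r)) @ drop L (a # ?r)) \<subseteq> set (take L (a # ?r) @ drop L (a # ?r)) \<union> {..<B}"
    using set_tab[of "take L (a # ?r)"] unfolding set_append by blast
  then have "set (tab (take L (a # ?r)) @ drop L (a # ?r)) \<subseteq> insert a (set v) \<union> {..<B}"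
    using snoc.IH unfolding append_take_drop_id by auto
  ultimately show ?case by simp
qed simp

lemma length_pass_le: "length (pass w) \<le> length w"
  and set_pass: "set (pass w) \<subseteq> set w \<union> {..<B}"
  using pass_invariant[of "rev w"] by (simp_all add: pass_def)

lemma sz_word_le:
  assumes "length r \<le> length w" "set r \<subseteq> set w \<union> {..<B}"
  shows "sz r \<le> Suc (length w * Suc (sz w + 2 * B + 1))"
proof (rule sz_list_le)
  fix a assume "a \<in> set r"
  then consider "a \<in> set w" | "a < B"
    using assms(2) by auto
  then show "sz a \<le> sz w + 2 * B + 1"
    using sz_nth_le[of a w] by cases (auto simp del: sz_simps(5), simp)
qed (rule assms(1))

lemma poly_bounded_word:
  "ptime f \<Longrightarrow> poly_bounded (\<lambda>x. Suc (length (f x) * Suc (sz (f x) + 2 * B + 1)))"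
  by (intro poly_bounded_intros ptime_size)

lemma ptime_pass: "ptime f \<Longrightarrow> ptime (\<lambda>x. pass (f x))"
  unfolding pass_def
proof (rule ptime_foldl[where step = "\<lambda>r a x. tab (take L (a # r)) @ drop L (a # r)"])
  show "ptime (\<lambda>p. tab (take L (fst (snd p) # fst p)) @ drop L (fst (snd p) # fst p))"
    by (intro ptime_intros ptime_comp[OF ptime_tab])
  assume f: "ptime f"
  show "poly_bounded (\<lambda>x. Suc (length (f x) * Suc (sz (f x) + 2 * B + 1)))"
    by (rule poly_bounded_word[OF f])
  show "sz (foldl pass_step [] (take i (rev (f x)))) \<le>
      Suc (length (f x) * Suc (sz (f x) + 2 * B + 1))" for x i
    using pass_invariant[of "take i (rev (f x))"] set_take_subset[of i "rev (f x)"]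
    by (intro sz_word_le) auto
qed (intro ptime_intros | assumption)+

lemma trivial_invariant:
  "length (foldl (\<lambda>s u. pass s) w v) \<le> length w \<and> set (foldl (\<lambda>s u. pass s) w v) \<subseteq> set w \<union> {..<B}"
proof (induction v rule: rev_induct)
  case (snoc a v)
  then show ?case
    using length_pass_le[of "foldl (\<lambda>s u. pass s) w v"] set_pass[of "foldl (\<lambda>s u. pass s) w v"] by auto
qed simp

lemma ptime_trivial: "ptime f \<Longrightarrow> ptime (\<lambda>x. trivial (f x))"
  unfolding trivial_def
proof (rule ptime_eq[OF ptime_foldl[where step = "\<lambda>s u x. pass s"]])
  show "ptime (\<lambda>p. pass (fst p))"
    by (intro ptime_pass ptime_intros)
  assume f: "ptime f"
  show "poly_bounded (\<lambda>x. Suc (length (f x) * Suc (sz (f x) + 2 * B + 1)))"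
    by (rule poly_bounded_word[OF f])
  show "sz (foldl (\<lambda>s u. pass s) (f x) (take i (f x))) \<le> Suc (length (f x) * Suc (sz (f x) + 2 * B + 1))" for x i
    using trivial_invariant[of "f x" "take i (f x)"] by (intro sz_word_le) auto
qed (intro ptime_intros | assumption)+

lemma ptime_inverse_word: "ptime f \<Longrightarrow> ptime (\<lambda>x. inverse_word (f x))"
  unfolding inverse_word_def by (intro ptime_intros ptime_comp[OF ptime_iv])

lemma ptime_extend: "ptime extend"
  unfolding extend_def[abs_def] by (intro ptime_intros)

lemma ptime_covers: "ptime f \<Longrightarrow> ptime g \<Longrightarrow> ptime (\<lambda>x. covers (f x) (g x))"
  unfolding covers_def
proof (rule ptime_eq[OF ptime_foldl[where step = "\<lambda>s u x. tl s"]])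
  show "ptime (\<lambda>p :: edge list \<times> unit \<times> 'a. tl (fst p))"
    by (intro ptime_intros)
  assume "ptime g"
  then show "poly_bounded (\<lambda>x. sz (g x))"
    by (rule ptime_size)
  have tl: "sz (tl xs) \<le> sz xs" for xs :: "edge list"
    by (cases xs) auto
  have "sz (foldl (\<lambda>s u. tl s) xs us) \<le> sz xs" for xs :: "edge list" and us :: "unit list"
    by (induction us arbitrary: xs) (auto intro: order_trans tl)
  then show "sz (foldl (\<lambda>s u. tl s) (g x) (take i (f x))) \<le> sz (g x)" for x i .
qed (intro ptime_intros | assumption)+

section \<open>Number and size of the short words\<close>

lemma extend_mem: "w \<in> set (extend W) \<longleftrightarrow> w = [] \<or> (\<exists>a < B. \<exists>v \<in> set W. w = a # v)"
  by (auto simp: extend_def)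

lemma extend_words:
  "length ((extend ^^ m) [[]]) \<le> (B + 1) ^ m \<and> (extend ^^ m) [[]] \<noteq> [] \<and>
   (\<forall>w \<in> set ((extend ^^ m) [[]]). length w \<le> m \<and> set w \<subseteq> {..<B})"
proof (induction m)
  case (Suc m)
  let ?W = "(extend ^^ m) [[]]"
  have "length (extend ?W) = Suc (B * length ?W)"
    by (simp add: extend_def length_concat comp_def sum_list_triv)
  also have "\<dots> \<le> (B + 1) * length ?W"
    using Suc.IH by (simp add: Suc_le_eq)
  also have "\<dots> \<le> (B + 1) * (B + 1) ^ m"
    using Suc.IH by (intro mult_le_mono2) simp
  finally have "length (extend ?W) \<le> (B + 1) ^ Suc m"
    by simp
  moreover have "\<forall>w \<in> set (extend ?W). length w \<le> Suc m \<and> set w \<subseteq> {..<B}"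
  proof
    fix w assume "w \<in> set (extend ?W)"
    then consider "w = []" | a v where "a < B" "v \<in> set ?W" "w = a # v"
      unfolding extend_mem by blast
    then show "length w \<le> Suc m \<and> set w \<subseteq> {..<B}"
      using Suc.IH by cases auto
  qed
  moreover have "extend ?W \<noteq> []"
    by (simp add: extend_def)
  ultimately show ?case by simp
qed simp

lemma sz_extend_words:
  "sz ((extend ^^ m) [[]]) \<le> Suc ((B + 1) ^ m * Suc (Suc (m * Suc (2 * B + 1))))"
proof (rule sz_list_le)
  fix w assume w: "w \<in> set ((extend ^^ m) [[]])"
  show "sz w \<le> Suc (m * Suc (2 * B + 1))"
    using extend_words[of m] w by (intro sz_list_le) fastforce+
qed (use extend_words[of m] in simp)

abbreviation grow_step :: "edge list \<Rightarrow> unit list \<times> nat list list \<Rightarrow> unit list \<times> nat list list" where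
  "grow_step E s \<equiv> (if covers (fst s) E then s else (fst s @ fst s, (extend ^^ c1) (snd s)))"

text \<open>Doubling takes place only while \<open>2 ^ j\<close> is below the length of
  \<open>E\<close>, hence the upper bound. Until then every element of the list causes a doubling,
  so after \<open>length E\<close> elements the length is surely reached.\<close>

lemma grow_invariant:
  "\<exists>j. length (fst (foldl (\<lambda>s e. grow_step E s) ([()], [[]]) F)) = 2 ^ j \<and>
     snd (foldl (\<lambda>s e. grow_step E s) ([()], [[]]) F) = (extend ^^ (c1 * j)) [[]] \<and>
     2 ^ j \<le> 2 * length E + 1 \<and> (length E \<le> 2 ^ j \<or> j = length F)"
proof (induction F rule: rev_induct)
  case Nil
  then show ?case by (intro exI[of _ 0]) simp
next
  case (snoc f F)
  let ?s = "foldl (\<lambda>s e. grow_step E s) ([()], [[]]) F"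
  obtain j where j: "length (fst ?s) = 2 ^ j" "snd ?s = (extend ^^ (c1 * j)) [[]]"
    "2 ^ j \<le> 2 * length E + 1" "length E \<le> 2 ^ j \<or> j = length F"
    using snoc by blast
  show ?case
  proof (cases "length E \<le> 2 ^ j")
    case True
    then show ?thesis
      using j by (intro exI[of _ j]) (simp add: covers_iff)
  next
    case False
    then show ?thesis
      using j by (intro exI[of _ "Suc j"]) (simp add: covers_iff funpow_add)
  qed
qed

lemma short_words_eq:
  obtains j where "length E \<le> 2 ^ j" "2 ^ j \<le> 2 * length E + 1"
    "short_words E = (extend ^^ (c1 * j + c2)) [[]]"
proof -
  obtain j where j: "snd (grow E) = (extend ^^ (c1 * j)) [[]]"
     "2 ^ j \<le> 2 * length E + 1" "length E \<le> 2 ^ j \<or> j = length E"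
    using grow_invariant[of E E] unfolding grow_def by blast
  moreover have "length E \<le> 2 ^ j"
    using j(3) less_exp[of j] by linarith
  ultimately show ?thesis
    using that[of j] by (simp add: short_words_def funpow_add add.commute)
qed

text \<open>The exponent \<open>(B + 1) ^ c1\<close> is a crude substitute for \<open>c1\<close>
  times the binary logarithm of \<open>B + 1\<close>, using that \<open>m\<close> is below
  \<open>2 ^ m\<close>. It is a constant of the group, so the bound is polynomial in
  \<open>n\<close>.\<close>

definition words_bound :: "nat \<Rightarrow> nat" where
  "words_bound n = Suc (n ^ ((B + 1) ^ c1) * Suc (Suc (c1 * n * Suc (2 * B + 1))))"

lemma sz_extend_bound:
  assumes "2 ^ j \<le> n"
  shows "sz ((extend ^^ (c1 * j)) [[]]) \<le> words_bound n"
proof -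
  have "(B + 1) ^ (c1 * j) \<le> (2 ^ ((B + 1) ^ c1)) ^ j"
    unfolding power_mult by (intro power_mono less_imp_le less_exp) simp
  also have "\<dots> = (2 ^ j) ^ ((B + 1) ^ c1)"
    by (simp add: mult.commute flip: power_mult)
  also have "\<dots> \<le> n ^ ((B + 1) ^ c1)"
    using assms by (intro power_mono) auto
  finally have 1: "(B + 1) ^ (c1 * j) \<le> n ^ ((B + 1) ^ c1)" .
  have "j \<le> n"
    using assms less_exp[of j] by linarith
  then have "Suc (Suc (c1 * j * Suc (2 * B + 1))) \<le> Suc (Suc (c1 * n * Suc (2 * B + 1)))"
    by (intro Suc_leI le_imp_less_Suc Suc_le_mono[THEN iffD2] mult_le_mono1 mult_le_mono2)
  with 1 show ?thesis
    unfolding words_bound_def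
    by (intro order_trans[OF sz_extend_words] Suc_le_mono[THEN iffD2, OF mult_le_mono])
qed

lemma ptime_short_words:
  assumes "ptime f"
  shows "ptime (\<lambda>x. short_words (f x))"
proof -
  let ?B = "\<lambda>x. Suc (Suc ((2 * length (f x) + 1) * 2) + words_bound (2 * length (f x) + 1))"
  have ext: "ptime (extend ^^ n)" for n
    using ptime_funpow[OF ptime_extend ptime_id] by simp
  have "ptime (\<lambda>x. foldl (\<lambda>s e. grow_step (f x) s) ([()], [[]]) (f x))"
  proof (rule ptime_foldl[where step = "\<lambda>s e x. grow_step (f x) s"])
    show "ptime (\<lambda>p. grow_step (f (snd (snd p))) (fst p))"
      by (intro ptime_intros ptime_covers ptime_comp[OF assms] ptime_comp[OF ext])
    show "poly_bounded ?B"
      unfolding words_bound_def by (intro poly_bounded_intros ptime_size assms)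
    show "sz (foldl (\<lambda>s e. grow_step (f x) s) ([()], [[]]) (take i (f x))) \<le> ?B x" for x i
    proof -
      let ?s = "foldl (\<lambda>s e. grow_step (f x) s) ([()], [[]]) (take i (f x))"
      obtain j where j: "length (fst ?s) = 2 ^ j" "snd ?s = (extend ^^ (c1 * j)) [[]]"
        "2 ^ j \<le> 2 * length (f x) + 1"
        using grow_invariant[of "f x" "take i (f x)"] by blast
      have "sz (fst ?s) \<le> Suc ((2 * length (f x) + 1) * 2)"
        using j sz_list_le[of "fst ?s" 1 "2 * length (f x) + 1"] by simp
      moreover have "sz (snd ?s) \<le> words_bound (2 * length (f x) + 1)"
        using j by (simp add: sz_extend_bound del: One_nat_def)
      moreover have "sz s \<le> Suc (Suc a + b)" if "sz (fst s) \<le> Suc a" "sz (snd s) \<le> b"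
        for s :: "unit list \<times> nat list list" and a b
        using that by (cases s) simp
      ultimately show ?thesis
        by (simp only: Suc_1)
    qed
  qed (intro ptime_intros assms)+
  then have "ptime (\<lambda>x. (extend ^^ c2) (snd (foldl (\<lambda>s e. grow_step (f x) s) ([()], [[]]) (f x))))"
    by (intro ptime_comp[OF ext] ptime_intros)
  then show ?thesis
    by (simp add: short_words_def grow_def)
qed

lemma ptime_vertices: "ptime f \<Longrightarrow> ptime (\<lambda>x. vertices (f x))"
  unfolding vertices_def by (intro ptime_intros)

lemma ptime_keys:
  assumes "ptime f" "ptime g"
  shows "ptime (\<lambda>x. keys (f x) (g x))"
  unfolding keys_def
  by (intro ptime_intros ptime_vertices ptime_comp[OF assms(1)] ptime_comp[OF assms(2)])

lemma ptime_compositions: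
  assumes "ptime f"
  shows "ptime (\<lambda>x. compositions (f x))"
  unfolding compositions_def by (intro ptime_intros ptime_comp[OF assms])

lemma ptime_refine:
  assumes "ptime f" "ptime g" "ptime h"
  shows "ptime (\<lambda>x. refine (f x) (g x) (h x))"
  unfolding refine_def
  by (intro ptime_intros ptime_trivial ptime_inverse_word ptime_compositions
      ptime_comp[OF assms(1)] ptime_comp[OF assms(2)] ptime_comp[OF assms(3)])

lemma ptime_step_edges:
  assumes "ptime f" "ptime g"
  shows "ptime (\<lambda>x. step_edges (f x) (g x))"
  unfolding step_edges_def
  by (intro ptime_intros ptime_comp[OF assms(1)] ptime_comp[OF assms(2)])

lemma ptime_split_items: "ptime f \<Longrightarrow> ptime (\<lambda>x. split_items (f x))"
  unfolding split_items_def
proof (rule ptime_foldl[where step = "\<lambda>s it x. if fst it then (fst s @ snd s @ [it], []) else (fst s, snd s @ [it])"])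
  show "ptime (\<lambda>p :: (item list \<times> item list) \<times> item \<times> 'a. if fst (fst (snd p)) then (fst (fst p) @ snd (fst p) @ [fst (snd p)], [])
      else (fst (fst p), snd (fst p) @ [fst (snd p)]))"
    by (intro ptime_intros)
  assume f: "ptime f"
  then show "poly_bounded (\<lambda>x. Suc (Suc (sz (f x))))"
    by (intro poly_bounded_intros ptime_size)
  show "sz (foldl split_step ([], []) (take i (f x)))
      \<le> Suc (Suc (sz (f x)))" for x i
  proof -
    let ?F = "\<lambda>its. foldl split_step ([], []) its"
    have "fst (?F its) @ snd (?F its) = its" for its :: "item list"
      by (induction its rule: rev_induct) auto
    from this[of "take i (f x)"]
    have "sz (fst (?F (take i (f x))) @ snd (?F (take i (f x)))) \<le> sz (f x)"
      by (rule ssubst) (rule sz_take_le)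
    moreover have "sz s \<le> Suc (Suc n)" if "sz (fst s @ snd s) \<le> n" for s :: "item list \<times> item list" and n
      using that by (cases s) simp
    ultimately show ?thesis
      by blast
  qed
qed (intro ptime_intros | assumption)+

lemma ptime_edges:
  assumes "ptime f"
  shows "ptime (\<lambda>x. edges (f x))"
proof -
  have "ptime (\<lambda>p. step_edges (fst p) (snd p))"
    by (intro ptime_step_edges ptime_intros)
  from ptime_size[OF this] obtain q where "\<And>p. sz (step_edges (fst p) (snd p)) \<le> poly q (sz p)"
    unfolding poly_bounded_def by blast
  from this[of "(t, it)" for t it] have q: "sz (step_edges t it) \<le> poly q (sz (t, it))" for t it
    unfolding fst_conv snd_conv .
  let ?b = "\<lambda>x. poly q (Suc (Suc (2 * length (f x)) + sz (f x)))"
  let ?F = "\<lambda>its. foldl edges_step (0, []) its"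
  have bound: "fst (?F its) = length its \<and> sz (snd (?F its)) \<le> Suc (length its * b)"
    if "\<And>t it. t \<le> n \<Longrightarrow> it \<in> set its \<Longrightarrow> sz (step_edges t it) \<le> b" "length its \<le> n" for its n b
    using that
  proof (induction its rule: rev_induct)
    case (snoc it its)
    then have IH: "fst (?F its) = length its" "sz (snd (?F its)) \<le> Suc (length its * b)"
      by auto
    have "sz (step_edges (length its) it) \<le> b"
      using snoc.prems by simp
    then show ?case
      using IH by simp
  qed simp
  have "ptime (\<lambda>x. foldl edges_step (0, []) (f x))"
  proof (rule ptime_foldl[where step = "\<lambda>s it x. (Suc (fst s), snd s @ step_edges (fst s) it)"])
    show "ptime (\<lambda>p :: (nat \<times> edge list) \<times> item \<times> 'a. (Suc (fst (fst p)), snd (fst p) @ step_edges (fst (fst p)) (fst (snd p))))"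
      by (intro ptime_intros ptime_step_edges)
    show "poly_bounded (\<lambda>x. Suc (Suc (2 * length (f x)) + Suc (length (f x) * ?b x)))"
      by (intro poly_bounded_intros poly_bounded_poly ptime_size assms)
    show "sz (?F (take i (f x))) \<le> Suc (Suc (2 * length (f x)) + Suc (length (f x) * ?b x))" for x i
    proof -
      have "sz (step_edges t it) \<le> ?b x" if "t \<le> length (f x)" "it \<in> set (take i (f x))" for t it
      proof -
        have "it \<in> set (f x)"
          using that(2) by (rule in_set_takeD)
        then have "sz it \<le> sz (f x)"
          by (rule sz_nth_le)
        then show ?thesis
          using that(1) by (intro order_trans[OF q] poly_mono_nat) simp
      qed
      from bound[of "length (f x)" "take i (f x)", OF this] have F: "fst (?F (take i (f x))) = length (take i (f x))"
        "sz (snd (?F (take i (f x)))) \<le> Suc (length (take i (f x)) * ?b x)"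
        by auto
      have "length (take i (f x)) * ?b x \<le> length (f x) * ?b x"
        by (rule mult_le_mono1) simp
      then have "sz (snd (?F (take i (f x)))) \<le> Suc (length (f x) * ?b x)"
        using F(2) by linarith
      moreover have "sz s \<le> Suc (Suc (2 * l) + b)" if "fst s \<le> l" "sz (snd s) \<le> b"
        for s :: "nat \<times> edge list" and l b
        using that by (cases s) simp
      moreover have "fst (?F (take i (f x))) \<le> length (f x)"
        using F(1) by simp
      ultimately show ?thesis
        by blast
    qed
  qed (intro ptime_intros assms)+
  then show ?thesis
    by (simp add: edges_def)
qed

lemma ptime_prepare: "ptime (\<lambda>x. prepare x)"
  unfolding prepare_def
  by (intro ptime_intros ptime_split_items ptime_inverse_word ptime_comp[OF ptime_item])

lemma refine_mem:
  assumes "e \<in> set (refine E K T)"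
  obtains c where "c \<in> set E \<union> set (compositions T)" "(src e, tgt e, word e) \<in> set K"
    "src e = src c" "tgt e = tgt c" "bits e = bits c" "trivial (word c @ inverse_word (word e))"
proof -
  obtain k where k: "k \<in> set K" "e \<in> set (concat (map (\<lambda>c.
     if fst k = src c \<and> fst (snd k) = tgt c \<and> trivial (word c @ inverse_word (snd (snd k)))
     then [(fst k, fst (snd k), snd (snd k), bits c)] else []) (E @ compositions T)))"
    using assms unfolding refine_def by (auto dest!: in_set_takeD)
  then obtain c where c: "c \<in> set (E @ compositions T)"
    "e \<in> set (if fst k = src c \<and> fst (snd k) = tgt c \<and> trivial (word c @ inverse_word (snd (snd k)))
      then [(fst k, fst (snd k), snd (snd k), bits c)] else [])"
    unfolding set_concat set_map by blast
  then have e: "fst k = src c" "fst (snd k) = tgt c" "trivial (word c @ inverse_word (snd (snd k)))"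
    "e = (fst k, fst (snd k), snd (snd k), bits c)"
    by (simp_all split: if_splits)
  then have "k = (src e, tgt e, word e)"
    by (cases k) simp
  then show ?thesis
    using that[of c] c(1) e k(1) by simp
qed

lemma length_refine: "length (refine E K T) \<le> length K"
proof -
  have "length (concat (map (\<lambda>k. take 1 (g k)) K)) \<le> length K" for g :: "vertex \<times> vertex \<times> nat list \<Rightarrow> edge list"
    by (induction K) auto
  then show ?thesis
    unfolding refine_def .
qed

text \<open>Together with \<open>length_refine\<close> this bounds every intermediate table: at most
  as many entries as keys, each with a known key and a bounded list of bits.\<close>

lemma table_bits:
  assumes "\<And>e. e \<in> set E \<Longrightarrow> fst (src e) + length (bits e) \<le> fst (tgt e)"
    and "e \<in> set (foldl (\<lambda>T e. refine E K T) [] F)"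
  shows "(src e, tgt e, word e) \<in> set K \<and> fst (src e) + length (bits e) \<le> fst (tgt e)"
  using assms(2)
proof (induction F arbitrary: e rule: rev_induct)
  case (snoc f F)
  let ?T = "foldl (\<lambda>T e. refine E K T) [] F"
  have "e \<in> set (refine E K ?T)"
    using snoc.prems by simp
  then obtain c where c: "c \<in> set E \<union> set (compositions ?T)" "(src e, tgt e, word e) \<in> set K"
    "src e = src c" "tgt e = tgt c" "bits e = bits c"
    by (rule refine_mem)
  have "fst (src c) + length (bits c) \<le> fst (tgt c)"
    using c(1)
  proof
    assume "c \<in> set (compositions ?T)"
    then obtain p q where "p \<in> set ?T" "q \<in> set ?T" "tgt p = src q"
      "c = (src p, tgt q, word p @ word q, bits p @ bits q)"
      unfolding compositions_mem by blast
    then show ?thesis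
      using snoc.IH[of p] snoc.IH[of q] by simp
  qed (rule assms(1))
  with c show ?case by simp
qed simp

lemma ptime_table_edges:
  assumes "ptime f"
  shows "ptime (\<lambda>x. table (snd (edges (f x))))"
proof -
  let ?E = "\<lambda>x. snd (edges (f x))"
  let ?K = "\<lambda>x. keys (?E x) (short_words (?E x))"
  have E: "ptime ?E"
    by (intro ptime_intros ptime_edges assms)
  have K: "ptime ?K"
    by (intro ptime_keys ptime_short_words E)
  have "ptime (\<lambda>x. foldl (\<lambda>T e. refine (?E x) (?K x) T) [] (?E x))"
  proof (rule ptime_foldl[where step = "\<lambda>T e x. refine (?E x) (?K x) T"])
    show "ptime (\<lambda>p. refine (?E (snd (snd p))) (?K (snd (snd p))) (fst p))"
      by (intro ptime_refine ptime_comp[OF E] ptime_comp[OF K] ptime_intros)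
    show "poly_bounded (\<lambda>x. Suc (length (?K x) * Suc (Suc (sz (?K x) + Suc (sz (?K x) * 4)))))"
      by (intro poly_bounded_intros ptime_size K)
    show "sz (foldl (\<lambda>T e. refine (?E x) (?K x) T) [] (take i (?E x))) \<le>
        Suc (length (?K x) * Suc (Suc (sz (?K x) + Suc (sz (?K x) * 4))))" for x i
    proof (rule sz_list_le)
      fix e assume "e \<in> set (foldl (\<lambda>T e. refine (?E x) (?K x) T) [] (take i (?E x)))"
      then have e: "(src e, tgt e, word e) \<in> set (?K x)" "fst (src e) + length (bits e) \<le> fst (tgt e)"
        using table_bits[of "?E x" e "?K x" "take i (?E x)"] edges_bits by blast+
      have key: "sz (src e, tgt e, word e) \<le> sz (?K x)"
        by (rule sz_nth_le[OF e(1)])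
      \<comment> \<open>Positions are unary, so the size of the target already dominates the number
        of bits. The factor 4 in the bound is a bit of size at most 3 together with its list
        cell.\<close>
      have "fst (tgt e) \<le> sz (tgt e)"
        by (cases "tgt e") simp
      then have "length (bits e) \<le> sz (?K x)"
        using e(2) key by simp
      then have "sz (bits e) \<le> Suc (sz (?K x) * Suc 3)"
        by (intro sz_list_le sz_bool)
      moreover have "sz e = Suc (sz (src e) + Suc (sz (tgt e) + Suc (sz (word e) + sz (bits e))))"
        by (cases e) simp
      ultimately show "sz e \<le> Suc (sz (?K x) + Suc (sz (?K x) * 4))"
        using key by simp
    next
      show "length (foldl (\<lambda>T e. refine (?E x) (?K x) T) [] (take i (?E x))) \<le> length (?K x)"
        by (cases "take i (?E x)" rule: rev_cases) (auto simp: length_refine)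
    qed
  qed (intro ptime_intros E)+
  then show ?thesis
    by (simp add: table_def)
qed

theorem ptime_solve: "ptime solve"
proof -
  have edges: "ptime (\<lambda>x. edges (prepare x))"
    by (intro ptime_edges ptime_prepare)
  have table: "ptime (\<lambda>x. table (snd (edges (prepare x))))"
    by (intro ptime_table_edges ptime_prepare)
  have "ptime (\<lambda>x. case concat (map (\<lambda>e. if src e = (0, True) \<and> tgt e = (fst (edges (prepare x)), True) \<and> word e = []
        then [bits e] else []) (table (snd (edges (prepare x))))) of [] \<Rightarrow> [False] | b # bs \<Rightarrow> b)"
    by (rule ptime_case_list[where g = "\<lambda>b bs x. b"])
      (intro ptime_intros ptime_comp[OF edges] ptime_comp[OF table])+
  then show ?thesis
    by (simp add: solve_def[abs_def])
qed

end

section \<open>Correctness\<close>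

subsection \<open>Paths in the graph of an instance\<close>

fun chain :: "edge list \<Rightarrow> vertex \<Rightarrow> edge list \<Rightarrow> vertex \<Rightarrow> bool" where
  "chain E i [] k \<longleftrightarrow> i = k"
| "chain E i (e # es) k \<longleftrightarrow> e \<in> set E \<and> src e = i \<and> chain E (tgt e) es k"

abbreviation chain_word :: "edge list \<Rightarrow> nat list" where
  "chain_word es \<equiv> concat (map word es)"

abbreviation chain_bits :: "edge list \<Rightarrow> bool list" where
  "chain_bits es \<equiv> concat (map bits es)"

lemma chain_append: "chain E i (es @ fs) k \<longleftrightarrow> (\<exists>j. chain E i es j \<and> chain E j fs k)"
  by (induction es arbitrary: i) auto

lemma chain_edges: "chain E i es k \<Longrightarrow> set es \<subseteq> set E"
proof (induction es arbitrary: i)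
  case (Cons e es)
  then show ?case
    using Cons.IH[of "tgt e"] by simp
qed simp

lemma chain_vertices: "chain E i es k \<Longrightarrow> es \<noteq> [] \<Longrightarrow> i \<in> set (vertices E) \<and> k \<in> set (vertices E)"
proof (induction es arbitrary: i)
  case (Cons e es)
  then show ?case
    by (cases es) (auto simp: vertices_def)
qed simp

lemma step_edges_mem: "e \<in> set (step_edges t it) \<longleftrightarrow> (\<exists>l l'. (fst it \<or> l = l') \<and>
   e = ((t, l), (Suc t, l'), if \<not> fst it \<and> l then snd it else [], if fst it then [l] else []))"
  unfolding step_edges_def by (simp, blast)

lemma fst_edges: "fst (edges its) = length its"
proof (induction its rule: rev_induct)
  case Nil
  then show ?case by (simp add: edges_def)
qed (simp add: edges_snoc)

lemma edges_mem: "e \<in> set (snd (edges its)) \<longleftrightarrow> (\<exists>t < length its. e \<in> set (step_edges t (its ! t)))"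
proof (induction its rule: rev_induct)
  case Nil
  then show ?case by (simp add: edges_def)
next
  case (snoc it its)
  then show ?case
    by (auto simp: edges_snoc fst_edges nth_append less_Suc_eq)
qed

lemma length_edges_ge: "length its \<le> length (snd (edges its))"
proof (induction its rule: rev_induct)
  case (snoc it its)
  have "step_edges (length its) it \<noteq> []"
    unfolding step_edges_def by simp
  then have "1 \<le> length (step_edges (length its) it)"
    by (simp add: Suc_le_eq)
  with snoc show ?case
    by (simp add: edges_snoc fst_edges)
qed simp

lemma chain_length: "chain (snd (edges its)) i es k \<Longrightarrow> fst k = fst i + length es"
  by (induction es arbitrary: i) (auto simp: edges_mem step_edges_mem)

text \<open>The bits and words along the paths to the final vertex; the flag tells whether the word at the
  beginning of the list is selected.\<close>

fun selections :: "bool \<Rightarrow> item list \<Rightarrow> (bool list \<times> nat list) set" where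
  "selections l [] = (if l then {([], [])} else {})"
| "selections l (it # its) =
     (if fst it then {(l # b, w) | l' b w. (b, w) \<in> selections l' its}
      else {(b, (if l then snd it else []) @ w) | b w. (b, w) \<in> selections l its})"

text \<open>Paths are unrolled at their first edge, which is determined by the item at
  \<open>t\<close>, the flag \<open>l\<close> and the next flag. The induction is on the number of
  remaining positions.\<close>

lemma chain_selections:
  assumes "t \<le> length its"
  shows "(\<exists>es. chain (snd (edges its)) (t, l) es (length its, True) \<and> chain_bits es = b \<and> chain_word es = w)
     \<longleftrightarrow> (b, w) \<in> selections l (drop t its)"
  using assms
proof (induction "length its - t" arbitrary: t l b w)
  case 0
  then have t: "t = length its" by simp
  have "chain (snd (edges its)) (t, l) es (length its, True) \<longleftrightarrow> es = [] \<and> l" for es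
    using chain_length[of its "(t, l)" es "(length its, True)"] t by (cases es) auto
  then have "(\<exists>es. chain (snd (edges its)) (t, l) es (length its, True) \<and> chain_bits es = b \<and> chain_word es = w)
     \<longleftrightarrow> l \<and> b = [] \<and> w = []"
    by auto
  then show ?case
    using t by auto
next
  case (Suc n)
  then have t: "t < length its" by simp
  let ?E = "snd (edges its)" and ?it = "its ! t" and ?n = "(length its, True)"
  have drop: "drop t its = ?it # drop (Suc t) its"
    using t by (simp add: Cons_nth_drop_Suc)
  have IH: "(\<exists>es. chain ?E (Suc t, l') es ?n \<and> chain_bits es = b' \<and> chain_word es = w')
     \<longleftrightarrow> (b', w') \<in> selections l' (drop (Suc t) its)" for l' b' w'
    using Suc by auto
  have first: "e \<in> set ?E \<and> src e = (t, l) \<longleftrightarrow> (\<exists>l'. (fst ?it \<or> l = l') \<and>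
      e = ((t, l), (Suc t, l'), if \<not> fst ?it \<and> l then snd ?it else [], if fst ?it then [l] else []))" for e
    using t unfolding edges_mem step_edges_mem by fastforce
  have "(\<exists>es. chain ?E (t, l) es ?n \<and> chain_bits es = b \<and> chain_word es = w) \<longleftrightarrow>
     (\<exists>e es. (e \<in> set ?E \<and> src e = (t, l)) \<and> chain ?E (tgt e) es ?n \<and> bits e @ chain_bits es = b \<and> word e @ chain_word es = w)"
    (is "?L \<longleftrightarrow> ?R")
  proof
    assume ?L
    then obtain es where es: "chain ?E (t, l) es ?n" "chain_bits es = b" "chain_word es = w"
      by blast
    then have "es \<noteq> []"
      using t by auto
    then obtain e fs where "es = e # fs"
      by (cases es) auto
    with es show ?R
      by (intro exI[of _ e] exI[of _ fs]) simp
  next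
    assume ?R
    then obtain e es where "e \<in> set ?E" "src e = (t, l)" "chain ?E (tgt e) es ?n"
      "bits e @ chain_bits es = b" "word e @ chain_word es = w"
      by blast
    then show ?L
      by (intro exI[of _ "e # es"]) auto
  qed
  also have "\<dots> \<longleftrightarrow> (\<exists>l' es. (fst ?it \<or> l = l') \<and> chain ?E (Suc t, l') es ?n \<and>
     (if fst ?it then [l] else []) @ chain_bits es = b \<and> (if \<not> fst ?it \<and> l then snd ?it else []) @ chain_word es = w)"
    unfolding first by auto
  also have "\<dots> \<longleftrightarrow> (\<exists>l' b' w'. (fst ?it \<or> l = l') \<and> (b', w') \<in> selections l' (drop (Suc t) its) \<and>
     (if fst ?it then [l] else []) @ b' = b \<and> (if \<not> fst ?it \<and> l then snd ?it else []) @ w' = w)"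
    unfolding IH[symmetric] by blast
  also have "\<dots> \<longleftrightarrow> (b, w) \<in> selections l (drop t its)"
    unfolding drop by auto
  finally show ?case .
qed

section \<open>Selections in an input that has the shape of an encoded instance\<close>

abbreviation blocks :: "nat list list list \<Rightarrow> item list" where
  "blocks us \<equiv> concat (map (\<lambda>u. map (Pair False) u @ [(True, [])]) us)"

fun select :: "bool list \<Rightarrow> nat list list list \<Rightarrow> nat list" where
  "select (l # b) (u # us) = (if l then concat u else []) @ select b us"
| "select _ _ = []"

lemma selections_letters:
  "selections l (map (Pair False) v) = (if l then {([], concat v)} else {})"
  by (induction v) auto

lemma selections_block:
  "selections l (map (Pair False) u @ (True, s) # its) =
     {(l # b, (if l then concat u else []) @ w) | l' b w. (b, w) \<in> selections l' its}"
  by (induction u) auto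

text \<open>The flag at the start is left open because the separator in front chooses it; it becomes
  the first bit. After the last block only the flag \<open>True\<close> leads to the final vertex,
  so \<open>v\<close> is always selected.\<close>

lemma selections_blocks:
  "(\<exists>l. (b, w) \<in> selections l (blocks us @ map (Pair False) v)) \<longleftrightarrow>
     length b = length us \<and> w = select b us @ concat v"
proof (induction us arbitrary: b w)
  case Nil
  show ?case
    by (auto simp: selections_letters)
next
  case (Cons u us)
  have "(\<exists>l. (b, w) \<in> selections l (blocks (u # us) @ map (Pair False) v)) \<longleftrightarrow>
      (\<exists>l b' w'. b = l # b' \<and> w = (if l then concat u else []) @ w' \<and>
         (\<exists>l'. (b', w') \<in> selections l' (blocks us @ map (Pair False) v)))"
    by (simp add: selections_block) blast
  also have "\<dots> \<longleftrightarrow> length b = length (u # us) \<and> w = select b (u # us) @ concat v"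
    unfolding Cons.IH by (cases b) auto
  finally show ?case .
qed

lemma split_items_blocks: "split_items (blocks us @ map (Pair False) v) = (blocks us, map (Pair False) v)"
proof -
  let ?f = "\<lambda>s it :: item. if fst it then (fst s @ snd s @ [it], []) else (fst s, snd s @ [it])"
  have letters: "foldl ?f (p, q) (map (Pair False) u) = (p, q @ map (Pair False) u)" for p q u
    by (induction u arbitrary: q) auto
  have "foldl ?f (p, []) (blocks us) = (p @ blocks us, [])" for p
  proof (induction us arbitrary: p)
    case (Cons u us)
    then show ?case
      using letters[of p "[]" u] by simp
  qed simp
  then show ?thesis
    unfolding split_items_def foldl_append using letters by simp
qed

subsection \<open>Words and group elements\<close>

text \<open>The constants meet two geometric lemmas: \<open>L\<close> is the length
  \<open>2 * h\<close> of the subwords in \<open>short_nongeodesic_subword\<close>, and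
  \<open>c1 * j + c2\<close> satisfies the requirement on \<open>K\<close> in
  \<open>split_product\<close> for paths of at most \<open>2 ^ j\<close> edges with labels of length
  at most \<open>D\<close>.\<close>

locale ssp_solver_correct = hyperbolic_metric G Y \<delta> + ssp_solver \<Sigma> tab iv item L B c1 c2
  for G :: "('a, 'm) monoid_scheme" (structure) and Y \<delta> and \<Sigma> :: "'s set" and tab iv item L B c1 c2 +
  fixes val :: "nat \<Rightarrow> 'a" and h D :: nat
  assumes val_closed [simp]: "val i \<in> carrier G"
    and wlen_val: "wlen (val i) \<le> 1"
    and val_words: "g \<in> carrier G \<Longrightarrow> \<exists>w. set w \<subseteq> {..<B} \<and> length w = wlen g \<and> list_prod (map val w) = g"
    and val_iv: "val (iv i) = inv (val i)" and iv_less: "i < B \<Longrightarrow> iv i < B"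
    and val_tab: "list_prod (map val (tab u)) = list_prod (map val u)"
    and tab_same: "length (tab u) = length u \<Longrightarrow> tab u = u"
    and tab_shorter: "set u \<subseteq> {..<B} \<Longrightarrow> length u \<le> L \<Longrightarrow> wlen (list_prod (map val u)) < length u \<Longrightarrow>
      length (tab u) < length u"
    and L_eq: "L = 2 * h" and h: "2 * \<delta> < real h" "1 \<le> h"
    and c1: "2 * \<delta> \<le> real c1" and c2: "c2 = 3 * D + 3"
    and item_word: "length (snd (item n)) \<le> D" "set (snd (item n)) \<subseteq> {..<B}"
begin

definition eval_word :: "nat list \<Rightarrow> 'a" where
  "eval_word w = list_prod (map val w)"

lemma eval_word_Nil [simp]: "eval_word [] = \<one>"
  by (simp add: eval_word_def)

lemma set_map_val: "set (map val w) \<subseteq> carrier G"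
  by auto

lemma eval_word_closed [simp]: "eval_word w \<in> carrier G"
  unfolding eval_word_def by (rule list_prod_closed[OF set_map_val])

lemma eval_word_Cons [simp]: "eval_word (a # w) = val a \<otimes> eval_word w"
  by (simp add: eval_word_def)

lemma eval_word_append: "eval_word (u @ v) = eval_word u \<otimes> eval_word v"
  unfolding eval_word_def map_append by (rule list_prod_append[OF set_map_val set_map_val])

lemma eval_inverse_word: "eval_word (inverse_word w) = inv (eval_word w)"
proof (induction w)
  case (Cons a w)
  then show ?case
    by (simp add: inverse_word_def eval_word_append val_iv inv_mult_group)
qed (simp add: inverse_word_def)

lemma inverse_word_less: "set w \<subseteq> {..<B} \<Longrightarrow> set (inverse_word w) \<subseteq> {..<B}"
  using iv_less by (auto simp: inverse_word_def)

lemma length_inverse_word: "length (inverse_word w) = length w"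
  by (simp add: inverse_word_def)

lemma wlen_eval_word: "wlen (eval_word w) \<le> length w"
  using wlen_list_prod_le[OF set_map_val, of w] wlen_val unfolding eval_word_def by auto

lemma eval_inverse_eq_one: "eval_word (u @ inverse_word w) = \<one> \<longleftrightarrow> eval_word u = eval_word w"
proof
  assume "eval_word (u @ inverse_word w) = \<one>"
  then have "eval_word u = inv (inv (eval_word w))"
    unfolding eval_word_append eval_inverse_word by (intro inv_equality[symmetric]) auto
  then show "eval_word u = eval_word w" by simp
next
  assume "eval_word u = eval_word w"
  then show "eval_word (u @ inverse_word w) = \<one>"
    by (simp add: eval_word_append eval_inverse_word)
qed

section \<open>Correctness of Dehn's algorithm\<close>

lemma pass_Nil [simp]: "pass [] = []"
  by (simp add: pass_def)

lemma pass_Cons: "pass (a # w) = tab (take L (a # pass w)) @ drop L (a # pass w)"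
  by (simp add: pass_def)

lemma eval_tab: "eval_word (tab u) = eval_word u"
  unfolding eval_word_def by (rule val_tab)

lemma eval_pass: "eval_word (pass w) = eval_word w"
proof (induction w)
  case (Cons a w)
  have "eval_word (pass (a # w)) = eval_word (take L (a # pass w) @ drop L (a # pass w))"
    unfolding pass_Cons eval_word_append eval_tab ..
  also have "\<dots> = eval_word (a # w)"
    unfolding append_take_drop_id using Cons by simp
  finally show ?case .
qed simp

lemma pass_less: "set w \<subseteq> {..<B} \<Longrightarrow> set (pass w) \<subseteq> {..<B}"
  using set_pass[of w] by blast

text \<open>No look-up can lengthen, so an unchanged total length means that no look-up shortened;
  by \<open>tab_same\<close> each of them was then the identity. Hence the windows examined are
  those of \<open>w\<close> itself, and \<open>tab_shorter\<close> makes them geodesic.\<close>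

lemma pass_same_length:
  assumes "length (pass w) = length w" "set w \<subseteq> {..<B}"
  shows "pass w = w \<and> (\<forall>i. wlen (eval_word (take L (drop i w))) = length (take L (drop i w)))"
  using assms
proof (induction w)
  case (Cons a w)
  let ?v = "a # pass w"
  have "length (tab (take L ?v)) \<le> length (take L ?v)" "length (pass w) \<le> length w"
    by (rule length_tab, rule length_pass_le)
  moreover have "length (tab (take L ?v)) + length (drop L ?v) = Suc (length w)"
    using Cons.prems(1) unfolding pass_Cons length_append by simp
  moreover have "length (take L ?v) + length (drop L ?v) = Suc (length (pass w))"
    unfolding length_append[symmetric] append_take_drop_id by simp
  ultimately have len: "length (tab (take L ?v)) = length (take L ?v)" "length (pass w) = length w"
    by linarith+
  then have IH: "pass w = w" "\<And>i. wlen (eval_word (take L (drop i w))) = length (take L (drop i w))"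
    using Cons by auto
  have same: "tab (take L (a # w)) = take L (a # w)"
    using tab_same[OF len(1)] IH(1) by simp
  have "set (take L (a # w)) \<subseteq> {..<B}"
    using Cons.prems(2) set_take_subset[of L "a # w"] by blast
  then have "\<not> wlen (eval_word (take L (a # w))) < length (take L (a # w))"
    using tab_shorter[of "take L (a # w)"] same unfolding eval_word_def by auto
  then have "wlen (eval_word (take L (a # w))) = length (take L (a # w))"
    using wlen_eval_word[of "take L (a # w)"] by linarith
  then have "wlen (eval_word (take L (drop i (a # w)))) = length (take L (drop i (a # w)))" for i
    using IH(2) by (cases i) auto
  moreover have "pass (a # w) = a # w"
    unfolding pass_Cons IH(1) same append_take_drop_id ..
  ultimately show ?case by blast
qed (simp)

lemma trivial_funpow: "trivial w \<longleftrightarrow> (pass ^^ length w) w = []"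
proof -
  have "foldl (\<lambda>s u. pass s) w v = (pass ^^ length v) w" for v :: "nat list"
    by (induction v arbitrary: w) (auto simp: funpow_swap1)
  then show ?thesis
    by (simp add: trivial_def)
qed

lemma funpow_pass:
  "eval_word ((pass ^^ n) w) = eval_word w"
  "set w \<subseteq> {..<B} \<Longrightarrow> set ((pass ^^ n) w) \<subseteq> {..<B}"
  by (induction n) (simp_all add: eval_pass pass_less)

text \<open>A pass either shortens the word or fixes it, so as many passes as the word has letters
  are enough.\<close>

lemma pass_stable:
  "length w \<le> n \<Longrightarrow> set w \<subseteq> {..<B} \<Longrightarrow> length (pass ((pass ^^ n) w)) = length ((pass ^^ n) w)"
proof (induction n arbitrary: w)
  case (Suc n)
  show ?case
  proof (cases "length (pass w) = length w")
    case True
    then have "pass w = w"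
      using pass_same_length Suc.prems by blast
    moreover from this have "(pass ^^ m) w = w" for m
      by (induction m) auto
    ultimately show ?thesis by simp
  next
    case False
    then have "length (pass w) \<le> n"
      using length_pass_le[of w] Suc.prems(1) by simp
    then show ?thesis
      using Suc.IH[of "pass w"] pass_less[OF Suc.prems(2)] by (simp only: funpow_Suc_right comp_apply)
  qed
qed simp

lemma trivial_imp: "trivial w \<Longrightarrow> eval_word w = \<one>"
  using funpow_pass(1)[of "length w" w] by (simp add: trivial_funpow)

text \<open>If the passes got stuck at a nonempty word for the identity, that word would be a closed
  path, and a closed path has a short subword that is not geodesic, although all windows
  are.\<close>

lemma trivial_iff:
  assumes "set w \<subseteq> {..<B}"
  shows "trivial w \<longleftrightarrow> eval_word w = \<one>"
proof
  assume w: "eval_word w = \<one>"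
  define v where "v = (pass ^^ length w) w"
  have v: "eval_word v = \<one>" "set v \<subseteq> {..<B}" "length (pass v) = length v"
    unfolding v_def using funpow_pass(1)[of "length w" w] funpow_pass(2)[OF assms] pass_stable[OF _ assms] w
    by auto
  have "v = []"
  proof (rule ccontr)
    assume "v \<noteq> []"
    then obtain i k where ik: "i + k \<le> length (map val v)" "k \<le> 2 * h"
      "wlen (list_prod (take k (drop i (map val v)))) < k"
      using short_nongeodesic_subword[OF set_map_val, of v h] wlen_val v(1) h unfolding eval_word_def by auto
    let ?u = "take L (drop i v)"
    have geo: "wlen (eval_word ?u) = length ?u"
      using pass_same_length[OF v(3,2)] by blast
    \<comment> \<open>The short subword is a prefix of the window at the same place; a window is cut
      short only by the end of the word. Prefixes of geodesic words are geodesic, which gives the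
      contradiction.\<close>
    have k: "k \<le> length ?u" "take k ?u = take k (drop i v)"
      using ik(1,2) L_eq by auto
    have "wlen (eval_word ?u) \<le> wlen (eval_word (take k ?u)) + wlen (eval_word (drop k ?u))"
      by (metis append_take_drop_id eval_word_append eval_word_closed wlen_mult)
    moreover have "wlen (eval_word (take k ?u)) < k"
      using ik(3) k(2) by (simp add: eval_word_def take_map drop_map)
    moreover have "wlen (eval_word (drop k ?u)) \<le> length ?u - k"
      using wlen_eval_word[of "drop k ?u"] by simp
    ultimately show False
      using geo k(1) by linarith
  qed
  then show "trivial w"
    by (simp add: trivial_funpow v_def)
qed (rule trivial_imp)

lemma set_extend_funpow: "set ((extend ^^ m) [[]]) = {w. set w \<subseteq> {..<B} \<and> length w \<le> m}"
proof (induction m)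
  case (Suc m)
  have "w \<in> set (extend ((extend ^^ m) [[]])) \<longleftrightarrow> set w \<subseteq> {..<B} \<and> length w \<le> Suc m" for w
    unfolding extend_mem Suc.IH by (cases w) auto
  then show ?case by auto
qed auto

subsection \<open>The table\<close>

text \<open>Every entry stems from an actual path. Its bits are literally those of the path, while
  its word agrees with that of the path only in the group.\<close>

lemma table_sound:
  assumes "e \<in> set (foldl (\<lambda>T e. refine E K T) [] F)"
  shows "\<exists>es. chain E (src e) es (tgt e) \<and> eval_word (chain_word es) = eval_word (word e) \<and> chain_bits es = bits e"
  using assms
proof (induction F arbitrary: e rule: rev_induct)
  case (snoc f F)
  let ?T = "foldl (\<lambda>T e. refine E K T) [] F"
  have "e \<in> set (refine E K ?T)"
    using snoc.prems by simp
  then obtain c where c: "c \<in> set E \<union> set (compositions ?T)"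
    "src e = src c" "tgt e = tgt c" "bits e = bits c" "trivial (word c @ inverse_word (word e))"
    by (rule refine_mem)
  have "\<exists>es. chain E (src c) es (tgt c) \<and> eval_word (chain_word es) = eval_word (word c) \<and> chain_bits es = bits c"
    using c(1)
  proof
    assume "c \<in> set E"
    then show ?thesis
      by (intro exI[of _ "[c]"]) simp
  next
    assume "c \<in> set (compositions ?T)"
    then obtain p q where pq: "p \<in> set ?T" "q \<in> set ?T" "tgt p = src q"
      "c = (src p, tgt q, word p @ word q, bits p @ bits q)"
      unfolding compositions_mem by blast
    obtain es where es: "chain E (src p) es (tgt p)" "eval_word (chain_word es) = eval_word (word p)" "chain_bits es = bits p"
      using snoc.IH[OF pq(1)] by blast
    obtain fs where fs: "chain E (src q) fs (tgt q)" "eval_word (chain_word fs) = eval_word (word q)" "chain_bits fs = bits q"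
      using snoc.IH[OF pq(2)] by blast
    have "chain E (src c) (es @ fs) (tgt c)"
      unfolding chain_append using es(1) fs(1) pq(3,4) by (intro exI[of _ "tgt p"]) simp
    then show ?thesis
      using es fs pq(4) by (intro exI[of _ "es @ fs"]) (simp add: eval_word_append)
  qed
  moreover have "eval_word (word c) = eval_word (word e)"
    using trivial_imp[OF c(5)] by (simp add: eval_inverse_eq_one)
  ultimately show ?case
    using c by simp
qed simp

text \<open>The entry kept for the key may come from another candidate than \<open>c\<close>. This
  does no harm, since by \<open>table_sound\<close> any entry is realised by some path.\<close>

lemma refine_complete:
  assumes "(i, k, w) \<in> set K" "c \<in> set E \<union> set (compositions T)" "src c = i" "tgt c = k"
    "trivial (word c @ inverse_word w)"
  shows "\<exists>e \<in> set (refine E K T). src e = i \<and> tgt e = k \<and> word e = w"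
proof -
  let ?f = "\<lambda>k c. if fst k = src c \<and> fst (snd k) = tgt c \<and> trivial (word c @ inverse_word (snd (snd k)))
     then [(fst k, fst (snd k), snd (snd k), bits c)] else []"
  let ?l = "concat (map (?f (i, k, w)) (E @ compositions T))"
  have "(i, k, w, bits c) \<in> set ?l"
    using assms by (auto intro!: bexI[of _ c])
  then obtain e l where l: "?l = e # l"
    by (cases ?l) auto
  then have "e \<in> set ?l" by simp
  then have "src e = i \<and> tgt e = k \<and> word e = w"
    by (auto split: if_splits)
  moreover have "e \<in> set (take 1 ?l)"
    using l by simp
  then have "e \<in> set (refine E K T)"
    unfolding refine_def set_concat set_map using assms(1) by blast
  ultimately show ?thesis by blast
qed

text \<open>Induction on the rounds. A path of several edges is cut by \<open>split_product\<close>
  at one of its inner vertices; the two diagonals are again short, so both parts have entries from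
  the previous round, and their composition is recognised by \<open>trivial\<close>. The bound by
  \<open>length E\<close> keeps \<open>j\<close> fixed throughout.\<close>

lemma table_complete:
  assumes E: "\<And>e. e \<in> set E \<Longrightarrow> length (word e) \<le> D \<and> set (word e) \<subseteq> {..<B}"
    and j: "length E \<le> 2 ^ j" "set W = {w. set w \<subseteq> {..<B} \<and> length w \<le> c1 * j + c2}"
    and es: "chain E i es k" "es \<noteq> []" "length es \<le> length F" "length es \<le> length E"
    and w: "w \<in> set W" "eval_word w = eval_word (chain_word es)"
  shows "\<exists>e \<in> set (foldl (\<lambda>T e. refine E (keys E W) T) [] F). src e = i \<and> tgt e = k \<and> word e = w"
  using es w
proof (induction F arbitrary: i k es w rule: rev_induct)
  case (snoc f F)
  let ?T = "foldl (\<lambda>T e. refine E (keys E W) T) [] F"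
  let ?K = "c1 * j + c2"
  have key: "(i, k, w) \<in> set (keys E W)"
    using chain_vertices[OF snoc.prems(1,2)] snoc.prems(5) by (auto simp: keys_def)
  have wB: "set w \<subseteq> {..<B}" "length w \<le> ?K"
    using snoc.prems(5) j(2) by auto
  have "\<exists>c \<in> set E \<union> set (compositions ?T). src c = i \<and> tgt c = k \<and> set (word c) \<subseteq> {..<B} \<and>
     eval_word (word c) = eval_word w"
  proof (cases "length es = 1")
    case True
    then obtain e where "es = [e]"
      by (auto simp: length_Suc_conv)
    then show ?thesis
      using snoc.prems E by (intro bexI[of _ e]) auto
  next
    case False
    let ?gs = "map (\<lambda>e. eval_word (word e)) es"
    have sub: "set es \<subseteq> set E"
      by (rule chain_edges[OF snoc.prems(1)])
    have prod: "list_prod (map (\<lambda>e. eval_word (word e)) fs) = eval_word (chain_word fs)" for fs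
      by (induction fs) (auto simp: eval_word_append)
    have "wlen (eval_word (word e)) \<le> D" if "e \<in> set es" for e
      using wlen_eval_word[of "word e"] E[of e] sub that by (meson order_trans subsetD)
    moreover have "2 \<le> length es"
      using False snoc.prems(2) by (cases es) (auto simp: Suc_le_eq)
    moreover have "wlen (eval_word w) \<le> ?K"
      using wlen_eval_word[of w] wB(2) by linarith
    \<comment> \<open>This is the requirement of \<open>split_product\<close> on the length of
      diagonals; \<open>c1\<close> and \<open>c2\<close> were chosen for it.\<close>
    moreover have "2 * real j * \<delta> + 3 * real D + 3 \<le> real ?K"
      using mult_right_mono[OF c1, of "real j"] c2 by (simp add: algebra_simps)
    moreover have "length es \<le> 2 ^ j"
      using snoc.prems(4) j(1) by simp
    moreover have "list_prod ?gs = eval_word w"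
      unfolding prod snoc.prems(6) ..
    ultimately have gs: "\<And>g. g \<in> set ?gs \<Longrightarrow> wlen g \<le> D" "2 \<le> length ?gs" "length ?gs \<le> 2 ^ j"
      "wlen (list_prod ?gs) \<le> ?K" "2 * real j * \<delta> + 3 * real D + 3 \<le> real ?K"
      by (simp_all, auto)
    have "set ?gs \<subseteq> carrier G"
      by auto
    from split_product[OF this gs] obtain us vs where uv: "?gs = us @ vs" "us \<noteq> []" "vs \<noteq> []"
      "wlen (list_prod us) \<le> ?K" "wlen (list_prod vs) \<le> ?K"
      by blast
    define es1 where "es1 = take (length us) es"
    define es2 where "es2 = drop (length us) es"
    have us: "us = map (\<lambda>e. eval_word (word e)) es1" and vs: "vs = map (\<lambda>e. eval_word (word e)) es2"
      using uv(1) unfolding es1_def es2_def take_map[symmetric] drop_map[symmetric] by simp_all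
    have es12: "es = es1 @ es2"
      by (simp add: es1_def es2_def)
    have ne: "es1 \<noteq> []" "es2 \<noteq> []"
      using us vs uv(2,3) by auto
    obtain m where m: "chain E i es1 m" "chain E m es2 k"
      using snoc.prems(1) unfolding es12 chain_append by blast
    \<comment> \<open>Geodesic representatives of the two parts: their lengths are those bounded by
      the split, so they are among the words in \<open>W\<close>.\<close>
    obtain w1 where w1: "set w1 \<subseteq> {..<B}" "length w1 = wlen (eval_word (chain_word es1))"
      "eval_word w1 = eval_word (chain_word es1)"
      using val_words[of "eval_word (chain_word es1)"] unfolding eval_word_def[symmetric] by auto
    obtain w2 where w2: "set w2 \<subseteq> {..<B}" "length w2 = wlen (eval_word (chain_word es2))"
      "eval_word w2 = eval_word (chain_word es2)"
      using val_words[of "eval_word (chain_word es2)"] unfolding eval_word_def[symmetric] by auto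
    have W: "w1 \<in> set W" "w2 \<in> set W"
      using uv(4,5) w1 w2 j(2) unfolding us vs prod by auto
    have len: "length es = length es1 + length es2" "length es1 > 0" "length es2 > 0"
      using es12 ne by auto
    have le: "length es1 \<le> length F" "length es2 \<le> length F" "length es1 \<le> length E" "length es2 \<le> length E"
      using snoc.prems(3,4) len unfolding length_append list.size by linarith+
    obtain p where p: "p \<in> set ?T" "src p = i" "tgt p = m" "word p = w1"
      using snoc.IH[OF m(1) ne(1) le(1,3) W(1) w1(3)] by blast
    obtain q where q: "q \<in> set ?T" "src q = m" "tgt q = k" "word q = w2"
      using snoc.IH[OF m(2) ne(2) le(2,4) W(2) w2(3)] by blast
    have "(i, k, w1 @ w2, bits p @ bits q) \<in> set (compositions ?T)"
      unfolding compositions_mem using p q by (intro bexI[of _ p] bexI[of _ q]) auto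
    moreover have "eval_word (w1 @ w2) = eval_word w"
      using w1(3) w2(3) snoc.prems(6) unfolding es12 by (simp add: eval_word_append)
    ultimately show ?thesis
      using w1(1) w2(1) by (intro bexI[of _ "(i, k, w1 @ w2, bits p @ bits q)"]) auto
  qed
  then obtain c where c: "c \<in> set E \<union> set (compositions ?T)" "src c = i" "tgt c = k"
    "set (word c) \<subseteq> {..<B}" "eval_word (word c) = eval_word w"
    by blast
  have "trivial (word c @ inverse_word w)"
    using c(4,5) inverse_word_less[OF wB(1)] by (subst trivial_iff) (auto simp: eval_inverse_eq_one)
  from refine_complete[OF key c(1,2,3) this] show ?case
    by simp
qed simp

lemma split_items_mem:
  "set (fst (split_items its)) \<union> set (snd (split_items its)) = set its"
proof -
  have "set (fst (foldl split_step ([], []) its)) \<union>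
    set (snd (foldl split_step ([], []) its)) = set its"
    by (induction its rule: rev_induct) auto
  then show ?thesis
    unfolding split_items_def .
qed

lemma prepare_words:
  assumes "it \<in> set (prepare x)"
  shows "length (snd it) \<le> D \<and> set (snd it) \<subseteq> {..<B}"
proof -
  have orig: "length (snd it) \<le> D \<and> set (snd it) \<subseteq> {..<B}"
    if "it \<in> set (fst (split_items (map item x))) \<union> set (snd (split_items (map item x)))" for it
  proof -
    have "it \<in> item ` set x"
      using that unfolding split_items_mem by simp
    then show ?thesis
      using item_word by auto
  qed
  consider "it = (True, [])" | "it \<in> set (fst (split_items (map item x)))"
    | it' where "it' \<in> set (snd (split_items (map item x)))" "it = (False, inverse_word (snd it'))"
    using assms by (auto simp: prepare_def)
  then show ?thesis
    using orig length_inverse_word inverse_word_less by cases auto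
qed

lemma edge_words:
  assumes "e \<in> set (snd (edges (prepare x)))"
  shows "length (word e) \<le> D \<and> set (word e) \<subseteq> {..<B}"
proof -
  obtain t l l' where "t < length (prepare x)"
    "word e = (if \<not> fst (prepare x ! t) \<and> l then snd (prepare x ! t) else [])"
    using assms unfolding edges_mem step_edges_mem by auto
  then show ?thesis
    using prepare_words[of "prepare x ! t" x] by auto
qed

text \<open>The first entry found may be taken, since \<open>table_sound\<close> makes its bits a
  genuine selection. If there is none, \<open>table_complete\<close> for the empty word excludes
  every selection with value one.\<close>

lemma solve_selections:
  "(\<exists>b w. (b, w) \<in> selections True (prepare x) \<and> eval_word w = \<one> \<and> solve x = b) \<or>
   (\<not> (\<exists>b w. (b, w) \<in> selections True (prepare x) \<and> eval_word w = \<one>) \<and> solve x = [False])"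
proof -
  let ?its = "prepare x"
  let ?E = "snd (edges ?its)"
  let ?n = "(length ?its, True)"
  let ?P = "\<lambda>e. src e = (0, True) \<and> tgt e = ?n \<and> word e = []"
  let ?l = "concat (map (\<lambda>e. if ?P e then [bits e] else []) (table ?E))"
  have solve: "solve x = (case ?l of [] \<Rightarrow> [False] | b # bs \<Rightarrow> b)"
    by (simp add: solve_def fst_edges)
  have sel: "(\<exists>es. chain ?E (0, True) es ?n \<and> chain_bits es = b \<and> chain_word es = w)
     \<longleftrightarrow> (b, w) \<in> selections True ?its" for b w
    using chain_selections[of 0 ?its] by simp
  have mem: "b \<in> set ?l \<longleftrightarrow> (\<exists>e \<in> set (table ?E). ?P e \<and> bits e = b)" for b
    by auto
  show ?thesis
  proof (cases ?l)
    case Nil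
    have "eval_word w \<noteq> \<one>" if bw: "(b, w) \<in> selections True ?its" for b w
    proof
      assume w: "eval_word w = \<one>"
      obtain es where es: "chain ?E (0, True) es ?n" "chain_word es = w"
        using bw unfolding sel[symmetric] by blast
      have len: "length es = length ?its"
        using chain_length[OF es(1)] by simp
      have "es \<noteq> []"
        using len by (auto simp: prepare_def)
      obtain j where j: "length ?E \<le> 2 ^ j" "short_words ?E = (extend ^^ (c1 * j + c2)) [[]]"
        by (rule short_words_eq)
      have "\<exists>e \<in> set (foldl (\<lambda>T e. refine ?E (keys ?E (short_words ?E)) T) [] ?E).
          src e = (0, True) \<and> tgt e = ?n \<and> word e = []"
      proof (rule table_complete)
        show "length ?E \<le> 2 ^ j"
          by (rule j(1))
        show set_W: "set (short_words ?E) = {w. set w \<subseteq> {..<B} \<and> length w \<le> c1 * j + c2}"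
          unfolding j(2) by (rule set_extend_funpow)
        show "[] \<in> set (short_words ?E)"
          unfolding set_W by simp
        show "length es \<le> length ?E" "length es \<le> length ?E"
          using len length_edges_ge[of ?its] by simp_all
      qed (use es w edge_words \<open>es \<noteq> []\<close> in auto)
      then obtain e where "e \<in> set (table ?E)" "?P e"
        unfolding table_def by blast
      then have "bits e \<in> set ?l"
        unfolding mem by blast
      then show False
        using Nil by simp
    qed
    then show ?thesis
      using solve Nil by auto
  next
    case (Cons b bs)
    then have "b \<in> set ?l"
      by simp
    then obtain e where e: "e \<in> set (table ?E)" "?P e" "bits e = b"
      unfolding mem by blast
    obtain es where es: "chain ?E (src e) es (tgt e)" "eval_word (chain_word es) = eval_word (word e)" "chain_bits es = bits e"
      using table_sound e(1) unfolding table_def by blast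
    then have "(b, chain_word es) \<in> selections True ?its"
      using e unfolding sel[symmetric] by auto
    moreover have "eval_word (chain_word es) = \<one>"
      using es(2) e(2) by simp
    ultimately show ?thesis
      using solve Cons by auto
  qed
qed

end

subsection \<open>Instances of the subset sum problem\<close>

context ssp_solver_correct
begin

lemma prepare_blocks:
  assumes "map item x = blocks us @ map (Pair False) v"
  shows "prepare x = (True, []) # blocks us @ map (Pair False) (rev (map inverse_word v))"
  unfolding prepare_def assms split_items_blocks by (simp add: comp_def rev_map)

lemma eval_inverse_words: "eval_word (concat (rev (map inverse_word v))) = inv (eval_word (concat v))"
proof (induction v)
  case (Cons w v)
  then show ?case
    by (simp add: eval_word_append eval_inverse_word inv_mult_group)
qed simp

text \<open>The leading bit belongs to the separator in front, whose flag is fixed to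
  \<open>True\<close>. The right-hand side is moved back across the equation by
  \<open>eval_inverse_eq_one\<close>.\<close>

lemma solve_blocks:
  assumes "map item x = blocks us @ map (Pair False) v"
  defines "S \<equiv> {b. length b = length us \<and> eval_word (select b us) = eval_word (concat v)}"
  shows "(\<exists>b \<in> S. solve x = True # b) \<or> (S = {} \<and> solve x = [False])"
proof -
  let ?v = "rev (map inverse_word v)"
  have sel: "(b, w) \<in> selections True (prepare x) \<longleftrightarrow>
      (\<exists>b'. b = True # b' \<and> length b' = length us \<and> w = select b' us @ concat ?v)" for b w
    unfolding prepare_blocks[OF assms(1)] selections.simps
    using selections_blocks[of _ _ us ?v] by auto
  have "eval_word (select b us @ concat ?v) = \<one> \<longleftrightarrow> eval_word (select b us) = eval_word (concat v)" for b
    using eval_inverse_eq_one[of "select b us" "concat v"]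
    unfolding eval_word_append eval_inverse_words eval_inverse_word .
  then show ?thesis
    using solve_selections[of x] unfolding sel S_def by auto
qed

end

section \<open>Finite data of the group: numbered generators and the shortening table\<close>

context word_metric
begin

text \<open>Numbers from \<open>B\<close> on stand for the identity and are fixed by
  \<open>iv\<close>, so \<open>val\<close> and \<open>iv\<close> are total and \<open>iv\<close>
  differs from the identity on a finite set only. The length of a letter is at most one rather than
  equal to one, since a generator may be trivial.\<close>

lemma letter_numbering:
  "\<exists>(B :: nat) val iv. (\<forall>i. val i \<in> carrier G) \<and> (\<forall>i. wlen (val i) \<le> 1) \<and>
     (\<forall>g \<in> carrier G. \<exists>w. set w \<subseteq> {..<B} \<and> length w = wlen g \<and> list_prod (map val w) = g) \<and>
     (\<forall>i. val (iv i) = inv (val i)) \<and> (\<forall>i < B. iv i < B) \<and> (\<forall>i. \<not> i < B \<longrightarrow> iv i = i)"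
proof -
  have "finite (letters Y)"
    using fg by (simp add: finite_generating_set_def letters_def)
  then obtain ls where ls: "set ls = letters Y"
    using finite_list by blast
  define B where "B = length ls"
  define val where "val = (\<lambda>i. if i < B then letter_val G (ls ! i) else \<one>)"
  define num where "num = (\<lambda>l. SOME j. j < B \<and> ls ! j = l)"
  define iv where "iv = (\<lambda>i. if i < B then num (inv_letter (ls ! i)) else i)"
  have ls_nth: "ls ! i \<in> letters Y" if "i < B" for i
    using that ls unfolding B_def by (metis nth_mem)
  have num: "num l < B \<and> ls ! num l = l" if "l \<in> letters Y" for l
  proof -
    have "\<exists>j. j < B \<and> ls ! j = l"
      using that ls unfolding B_def by (metis in_set_conv_nth)
    then show ?thesis
      unfolding num_def by (rule someI_ex)
  qed
  have val_num: "val (num l) = letter_val G l" if "l \<in> letters Y" for l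
    using num[OF that] by (simp add: val_def)
  show ?thesis
  proof (intro exI[of _ B] exI[of _ val] exI[of _ iv] conjI allI ballI impI)
    show closed: "val i \<in> carrier G" for i
      using letter_val_closed[OF Y_carrier] ls_nth by (simp add: val_def)
    show "wlen (val i) \<le> 1" for i
      using wlen_le[of "[ls ! i]"] ls_nth[of i] letter_val_closed[OF Y_carrier] by (simp add: val_def)
    show "\<exists>w. set w \<subseteq> {..<B} \<and> length w = wlen g \<and> list_prod (map val w) = g" if g: "g \<in> carrier G" for g
    proof -
      obtain w where w: "w \<in> lists (letters Y)" "length w = wlen g" "word_val G w = g"
        using wlen_word[OF g] by blast
      have "list_prod (map val (map num w)) = word_val G w"
        using w(1) by (induction w) (auto simp: val_num)
      moreover have "set (map num w) \<subseteq> {..<B}"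
        using w(1) num by auto
      ultimately show ?thesis
        using w by (intro exI[of _ "map num w"]) simp
    qed
    show "val (iv i) = inv (val i)" for i
    proof (cases "i < B")
      case True
      then have "inv_letter (ls ! i) \<in> letters Y"
        using ls_nth by simp
      from val_num[OF this] show ?thesis
        using True ls_nth letter_val_inv_letter[OF Y_carrier] by (simp add: iv_def val_def)
    next
      case False
      then show ?thesis
        by (simp add: iv_def val_def)
    qed
    show "iv i < B" if "i < B" for i
      using num[of "inv_letter (ls ! i)"] ls_nth[OF that] that by (simp add: iv_def)
    show "iv i = i" if "\<not> i < B" for i
      using that by (simp add: iv_def)
  qed
qed

text \<open>A word is replaced by a geodesic one only if this is strictly shorter, so equal length
  means that nothing happened. Outside a finite set of words \<open>tab\<close> is the identity, as
  needed to hard-wire it.\<close>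

lemma shortening_table:
  fixes B L :: nat and val :: "nat \<Rightarrow> 'a"
  assumes val: "\<forall>i. val i \<in> carrier G"
    "\<forall>g \<in> carrier G. \<exists>w. set w \<subseteq> {..<B} \<and> length w = wlen g \<and> list_prod (map val w) = g"
  shows "\<exists>tab. (\<forall>u. length (tab u) \<le> length u) \<and> (\<forall>u. set (tab u) \<subseteq> set u \<union> {..<B}) \<and>
     (\<forall>u. list_prod (map val (tab u)) = list_prod (map val u)) \<and>
     (\<forall>u. length (tab u) = length u \<longrightarrow> tab u = u) \<and>
     (\<forall>u. set u \<subseteq> {..<B} \<longrightarrow> length u \<le> L \<longrightarrow> wlen (list_prod (map val u)) < length u \<longrightarrow>
        length (tab u) < length u) \<and>
     (\<forall>u. \<not> (set u \<subseteq> {..<B} \<and> length u \<le> L) \<longrightarrow> tab u = u)"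
proof -
  have "\<exists>w. set w \<subseteq> {..<B} \<and> length w = wlen (list_prod (map val u)) \<and> list_prod (map val w) = list_prod (map val u)" for u
    using val(1) by (intro val(2)[rule_format] list_prod_closed) auto
  then obtain geo where geo: "\<And>u. set (geo u) \<subseteq> {..<B}" "\<And>u. length (geo u) = wlen (list_prod (map val u))"
    "\<And>u. list_prod (map val (geo u)) = list_prod (map val u)"
    by metis
  define tab where "tab = (\<lambda>u. if set u \<subseteq> {..<B} \<and> length u \<le> L \<and> wlen (list_prod (map val u)) < length u
     then geo u else u)"
  show ?thesis
    by (rule exI[of _ tab]) (use geo in \<open>auto simp: tab_def split: if_splits\<close>)
qed

end

lemma concat_encode:
  "map item (map idx (encode_instance (ws, w))) =
     concat (map (\<lambda>w. map (\<lambda>l. item (idx (Letter l))) w @ [item (idx Sep)]) ws) @ map (\<lambda>l. item (idx (Letter l))) w"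
  by (simp add: encode_instance_def map_concat comp_def)

lemma (in group) subset_product_select:
  assumes "\<And>w. w \<in> set ws \<Longrightarrow> list_prod (map val (concat (map r w))) = word_val G w"
    and "\<And>i. val i \<in> carrier G" "length b = length ws"
  shows "list_prod (map val (select b (map (map r) ws))) = subset_product G (map (word_val G) ws) b"
  using assms(3,1)
proof (induction b ws rule: list_induct2)
  case (Cons l b w ws)
  have closed: "set (map val u) \<subseteq> carrier G" for u
    using assms(2) by auto
  have w: "list_prod (map val (concat (map r w))) = word_val G w"
    using Cons.prems[of w] by simp
  then have "word_val G w \<in> carrier G"
    using list_prod_closed[OF closed] by metis
  moreover have "list_prod (map val (select b (map (map r) ws))) = subset_product G (map (word_val G) ws) b"
    using Cons by simp
  ultimately show ?case
    using w list_prod_append[OF closed closed] list_prod_closed[OF closed, of "select b (map (map r) ws)"]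
    by (cases l) (simp_all add: nat_pow_def)
qed simp

text \<open>The metric is that of \<open>Y\<close>, while instances are written over
  \<open>X\<close>: \<open>item\<close> spells each letter of \<open>X\<close> as a word over
  \<open>Y\<close>, so that an edge may have a label of length up to \<open>D\<close>.\<close>

theorem corollary5p9:
  fixes G :: "('a, 'm) monoid_scheme" and X :: "'a set"
  assumes "hyperbolic_group G"
    and "finite_generating_set G X"
  shows "ssp_search_poly_time G X"
proof -
  obtain Y \<delta> where "group G" "finite_generating_set G Y" "gromov_hyperbolic (carrier G) (word_dist G Y) \<delta>"
    using assms(1) unfolding hyperbolic_group_def by blast
  then interpret hyperbolic_metric G Y \<delta>
    by (intro hyperbolic_metric.intro word_metric.intro word_metric_axioms.intro hyperbolic_metric_axioms.intro)
  interpret tape_alphabet "ssp_alphabet X" .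
  have X: "finite X" "X \<subseteq> carrier G"
    using assms(2) by (simp_all add: finite_generating_set_def)
  then have fin: "finite (letters X)" "finite (ssp_alphabet X)"
    by (simp_all add: letters_def ssp_alphabet_def)
  obtain B :: nat and val iv where "\<forall>i. val i \<in> carrier G" "\<forall>i. wlen (val i) \<le> 1"
    "\<forall>g \<in> carrier G. \<exists>w. set w \<subseteq> {..<B} \<and> length w = wlen g \<and> list_prod (map val w) = g"
    and "\<forall>i. val (iv i) = inv\<^bsub>G\<^esub> (val i)" "\<forall>i < B. iv i < B" "\<forall>i. \<not> i < B \<longrightarrow> iv i = i"
    using letter_numbering by (elim exE conjE) (rule that, assumption+)
  note numbering = this
  note val = this(1-3)[rule_format] and iv = this(4-6)[rule_format]
  \<comment> \<open>The summand 1 makes the inequality for \<open>h\<close> strict and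
    \<open>h\<close> positive, also when \<delta> is 0.\<close>
  define h where "h = nat \<lceil>2 * \<delta>\<rceil> + 1"
  have h: "2 * \<delta> < real h" "1 \<le> h"
    unfolding h_def by linarith+
  obtain tab where "\<forall>u. length (tab u) \<le> length u" "\<forall>u. set (tab u) \<subseteq> set u \<union> {..<B}"
    "\<forall>u. list_prod (map val (tab u)) = list_prod (map val u)"
    "\<forall>u. length (tab u) = length u \<longrightarrow> tab u = u"
    "\<forall>u. set u \<subseteq> {..<B} \<longrightarrow> length u \<le> 2 * h \<longrightarrow> wlen (list_prod (map val u)) < length u \<longrightarrow>
      length (tab u) < length u"
    "\<forall>u. \<not> (set u \<subseteq> {..<B} \<and> length u \<le> 2 * h) \<longrightarrow> tab u = u"
    using shortening_table[OF numbering(1,3), of "2 * h"] by (elim exE conjE) (rule that, assumption+)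
  note tab = this[rule_format]
  have "\<forall>l \<in> letters X. \<exists>w. set w \<subseteq> {..<B} \<and> list_prod (map val w) = letter_val G l"
    using val(3) letter_val_closed[OF X(2)] by blast
  then obtain rep where rep: "\<And>l. l \<in> letters X \<Longrightarrow> set (rep l) \<subseteq> {..<B}"
    "\<And>l. l \<in> letters X \<Longrightarrow> list_prod (map val (rep l)) = letter_val G l"
    by metis
  obtain idx :: "'a ssp_sym \<Rightarrow> nat" where idx: "inj_on idx (ssp_alphabet X)"
    using finite_imp_inj_to_nat_seg[OF fin(2)] by blast
  define letter_of where "letter_of n = (THE l. l \<in> letters X \<and> idx (Letter l) = n)" for n
  \<comment> \<open>Every number that is not a letter is decoded as a separator. This covers
    \<open>Sep\<close> and makes \<open>item\<close> a finite table with a constant default.\<close>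
  define item where "item = (\<lambda>n. if n \<in> (\<lambda>l. idx (Letter l)) ` letters X then (False, rep (letter_of n)) else (True, []))"
  have idx_eq: "idx (Letter l) = idx (Letter l') \<longleftrightarrow> l = l'" "idx (Letter l) \<noteq> idx Sep"
    if "l \<in> letters X" "l' \<in> letters X" for l l'
    using that inj_onD[OF idx, of "Letter l" "Letter l'"] inj_onD[OF idx, of "Letter l" Sep]
    by (auto simp: ssp_alphabet_def)
  have letter_of: "letter_of (idx (Letter l)) = l" if "l \<in> letters X" for l
    unfolding letter_of_def using that idx_eq(1) by (intro the_equality) auto
  have item_Letter: "item (idx (Letter l)) = (False, rep l)" if "l \<in> letters X" for l
    using that letter_of[OF that] by (simp add: item_def)
  have item_Sep: "item (idx Sep) = (True, [])"
    using idx_eq(2) unfolding item_def by fastforce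
  \<comment> \<open>The sum serves as a common bound on the lengths of all spellings.\<close>
  define D where "D = (\<Sum>l \<in> letters X. length (rep l))"
  have item_word: "length (snd (item n)) \<le> D \<and> set (snd (item n)) \<subseteq> {..<B}" for n
  proof (cases "n \<in> (\<lambda>l. idx (Letter l)) ` letters X")
    case True
    then obtain l where l: "l \<in> letters X" "n = idx (Letter l)"
      by blast
    have "length (rep l) \<le> D"
      unfolding D_def using fin(1) l(1) by (intro member_le_sum) auto
    then show ?thesis
      using item_Letter[OF l(1)] l rep(1) by simp
  qed (auto simp: item_def)
  have ptime_tab: "ptime tab"
  proof -
    have "finite {u. set u \<subseteq> {..<B} \<and> length u \<le> 2 * h}"
      by (intro finite_lists_length_le) simp
    from ptime_finite_table[OF this ptime_id, of tab]
    have "ptime (\<lambda>u. if u \<in> {u. set u \<subseteq> {..<B} \<and> length u \<le> 2 * h} then tab u else u)" .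
    moreover have "(\<lambda>u. if u \<in> {u. set u \<subseteq> {..<B} \<and> length u \<le> 2 * h} then tab u else u) = tab"
      using tab(6) by (intro ext) simp
    ultimately show ?thesis
      by simp
  qed
  have ptime_iv: "ptime iv"
  proof -
    have "ptime (\<lambda>i. if i \<in> {..<B} then iv i else i)"
      by (rule ptime_finite_table[OF _ ptime_id]) simp
    moreover have "(\<lambda>i. if i \<in> {..<B} then iv i else i) = iv"
      using iv(3) by (intro ext) simp
    ultimately show ?thesis
      by simp
  qed
  have ptime_item: "ptime item"
    unfolding item_def by (rule ptime_finite_table[OF _ ptime_const]) (simp add: fin)
  define c1 where "c1 = nat \<lceil>2 * \<delta>\<rceil>"
  have c1: "2 * \<delta> \<le> real c1"
    unfolding c1_def by linarith
  interpret ssp_solver_correct G Y \<delta> "ssp_alphabet X" tab iv item "2 * h" B c1 "3 * D + 3" val h D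
    by unfold_locales
      (use ptime_tab ptime_iv ptime_item tab val iv h c1 item_word in blast)+
  have eval_word_val: "eval_word (concat (map rep w)) = word_val G w" if "w \<in> lists (letters X)" for w
    using that
  proof (induction w)
    case (Cons l w)
    then have "eval_word (rep l) = letter_val G l"
      using rep(2) by (simp add: eval_word_def)
    then show ?case
      using Cons by (simp add: eval_word_append)
  qed simp
  have answer: "\<exists>ans. ssp_correct_answer G i ans \<and>
      encode_answer ans = map Bit (solve (map idx (encode_instance i)))" if inst: "i \<in> ssp_instances X" for i
  proof -
    obtain ws w where i: "i = (ws, w)" "ws \<in> lists (lists (letters X))" "w \<in> lists (letters X)"
      using inst unfolding ssp_instances_def by blast
    let ?x = "map idx (encode_instance (ws, w))"
    let ?S = "{b. length b = length ws \<and> subset_product G (map (word_val G) ws) b = word_val G w}"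
    have letters: "map (\<lambda>l. item (idx (Letter l))) u = map (Pair False) (map rep u)" if "u \<in> lists (letters X)" for u
      using that item_Letter by auto
    have "concat (map (\<lambda>u. map (\<lambda>l. item (idx (Letter l))) u @ [item (idx Sep)]) ws) = blocks (map (map rep) ws)"
      unfolding item_Sep using i(2) letters by (induction ws) auto
    then have x: "map item ?x = blocks (map (map rep) ws) @ map (Pair False) (map rep w)"
      unfolding concat_encode letters[OF i(3)] by simp
    have select: "eval_word (select b (map (map rep) ws)) = subset_product G (map (word_val G) ws) b"
      if "length b = length ws" for b
      unfolding eval_word_def
      by (rule subset_product_select) (use eval_word_val i(2) that in \<open>auto simp: eval_word_def\<close>)
    have "{b. length b = length (map (map rep) ws) \<and>
        eval_word (select b (map (map rep) ws)) = eval_word (concat (map rep w))} = ?S"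
      using select eval_word_val[OF i(3)] by auto
    with solve_blocks[OF x] consider b where "b \<in> ?S" "solve ?x = True # b" | "?S = {}" "solve ?x = [False]"
      by auto
    then show ?thesis
    proof cases
      case 1
      then show ?thesis
        unfolding i(1) by (intro exI[of _ "Some b"]) (simp add: ssp_solution_def)
    next
      case 2
      then have "\<not> ssp_solution G (ws, w) b" for b
        by (auto simp: ssp_solution_def)
      then show ?thesis
        using 2(2) unfolding i(1) by (intro exI[of _ None]) simp
    qed
  qed
  have "range Bit \<subseteq> ssp_alphabet X"
    by (auto simp: ssp_alphabet_def image_iff)
  from ptime_machine[OF ptime_solve fin(2) this, of idx] obtain M p where M: "wf_TM (ssp_alphabet X) M"
    "\<And>x. x \<in> lists (ssp_alphabet X) \<Longrightarrow>
      \<exists>t \<le> poly p (length x). TM_outputs_after M x t (map Bit (solve (map idx x)))"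
    by blast
  have "encode_instance i \<in> lists (ssp_alphabet X)" if "i \<in> ssp_instances X" for i
  proof -
    have "set (encode_instance i) = (\<Union>u \<in> set (fst i). insert Sep (Letter ` set u)) \<union> Letter ` set (snd i)"
      by (auto simp: encode_instance_def)
    moreover have "fst i \<in> lists (lists (letters X))" "snd i \<in> lists (letters X)"
      using that by (auto simp: ssp_instances_def)
    then have "(\<Union>u \<in> set (fst i). set u) \<subseteq> letters X" "set (snd i) \<subseteq> letters X"
      unfolding lists_eq_set by auto
    ultimately have "set (encode_instance i) \<subseteq> insert Sep (Letter ` letters X)"
      by auto
    then show ?thesis
      unfolding in_lists_conv_set ssp_alphabet_def by blast
  qed
  then have "\<exists>ans t. ssp_correct_answer G i ans \<and> t \<le> poly p (length (encode_instance i)) \<and>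
      TM_outputs_after M (encode_instance i) t (encode_answer ans)" if "i \<in> ssp_instances X" for i
    using M(2)[of "encode_instance i"] answer[OF that] that by metis
  then show ?thesis
    unfolding ssp_search_poly_time_def poly_time_search_def using M(1) by blast
qed

end
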